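(* Let $\omega=\omega_1\cdots\omega_s$ on $[-1,1]$, where the function $t\mapsto\omega_i(\cos t)$ belongs to $\Omega$ for $i=1,\dots,s$, and let $u$ be an $A^*$ weight on $[-1,1]$. Then there exists a constant $C=C(\omega,u)$ such that for every integer $n\ge1$ and every algebraic polynomial $P_n$ of degree at most $n$, $$\|P_n'\,\omega u\|_{L_\infty[-1,1]}\le C\,n^2\,\|P_n\,\omega u\|_{L_\infty[-1,1]}.$$
   Context: $\mathbb{T}=\mathbb{R}/2\pi\mathbb{Z}$. Weights on $[-1,1]$ are nonnegative integrable functions $[-1,1]\to[0,\infty)$. A weight $u$ on $[-1,1]$ satisfies the $A^*$ condition if there is a constant $L$ such that $u(x)\le\frac{L}{|I|}\int_Iu$ for all intervals $I\subset[-1,1]$ and all $x\in I$. Class $\Omega$: a function $w$ on $\mathbb{T}$ belongs to $\Omega$ if $w(t)=\exp(-F(g(t)))$, $t\in\mathbb{T}$ (with $w(t)=0$ where $g(t)=0$), where for some $A>0$: - $g:\mathbb{T}\to[-A,A]$ is real analytic, i.e. for some $D>0$, $|g^{(n)}(t)|\le D^n n!$ for all $t\in\mathbb{T}$, $n\ge 1$; each zero of $g$ has multiplicity one; and $g$ has at least one zero on $\mathbb{T}$; - $F:[-A,A]\setminus\{0\}\to(0,\infty)$ is even, $C^\infty$ on $(0,A]$, and satisfies: (F1) $F(x)\to\infty$ as $x\to0+$; (F2) $F$ is decreasing on $(0,A]$; (F3) for some $B>0$, $|F^{(n)}(x)|\le B^n n^n F(x)/x^n$ for $x\in(0,A]$,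 $n=1,2,\dots$; (F4) there exist $A_1,A_2>0$ with $A_2\le |F'(x)|x/F(x)\le A_1$ for $x\in(0,A]$. *)

theory Defs
  imports "HOL-Probability.Essential_Supremum" "HOL-Computational_Algebra.Polynomial"
begin

(* D 0, D 1, D 2, ... are the successive derivatives on S of the infinitely differentiable
   function f; they are one-sided at an endpoint belonging to S. When S has no isolated points
   (below: the whole line, or an interval (0,A]), D is determined on S by f. *)
definition derivs_on :: "real set \<Rightarrow> (real \<Rightarrow> real) \<Rightarrow> (nat \<Rightarrow> real \<Rightarrow> real) \<Rightarrow> bool" where
  "derivs_on S f D \<longleftrightarrow>
     (\<forall>x\<in>S. D 0 x = f x) \<and>
     (\<forall>n. \<forall>x\<in>S. (D n has_real_derivative D (Suc n) x) (at x within S))"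

(* Functions on the circle R/2 pi Z are 2 pi-periodic functions on the real line.
   A zero t of g has multiplicity one iff g'(t) is nonzero. *)
definition Omega_inner :: "real \<Rightarrow> (real \<Rightarrow> real) \<Rightarrow> bool" where
  "Omega_inner A g \<longleftrightarrow>
     (\<forall>t. g (t + 2 * pi) = g t) \<and>
     (\<forall>t. g t \<in> {-A..A}) \<and>
     (\<exists>G. derivs_on UNIV g G \<and>
          (\<exists>D>0. \<forall>n\<ge>1. \<forall>t. \<bar>G n t\<bar> \<le> D ^ n * fact n) \<and>
          (\<forall>t. g t = 0 \<longrightarrow> G 1 t \<noteq> 0)) \<and>
     (\<exists>t. g t = 0)"

(* Only the values of F on [-A,A] minus {0} are relevant. *)
definition Omega_outer :: "real \<Rightarrow> (real \<Rightarrow> real) \<Rightarrow> bool" where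
  "Omega_outer A F \<longleftrightarrow>
     (\<forall>x\<in>{-A..A} - {0}. F x > 0 \<and> F (- x) = F x) \<and>
     filterlim F at_top (at_right 0) \<and>
     antimono_on {0<..A} F \<and>
     (\<exists>\<Phi>. derivs_on {0<..A} F \<Phi> \<and>
          (\<exists>B>0. \<forall>n\<ge>1. \<forall>x\<in>{0<..A}. \<bar>\<Phi> n x\<bar> \<le> B ^ n * real n ^ n * F x / x ^ n) \<and>
          (\<exists>A1>0. \<exists>A2>0. \<forall>x\<in>{0<..A}.
             A2 \<le> \<bar>\<Phi> 1 x\<bar> * x / F x \<and> \<bar>\<Phi> 1 x\<bar> * x / F x \<le> A1))"

definition Omega :: "(real \<Rightarrow> real) set" where
  "Omega = {w. \<exists>A>0. \<exists>g F. Omega_inner A g \<and> Omega_outer A F \<and>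
                 (\<forall>t. w t = (if g t = 0 then 0 else exp (- F (g t))))}"

definition weight :: "(real \<Rightarrow> real) \<Rightarrow> bool" where
  "weight u \<longleftrightarrow> (\<forall>x\<in>{-1..1}. 0 \<le> u x) \<and> set_integrable lebesgue {-1..1} u"

(* Degenerate intervals, for which the mean value makes no sense, are excluded. *)
definition A_star_weight :: "(real \<Rightarrow> real) \<Rightarrow> bool" where
  "A_star_weight u \<longleftrightarrow> weight u \<and>
     (\<exists>L. \<forall>I. is_interval I \<and> I \<subseteq> {-1..1} \<and> measure lebesgue I > 0 \<longrightarrow>
            (\<forall>x\<in>I. u x \<le> L / measure lebesgue I * (LINT y:I|lebesgue. u y)))"

definition Linf_norm :: "(real \<Rightarrow> complex) \<Rightarrow> ereal" where
  "Linf_norm f = esssup (lebesgue_on {-1..1}) (\<lambda>x. ereal (norm (f x)))"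

end

theory Submission
  imports Defs "HOL-Complex_Analysis.Conformal_Mappings"
begin

text \<open>
  Substitute \<open>x = cos t\<close> and let \<open>f t = P (cos t)\<close>, an entire function of exponential type
  \<open>n\<close>, so that \<open>f w * exp (\<i> * n * w)\<close> is bounded in the upper half plane.  Off the union \<open>Z\<close> of
  the zero sets the weight \<open>\<Prod>i. \<omega> i (cos t)\<close> is \<open>exp (1 - H t)\<close>, where \<open>H = 1 + \<Sum>i. F i (g i t)\<close>.
  Besides the separation of the points of \<open>Z\<close> and the boundedness of \<open>H\<close> away from them, two features
  matter.  First, \<open>H\<close> lies below a parabola tangent to it at any point \<open>t\<close>: if \<open>d \<le> 1\<close> is at
  most the distance from \<open>t\<close> to \<open>Z\<close>, then \<open>\<bar>H'\<bar> \<le> C * H / d\<close> and \<open>\<bar>H''\<bar> \<le> C * H / d\<^sup>2\<close> there.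
  Secondly, \<open>H\<close> decays at least like a power of the distance to a zero.  These properties are
  collected in the locale \<open>singular_exponent\<close>.

  Bounds for \<open>f\<close> at complex points come from the maximum principle applied to \<open>f\<close> times explicit
  multipliers \<open>exp (A * \<zeta>)\<close>, where \<open>\<zeta> w = (w - t) / (w - t + \<i> * d)\<close> maps the upper half
  plane into a disc (\<open>weighted_max_principle_upper\<close>).  On the real line \<open>Re \<zeta>\<close> is a parabola
  near \<open>t\<close> and of order one at distance more than \<open>d\<close>, so a multiplier with \<open>A\<close> of order \<open>- n * d\<close>
  absorbs the quadratic remainder of the tangent estimate as well as everything far away, while
  it costs only a bounded factor for \<open>\<bar>w - t\<bar> \<le> 1 / n\<close>.

  At a zero \<open>z\<close> the exponent \<open>H\<close> need not be integrable and has to be truncated.  Let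
  \<open>\<delta> z\<close> be the critical scale, defined by \<open>H (z + \<delta> z) = K * n * \<delta> z\<close> with a large constant \<open>K\<close>, and
  replace \<open>H\<close> within distance \<open>\<delta> z\<close> of \<open>z\<close> by a constant comparable to \<open>K * n * \<delta> z\<close>, for every \<open>z\<close> in
  \<open>Z\<close>; call the result \<open>h\<close>.  If \<open>\<bar>f\<bar>\<close>
  is at most \<open>S * exp h\<close> divided by an auxiliary weight \<open>v\<close> on the real line, then:
  away from the zeros \<open>\<bar>f\<bar>\<close> is bounded by a multiple of the same quantity on complex discs of radius
  comparable to \<open>1 / n\<close> (\<open>disc_bound_away_from_zeros\<close>); near a zero \<open>\<bar>f\<bar>\<close> is exponentially smaller than
  the truncated bound permits (\<open>disc_bound_near_zero\<close>), because seen from distance \<open>R * \<delta> z\<close>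
  with \<open>R\<close> large the short interval has small harmonic measure and \<open>H\<close> has decayed outside it.  Hence the
  supremum \<open>S\<close> of \<open>\<bar>f\<bar> * v * exp (- h)\<close> is nearly attained only where \<open>h = H\<close>; this is
  the content of \<open>weighted_bernstein\<close>.

  The \<open>A\<^sup>*\<close> weight \<open>u\<close> enters through \<open>v\<close>, the least majorant of \<open>u (cos t)\<close> that varies
  by at most polynomial factors at scale \<open>1 / n\<close>.  The \<open>A\<^sup>*\<close> condition makes \<open>u\<close> doubling,
  and so every interval of length comparable to \<open>1 / n\<close> around \<open>t\<close> has points outside any given null set
  where \<open>u (cos t')\<close> is comparable to \<open>v t\<close> (\<open>A_star_cos_doubling\<close>).  At a point where \<open>S\<close> is nearly
  attained \<open>\<bar>f\<bar>\<close> and \<open>H\<close> are stable at that scale, and comparison with such a point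
  bounds \<open>S\<close> by the essential supremum of \<open>P\<close> times the original weight.  Finally \<open>P' (cos t) = - f' t / sin t\<close>,
  and Cauchy estimates in discs of radius comparable to \<open>1 / n\<close>, with the maximum principle near
  the zeros of the sine, give the factor \<open>n\<^sup>2\<close> (\<open>markov_of_disc\<close>).
\<close>

section \<open>Maximum principles with multipliers\<close>

text \<open>
  The factor \<open>\<i> / (e * w + \<i>)\<close> has modulus at most one in the half plane and tends to
  zero at infinity, so the maximum principle on a large half disc applies to the product; then \<open>e\<close>
  tends to zero.
\<close>

lemma phragmen_lindelof_half_plane:
  assumes hol: "G holomorphic_on {w. 0 < Im w}"
    and cont: "continuous_on {w. 0 \<le> Im w} G"
    and bounded: "\<And>w. 0 \<le> Im w \<Longrightarrow> norm (G w) \<le> M"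
    and real: "\<And>x::real. norm (G (of_real x)) \<le> B"
    and w: "0 \<le> Im w"
  shows "norm (G w) \<le> B"
proof -
  have "0 \<le> M" using order_trans[OF norm_ge_zero bounded[of 0]] by simp
  have "0 \<le> B" using order_trans[OF norm_ge_zero real[of 0]] by simp
  have lower: "e * norm v \<le> norm (of_real e * v + \<i>)" and nz: "of_real e * v + \<i> \<noteq> 0"
    and lower1: "1 \<le> norm (of_real e * v + \<i>)"
    if "0 < e" "0 \<le> Im v" for e :: real and v :: complex
  proof -
    have "(e * norm v)\<^sup>2 \<le> (norm (of_real e * v + \<i>))\<^sup>2"
      using that by (simp add: cmod_power2 power_mult_distrib) (simp add: power2_sum power_mult_distrib algebra_simps)
    then show "e * norm v \<le> norm (of_real e * v + \<i>)"
      by (rule power2_le_imp_le) simp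
    have "1 \<le> Im (of_real e * v + \<i>)" using that by simp
    then show "1 \<le> norm (of_real e * v + \<i>)" using abs_Im_le_cmod order_trans abs_ge_self by metis
    then show "of_real e * v + \<i> \<noteq> 0" by fastforce
  qed
  have key: "norm (G w) \<le> B' * (1 + e * norm w)" if "B < B'" "0 < e" for B' e
  proof -
    have "0 < B'" using that \<open>0 \<le> B\<close> by simp
    define \<rho> where "\<rho> = max (M / (e * B')) (norm w) + 1"
    have \<rho>: "0 < \<rho>" "norm w < \<rho>" "M \<le> e * \<rho> * B'"
    proof -
      show "0 < \<rho>" "norm w < \<rho>" unfolding \<rho>_def using norm_ge_zero[of w] by linarith+
      have "M / (e * B') \<le> \<rho>" unfolding \<rho>_def by linarith
      then show "M \<le> e * \<rho> * B'" using \<open>0 < B'\<close> that by (simp add: field_simps)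
    qed
    define S where "S = {v. 0 \<le> Im v} \<inter> cball 0 \<rho>"
    have clS: "closed S" unfolding S_def by (intro closed_Int closed_halfspace_Im_ge closed_cball)
    have intS: "interior S \<subseteq> {v. 0 < Im v}"
    proof
      fix v assume "v \<in> interior S"
      then obtain r where r: "0 < r" "cball v r \<subseteq> S" using mem_interior_cball by blast
      then have "v - \<i> * of_real r \<in> S" by (auto simp: dist_norm norm_mult)
      then show "v \<in> {v. 0 < Im v}" using r unfolding S_def by simp
    qed
    define g where "g = (\<lambda>v. G v * (\<i> / (of_real e * v + \<i>)))"
    have normi: "norm (\<i> / (of_real e * v + \<i>)) = 1 / norm (of_real e * v + \<i>)" for v
      by (simp add: norm_divide)
    have "norm (g w) \<le> B'"
    proof (rule maximum_modulus_frontier[of g S])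
      have "interior S \<subseteq> {w. 0 < Im w}" by (rule intS)
      moreover have "of_real e * v + \<i> \<noteq> 0" if "v \<in> interior S" for v
        using nz[of e v] \<open>0 < e\<close> intS that by auto
      ultimately show "g holomorphic_on interior S"
        unfolding g_def
        by (intro holomorphic_intros holomorphic_on_subset[OF hol])
      have "continuous_on S g"
        unfolding g_def using nz that(2)
        by (intro continuous_intros continuous_on_subset[OF cont]) (auto simp: S_def)
      then show "continuous_on (closure S) g" using clS by simp
      show "bounded S" unfolding S_def by (simp add: bounded_Int)
      show "w \<in> S" using w \<rho> unfolding S_def by simp
      fix v assume v: "v \<in> frontier S"
      have vS: "v \<in> S" using v clS frontier_subset_closed by blast
      have "Im v = 0 \<or> norm v = \<rho>"
      proof (rule ccontr)
        assume "\<not> ?thesis"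
        then have "v \<in> {v. 0 < Im v} \<inter> ball 0 \<rho>" using vS unfolding S_def by auto
        moreover have "open ({v. 0 < Im v} \<inter> ball 0 \<rho>)" by (intro open_Int open_halfspace_Im_gt open_ball)
        moreover have "{v. 0 < Im v} \<inter> ball 0 \<rho> \<subseteq> S" unfolding S_def by auto
        ultimately have "v \<in> interior S" by (meson interiorI)
        with v show False unfolding frontier_def by simp
      qed
      then show "norm (g v) \<le> B'"
      proof
        assume "Im v = 0"
        then have "v = of_real (Re v)" by (simp add: complex_eq_iff)
        then have "norm (G v) \<le> B" using real by metis
        moreover have "1 / norm (of_real e * v + \<i>) \<le> 1" using lower1[of e v] that \<open>Im v = 0\<close> by (simp add: divide_simps)
        ultimately have "norm (G v) * (1 / norm (of_real e * v + \<i>)) \<le> B * 1"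
          by (intro mult_mono) (use \<open>0 \<le> B\<close> in auto)
        then show ?thesis unfolding g_def norm_mult normi using that by linarith
      next
        assume nv: "norm v = \<rho>"
        have Im: "0 \<le> Im v" using vS unfolding S_def by simp
        have "0 < e * \<rho>" using that \<rho> by simp
        have "norm (G v) / norm (of_real e * v + \<i>) \<le> M / (e * \<rho>)"
          by (intro frac_le bounded Im \<open>0 \<le> M\<close> \<open>0 < e * \<rho>\<close>) (use lower[of e v] Im that nv in auto)
        also have "\<dots> \<le> B'" using \<rho> \<open>0 < e * \<rho>\<close> by (simp add: field_simps)
        finally show ?thesis unfolding g_def norm_mult normi by simp
      qed
    qed
    then have "norm (G w) \<le> B' * norm (of_real e * w + \<i>)"
      unfolding g_def norm_mult normi using nz[of e w] that w by (simp add: divide_simps)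
    also have "norm (of_real e * w + \<i>) \<le> 1 + e * norm w"
      using norm_triangle_ineq[of "of_real e * w" \<i>] that by (simp add: norm_mult)
    finally show ?thesis using \<open>0 < B'\<close> by simp
  qed
  have "((\<lambda>e. (B + e) * (1 + e * norm w)) \<longlongrightarrow> (B + 0) * (1 + 0 * norm w)) (at_right 0)"
    by (intro tendsto_intros)
  moreover have "\<forall>\<^sub>F e in at_right 0. norm (G w) \<le> (B + e) * (1 + e * norm w)"
    by (rule eventually_mono[OF eventually_at_right_less]) (use key in auto)
  ultimately show ?thesis
    using tendsto_lowerbound[of _ _ "at_right (0::real)" "norm (G w)"] by fastforce
qed

text \<open>
  A Moebius transformation of the upper half plane into the disc with diameter \<open>{0..1}\<close>, sending \<open>t\<close>
  to \<open>0\<close> and infinity to \<open>1\<close>.  Its real part on the real line is one minus a Poisson kernel at height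
  \<open>d\<close>, normalised to have maximum one.
\<close>

definition half_plane_map :: "real \<Rightarrow> real \<Rightarrow> complex \<Rightarrow> complex" where
  "half_plane_map t d w = (w - of_real t) / (w - of_real t + \<i> * of_real d)"

lemma
  assumes "0 < d" "0 \<le> Im w"
  shows half_plane_map_denominator_nz: "w - of_real t + \<i> * of_real d \<noteq> 0"
    and norm_half_plane_map_le_1: "norm (half_plane_map t d w) \<le> 1"
    and norm_half_plane_map_le: "norm (half_plane_map t d w) \<le> norm (w - of_real t) / d"
    and norm_half_plane_map_comp_le: "norm (w - of_real t) > d \<Longrightarrow>
      norm (1 - half_plane_map t d w) \<le> d / (norm (w - of_real t) - d)"
    and norm_half_plane_map_comp_ge:
      "d / (norm (w - of_real t) + d) \<le> norm (1 - half_plane_map t d w)"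
    and norm_half_plane_map_comp_le_1: "norm (1 - half_plane_map t d w) \<le> 1"
proof -
  let ?v = "w - of_real t"
  let ?u = "w - of_real t + \<i> * of_real d"
  have "d \<le> Im ?u" using assms by simp
  then have du: "d \<le> norm ?u" using abs_Im_le_cmod order_trans abs_ge_self by metis
  then show nz: "?u \<noteq> 0" using assms by fastforce
  have "(norm ?v)\<^sup>2 \<le> (norm ?u)\<^sup>2"
    using assms unfolding cmod_power2 by (simp add: power2_eq_square algebra_simps)
  then have vu: "norm ?v \<le> norm ?u" by (rule power2_le_imp_le) simp
  have 1: "1 - half_plane_map t d w = \<i> * of_real d / ?u"
    using nz by (simp add: half_plane_map_def field_simps)
  have 2: "norm (1 - half_plane_map t d w) = d / norm ?u"
    unfolding 1 using assms by (simp add: norm_divide norm_mult)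
  have pos: "0 < norm ?u" using nz by simp
  show "norm (half_plane_map t d w) \<le> 1"
    unfolding half_plane_map_def norm_divide using vu pos by (simp add: divide_simps)
  show "norm (half_plane_map t d w) \<le> norm ?v / d"
    unfolding half_plane_map_def norm_divide using du assms pos by (intro divide_left_mono mult_pos_pos) auto
  have ud: "norm ?u \<le> norm ?v + d"
    using norm_triangle_ineq[of ?v "\<i> * of_real d"] assms by (simp add: norm_mult)
  have ud2: "norm ?v - d \<le> norm ?u"
    using norm_diff_ineq[of ?v "\<i> * of_real d"] assms by (simp add: norm_mult)
  show "norm ?v > d \<Longrightarrow> norm (1 - half_plane_map t d w) \<le> d / (norm ?v - d)"
    unfolding 2 using ud2 assms pos by (intro divide_left_mono mult_pos_pos) auto
  show "d / (norm ?v + d) \<le> norm (1 - half_plane_map t d w)"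
    unfolding 2 using ud assms pos by (intro divide_left_mono mult_pos_pos add_nonneg_pos) auto
  show "norm (1 - half_plane_map t d w) \<le> 1"
    unfolding 2 using du assms pos by (simp add: divide_simps)
qed

lemma half_plane_map_of_real:
  assumes "0 < d"
  shows "half_plane_map t d (of_real x) =
    Complex ((x - t)\<^sup>2 / ((x - t)\<^sup>2 + d\<^sup>2)) (- (d * (x - t)) / ((x - t)\<^sup>2 + d\<^sup>2))"
proof -
  have "half_plane_map t d (of_real x) = of_real (x - t) / Complex (x - t) d"
    by (simp add: half_plane_map_def Complex_eq)
  then show ?thesis
    by (simp add: complex_eq_iff Re_divide Im_divide power2_eq_square mult.commute)
qed

lemma norm_half_plane_map_comp_of_real:
  assumes "0 < d"
  shows "norm (1 - half_plane_map t d (of_real x)) = d / sqrt ((x - t)\<^sup>2 + d\<^sup>2)"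
proof -
  have "of_real x - of_real t + \<i> * of_real d \<noteq> (0::complex)"
    using half_plane_map_denominator_nz[of d "of_real x" t] assms by simp
  then have "1 - half_plane_map t d (of_real x) = \<i> * of_real d / (of_real x - of_real t + \<i> * of_real d)"
    by (simp add: half_plane_map_def field_simps)
  then have "norm (1 - half_plane_map t d (of_real x)) = norm (\<i> * of_real d / (of_real x - of_real t + \<i> * of_real d))"
    by (simp only:)
  also have "\<dots> = d / norm (of_real x - of_real t + \<i> * of_real d)"
    using assms by (simp add: norm_divide norm_mult)
  also have "norm (of_real x - of_real t + \<i> * of_real d) = sqrt ((x - t)\<^sup>2 + d\<^sup>2)"
    by (simp add: cmod_def)
  finally show ?thesis .
qed

text \<open>
  Multiplication by \<open>exp (\<i> * w)\<close> turns \<open>cos w\<close> into \<open>(exp (\<i> * w) ^ 2 + 1) / 2\<close>, which is bounded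
  by one in the upper half plane; there is one such factor for each power of \<open>cos w\<close>.
\<close>

lemma norm_poly_cos_le:
  assumes "degree P \<le> n"
  shows "\<exists>M. \<forall>w. 0 \<le> Im w \<longrightarrow> norm (poly P (cos w) * exp (\<i> * of_nat n * w)) \<le> M"
proof (intro exI allI impI)
  fix w :: complex assume Im: "0 \<le> Im w"
  have e1: "norm (exp (\<i> * w)) \<le> 1" using Im by simp
  have ce: "cos w * exp (\<i> * w) = (exp (\<i> * w) ^ 2 + 1) / 2"
    unfolding cos_exp_eq by (simp add: power2_eq_square algebra_simps flip: exp_add)
  have nce: "norm (cos w * exp (\<i> * w)) \<le> 1"
  proof -
    have "norm (exp (\<i> * w) ^ 2 + 1) \<le> norm (exp (\<i> * w)) ^ 2 + 1"
      using norm_triangle_ineq[of "exp (\<i> * w) ^ 2" 1] by (simp add: norm_power)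
    also have "\<dots> \<le> 1 + 1" using e1 by (simp add: power_le_one)
    finally show ?thesis unfolding ce by (simp add: norm_divide)
  qed
  have "exp (\<i> * of_nat n * w) = exp (\<i> * w) ^ n"
    by (metis exp_of_nat_mult mult.assoc mult.left_commute)
  then have "poly P (cos w) * exp (\<i> * of_nat n * w) = (\<Sum>k\<le>degree P. coeff P k * cos w ^ k * exp (\<i> * w) ^ n)"
    by (simp add: poly_altdef sum_distrib_right)
  also have "\<dots> = (\<Sum>k\<le>degree P. coeff P k * (cos w * exp (\<i> * w)) ^ k * exp (\<i> * w) ^ (n - k))"
  proof (rule sum.cong[OF refl])
    fix k assume "k \<in> {..degree P}"
    then have "n = k + (n - k)" using assms by simp
    then have "exp (\<i> * w) ^ n = exp (\<i> * w) ^ k * exp (\<i> * w) ^ (n - k)" by (metis power_add)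
    then show "coeff P k * cos w ^ k * exp (\<i> * w) ^ n = coeff P k * (cos w * exp (\<i> * w)) ^ k * exp (\<i> * w) ^ (n - k)"
      by (simp add: power_mult_distrib)
  qed
  also have "norm \<dots> \<le> (\<Sum>k\<le>degree P. norm (coeff P k))"
  proof (rule order_trans[OF norm_sum], rule sum_mono)
    fix k
    have "norm ((cos w * exp (\<i> * w)) ^ k) * norm (exp (\<i> * w) ^ (n - k)) \<le> 1 * 1"
      unfolding norm_power by (intro mult_mono power_le_one nce e1) auto
    then have "norm (coeff P k) * (norm ((cos w * exp (\<i> * w)) ^ k) * norm (exp (\<i> * w) ^ (n - k))) \<le> norm (coeff P k) * 1"
      by (intro mult_left_mono) auto
    then show "norm (coeff P k * (cos w * exp (\<i> * w)) ^ k * exp (\<i> * w) ^ (n - k)) \<le> norm (coeff P k)"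
      by (simp only: norm_mult mult.assoc mult_1_right)
  qed
  finally show "norm (poly P (cos w) * exp (\<i> * of_nat n * w)) \<le> (\<Sum>k\<le>degree P. norm (coeff P k))" .
qed

text \<open>
  Two exponential multipliers are available, one for the scale of the distance to a zero
  and one for the distance between zeros.  The power of \<open>1 - half_plane_map t \<rho>\<close> decays like a power
  of the distance to \<open>t\<close> and compensates the polynomial growth of an auxiliary weight.
\<close>

lemma weighted_max_principle_upper:
  fixes A A' :: complex
  assumes deg: "degree P \<le> n" and pos: "0 < d1" "0 < d2" "0 < \<rho>"
    and real: "\<And>x::real. norm (poly P (of_real (cos x))) *
      exp (Re (A * half_plane_map t d1 (of_real x)) + Re (A' * half_plane_map t d2 (of_real x))) *
      (\<rho> / sqrt ((x - t)\<^sup>2 + \<rho>\<^sup>2)) ^ k \<le> B"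
    and w: "0 \<le> Im w"
  shows "norm (poly P (cos w)) *
      exp (Re (A * half_plane_map t d1 w) + Re (A' * half_plane_map t d2 w)) *
      norm (1 - half_plane_map t \<rho> w) ^ k \<le> B * exp (n * Im w)"
proof -
  define \<Psi> where "\<Psi> = (\<lambda>w. exp (A * half_plane_map t d1 w + A' * half_plane_map t d2 w) * (1 - half_plane_map t \<rho> w) ^ k)"
  define G where "G = (\<lambda>w. poly P (cos w) * exp (\<i> * of_nat n * w) * \<Psi> w)"
  have n\<Psi>: "norm (\<Psi> w) = exp (Re (A * half_plane_map t d1 w) + Re (A' * half_plane_map t d2 w)) *
      norm (1 - half_plane_map t \<rho> w) ^ k" for w
    unfolding \<Psi>_def by (simp add: norm_mult norm_power)
  have hol: "G holomorphic_on {w. 0 \<le> Im w}"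
    unfolding G_def \<Psi>_def half_plane_map_def using half_plane_map_denominator_nz pos
    by (intro holomorphic_intros) auto
  obtain M where M: "\<And>w. 0 \<le> Im w \<Longrightarrow> norm (poly P (cos w) * exp (\<i> * of_nat n * w)) \<le> M"
    using norm_poly_cos_le[OF deg] by blast
  have b\<Psi>: "norm (\<Psi> v) \<le> exp (norm A + norm A')" if "0 \<le> Im v" for v
  proof -
    have r: "Re (a * half_plane_map t d v) \<le> norm a" if "0 < d" for a d
    proof -
      have "Re (a * half_plane_map t d v) \<le> norm (a * half_plane_map t d v)" by (rule complex_Re_le_cmod)
      also have "\<dots> \<le> norm a * 1" unfolding norm_mult
        by (intro mult_left_mono norm_half_plane_map_le_1 that \<open>0 \<le> Im v\<close>) auto
      finally show ?thesis by simp
    qed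
    have "exp (Re (A * half_plane_map t d1 v) + Re (A' * half_plane_map t d2 v)) *
      norm (1 - half_plane_map t \<rho> v) ^ k \<le> exp (norm A + norm A') * 1"
      using r[OF pos(1), of A] r[OF pos(2), of A']
      by (intro mult_mono power_le_one norm_half_plane_map_comp_le_1 pos that) auto
    then show ?thesis unfolding n\<Psi> by simp
  qed
  have "norm (G w) \<le> B"
  proof (rule phragmen_lindelof_half_plane[of G "M * exp (norm A + norm A')"])
    show "G holomorphic_on {w. 0 < Im w}" by (rule holomorphic_on_subset[OF hol]) auto
    show "continuous_on {w. 0 \<le> Im w} G" by (rule holomorphic_on_imp_continuous_on[OF hol])
    show "norm (G v) \<le> M * exp (norm A + norm A')" if "0 \<le> Im v" for v
      unfolding G_def norm_mult[of _ "\<Psi> v"] using order_trans[OF norm_ge_zero M[OF that]]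
      by (intro mult_mono M b\<Psi> that) auto
    show "norm (G (of_real x)) \<le> B" for x
    proof -
      have "norm (G (of_real x)) = norm (poly P (of_real (cos x))) * norm (\<Psi> (of_real x))"
        unfolding G_def norm_mult by (simp flip: cos_of_real)
      also have "\<dots> \<le> B" unfolding n\<Psi> norm_half_plane_map_comp_of_real[OF pos(3)] mult.assoc[symmetric] by (rule real)
      finally show ?thesis .
    qed
  qed (rule w)
  then have "norm (poly P (cos w)) * exp (- (n * Im w)) * norm (\<Psi> w) \<le> B"
    unfolding G_def norm_mult by simp
  then have "norm (poly P (cos w)) * norm (\<Psi> w) \<le> B * exp (n * Im w)"
    by (simp add: exp_minus field_simps)
  then show ?thesis unfolding n\<Psi> by (simp add: mult.assoc)
qed

text \<open>
  Conjugating the coefficients of \<open>P\<close> exchanges the two half planes and keeps \<open>\<bar>P\<bar>\<close> on the real line.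
\<close>

lemma weighted_max_principle_lower:
  fixes A A' :: complex
  assumes deg: "degree P \<le> n" and pos: "0 < d1" "0 < d2" "0 < \<rho>"
    and real: "\<And>x::real. norm (poly P (of_real (cos x))) *
      exp (Re (A * half_plane_map t d1 (of_real x)) + Re (A' * half_plane_map t d2 (of_real x))) *
      (\<rho> / sqrt ((x - t)\<^sup>2 + \<rho>\<^sup>2)) ^ k \<le> B"
    and w: "0 \<le> Im w"
  shows "norm (poly P (cos (cnj w))) *
      exp (Re (A * half_plane_map t d1 w) + Re (A' * half_plane_map t d2 w)) *
      norm (1 - half_plane_map t \<rho> w) ^ k \<le> B * exp (n * Im w)"
proof -
  have "degree (map_poly cnj P) \<le> n" using deg by (simp add: degree_map_poly)
  moreover have "norm (poly (map_poly cnj P) z) = norm (poly P (cnj z))" for z by simp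
  ultimately show ?thesis
    using weighted_max_principle_upper[of "map_poly cnj P" n d1 d2 \<rho> A t A' k B w] assms
    by (simp add: cnj_cos)
qed

section \<open>Exponents with separated singularities and their truncation\<close>

lemma norm_le_on_disc_of_sphere:
  fixes P :: "complex poly" and r :: real
  assumes "\<And>w. norm (w - z) = r \<Longrightarrow> norm (poly P (cos w)) \<le> B" and "norm (w - z) \<le> r" and "0 < r"
  shows "norm (poly P (cos w)) \<le> B"
proof (rule maximum_modulus_frontier[of "\<lambda>w. poly P (cos w)" "cball z r"])
  show "(\<lambda>w. poly P (cos w)) holomorphic_on interior (cball z r)"
    by (intro holomorphic_intros)
  show "continuous_on (closure (cball z r)) (\<lambda>w. poly P (cos w))"
    by (intro continuous_intros)
  show "norm (poly P (cos v)) \<le> B" if "v \<in> frontier (cball z r)" for v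
    using that assms by (simp add: dist_norm norm_minus_commute)
qed (use assms in \<open>auto simp: dist_norm norm_minus_commute\<close>)

text \<open>
  The negative logarithm of a weight with zeros in \<open>Z\<close>.  The property \<open>tangent\<close> is a one-sided
  form of bounds for the first two derivatives, with the distance to \<open>Z\<close> as length scale; it is stable
  under addition.  In \<open>decay\<close> the points \<open>z + x\<close> and \<open>z + y\<close> may lie on different sides of
  \<open>z\<close>, so the exponent is also comparable at equal distances from \<open>z\<close>.
\<close>

locale singular_exponent =
  fixes H :: "real \<Rightarrow> real" and Z :: "real set" and c C \<alpha> :: real
  assumes c_pos: "0 < c" and c_le_1: "c \<le> 1" and C_ge_1: "1 \<le> C" and \<alpha>_pos: "0 < \<alpha>"
    and separated: "z \<in> Z \<Longrightarrow> z' \<in> Z \<Longrightarrow> z \<noteq> z' \<Longrightarrow> 4 * c \<le> \<bar>z - z'\<bar>"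
    and ge_1: "t \<notin> Z \<Longrightarrow> 1 \<le> H t"
    and continuous: "continuous_on (- Z) H"
    and bounded_away: "0 < \<eta> \<Longrightarrow> \<exists>B. \<forall>t. (\<forall>z\<in>Z. \<eta> \<le> \<bar>t - z\<bar>) \<longrightarrow> H t \<le> B"
    and tangent: "0 < d \<Longrightarrow> d \<le> 1 \<Longrightarrow> (\<And>z. z \<in> Z \<Longrightarrow> d \<le> \<bar>t - z\<bar>) \<Longrightarrow>
      \<exists>b. \<bar>b\<bar> \<le> C * H t / d \<and>
        (\<forall>s. \<bar>s - t\<bar> \<le> d / 2 \<longrightarrow> H s \<le> H t + b * (s - t) + C * H t * (s - t)\<^sup>2 / d\<^sup>2)"
    and decay: "z \<in> Z \<Longrightarrow> 0 < \<bar>x\<bar> \<Longrightarrow> \<bar>x\<bar> \<le> \<bar>y\<bar> \<Longrightarrow> \<bar>y\<bar> \<le> 2 * c \<Longrightarrow>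
      H (z + y) \<le> C * (\<bar>x\<bar> / \<bar>y\<bar>) powr \<alpha> * H (z + x)"
begin

lemma not_singular_near: "z \<in> Z \<Longrightarrow> 0 < \<bar>x\<bar> \<Longrightarrow> \<bar>x\<bar> < 4 * c \<Longrightarrow> z + x \<notin> Z"
  using separated[of z "z + x"] by fastforce

text \<open>
  The line \<open>N * x\<close> lies below \<open>H (z + x) \<ge> 1\<close> for \<open>x \<le> 1 / N\<close> and above it at \<open>x = \<theta>\<close>
  once \<open>N\<close> is large, uniformly in \<open>z\<close>; the intermediate value theorem gives a crossing.
\<close>

lemma exists_critical_scale:
  assumes "0 < \<theta>" "\<theta> \<le> c"
  shows "\<exists>K>0. \<forall>N\<ge>K. \<forall>z\<in>Z. \<exists>\<delta>. 0 < \<delta> \<and> \<delta> \<le> \<theta> \<and> H (z + \<delta>) = N * \<delta>"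
proof -
  obtain B where B: "\<And>t. (\<forall>z\<in>Z. \<theta> \<le> \<bar>t - z\<bar>) \<Longrightarrow> H t \<le> B" using bounded_away[OF assms(1)] by blast
  define K where "K = max (B / \<theta>) (1 / \<theta>)"
  have "0 < K" unfolding K_def using assms by (simp add: less_max_iff_disj)
  have "\<exists>\<delta>. 0 < \<delta> \<and> \<delta> \<le> \<theta> \<and> H (z + \<delta>) = N * \<delta>" if N: "K \<le> N" and z: "z \<in> Z" for N z
  proof -
    have "0 < N" using N \<open>0 < K\<close> by simp
    have far: "\<forall>z'\<in>Z. \<theta> \<le> \<bar>(z + \<theta>) - z'\<bar>"
    proof
      fix z' assume "z' \<in> Z"
      show "\<theta> \<le> \<bar>(z + \<theta>) - z'\<bar>"
        using separated[OF z \<open>z' \<in> Z\<close>] assms by (cases "z = z'") auto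
    qed
    have "B / \<theta> \<le> N" "1 / \<theta> \<le> N" using N unfolding K_def by auto
    then have hi: "H (z + \<theta>) \<le> N * \<theta>" and le: "1 / N \<le> \<theta>"
      using B[OF far] assms \<open>0 < N\<close> by (simp_all add: field_simps)
    have nz: "z + x \<notin> Z" if "0 < x" "x \<le> \<theta>" for x
      using not_singular_near[OF z, of x] that assms by simp
    have lo: "N * (1 / N) \<le> H (z + 1 / N)"
      using ge_1[OF nz[of "1 / N"]] le \<open>0 < N\<close> by simp
    have "continuous_on {1 / N..\<theta>} (\<lambda>x. H (z + x) - N * x)"
    proof (intro continuous_intros continuous_on_compose2[OF continuous])
      have "0 < 1 / N" using \<open>0 < N\<close> by simp
      have "z + x \<in> - Z" if "x \<in> {1 / N..\<theta>}" for x
        using nz[of x] that less_le_trans[OF \<open>0 < 1 / N\<close>, of x] by simp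
      then show "(\<lambda>x. z + x) ` {1 / N..\<theta>} \<subseteq> - Z" by blast
    qed
    then obtain \<delta> where "1 / N \<le> \<delta>" "\<delta> \<le> \<theta>" "H (z + \<delta>) - N * \<delta> = 0"
      using IVT2'[of "\<lambda>x. H (z + x) - N * x" \<theta> 0 "1 / N"] hi lo le by auto
    then show ?thesis using \<open>0 < N\<close> by (intro exI[of _ \<delta>]) (auto intro: less_le_trans[of 0 "1 / N"])
  qed
  then show ?thesis using \<open>0 < K\<close> by blast
qed

end

text \<open>
  In the application \<open>N = K * n\<close>.  Near \<open>z\<close> but beyond the critical scale \<open>\<delta> z\<close> the exponent stays below a multiple of
  \<open>N\<close> times the distance to \<open>z\<close>, and so a polynomial of degree \<open>n\<close> can follow the weight there; within
  that scale it cannot.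
\<close>

locale truncated_exponent = singular_exponent +
  fixes \<delta> :: "real \<Rightarrow> real" and N \<theta> :: real
  assumes N_pos: "0 < N" and \<theta>_le: "\<theta> \<le> c"
    and \<delta>_pos: "z \<in> Z \<Longrightarrow> 0 < \<delta> z" and \<delta>_le: "z \<in> Z \<Longrightarrow> \<delta> z \<le> \<theta>"
    and critical: "z \<in> Z \<Longrightarrow> H (z + \<delta> z) = N * \<delta> z"
begin

text \<open>
  The division by \<open>C\<close> keeps the constant below \<open>H\<close> on the whole interval, since \<open>H\<close> may
  drop by a factor \<open>C\<close> on the way to the zero (\<open>critical_le\<close>).
\<close>

definition trunc :: "real \<Rightarrow> real" where
  "trunc t = (if \<exists>z\<in>Z. \<bar>t - z\<bar> < \<delta> z then N * \<delta> (SOME z. z \<in> Z \<and> \<bar>t - z\<bar> < \<delta> z) / C else H t)"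

lemma near_unique:
  assumes "z \<in> Z" "z' \<in> Z" "\<bar>t - z\<bar> \<le> 2 * c" "\<bar>t - z'\<bar> < \<delta> z'"
  shows "z' = z"
proof (rule ccontr)
  assume "z' \<noteq> z"
  then have "4 * c \<le> \<bar>z' - z\<bar>" using separated assms by blast
  moreover have "\<delta> z' \<le> c" using \<delta>_le[OF assms(2)] \<theta>_le by simp
  ultimately show False using assms c_pos by linarith
qed

lemma trunc_near:
  assumes "z \<in> Z" "\<bar>t - z\<bar> < \<delta> z"
  shows "trunc t = N * \<delta> z / C"
proof -
  define z' where "z' = (SOME z. z \<in> Z \<and> \<bar>t - z\<bar> < \<delta> z)"
  have "z' \<in> Z \<and> \<bar>t - z'\<bar> < \<delta> z'" unfolding z'_def by (rule someI[of _ z]) (use assms in blast)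
  moreover have "\<bar>t - z\<bar> \<le> 2 * c" using assms \<delta>_le[OF assms(1)] \<theta>_le c_pos by linarith
  ultimately have "z' = z" using near_unique assms by blast
  then show ?thesis unfolding trunc_def using assms z'_def by auto
qed

lemma trunc_good: "(\<And>z. z \<in> Z \<Longrightarrow> \<delta> z \<le> \<bar>t - z\<bar>) \<Longrightarrow> trunc t = H t"
  unfolding trunc_def by (metis linorder_not_less)

lemma critical_le:
  assumes "z \<in> Z" "0 < \<bar>x\<bar>" "\<bar>x\<bar> \<le> \<delta> z"
  shows "N * \<delta> z \<le> C * H (z + x)"
proof -
  have d: "0 < \<delta> z" "\<delta> z \<le> 2 * c" using \<delta>_pos \<delta>_le \<theta>_le c_pos assms(1) by fastforce+
  have "z + x \<notin> Z" using not_singular_near assms \<delta>_le[OF assms(1)] \<theta>_le c_pos by force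
  then have "0 \<le> H (z + x)" using ge_1 by fastforce
  have "N * \<delta> z \<le> C * (\<bar>x\<bar> / \<delta> z) powr \<alpha> * H (z + x)"
    using decay[OF assms(1,2), of "\<delta> z"] assms d critical by simp
  also have "\<dots> \<le> C * 1 * H (z + x)"
    using assms d \<alpha>_pos C_ge_1 \<open>0 \<le> H (z + x)\<close> by (intro mult_right_mono mult_left_mono powr_le1) auto
  finally show ?thesis by simp
qed

lemma decay_critical:
  assumes "z \<in> Z" "1 \<le> r" "r * \<delta> z \<le> \<bar>x\<bar>" "\<bar>x\<bar> \<le> 2 * c"
  shows "H (z + x) \<le> C * r powr - \<alpha> * (N * \<delta> z)"
proof -
  have d: "0 < \<delta> z" using \<delta>_pos assms(1) by simp
  then have "\<delta> z \<le> r * \<delta> z" using assms by simp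
  then have x: "\<delta> z \<le> \<bar>x\<bar>" using assms by linarith
  have "H (z + x) \<le> C * (\<delta> z / \<bar>x\<bar>) powr \<alpha> * (N * \<delta> z)"
    using decay[OF assms(1), of "\<delta> z" x] x d assms critical[OF assms(1)] by simp
  also have "(\<delta> z / \<bar>x\<bar>) powr \<alpha> \<le> (1 / r) powr \<alpha>"
    using assms d x \<alpha>_pos by (intro powr_mono2) (auto simp: field_simps)
  also have "(1 / r) powr \<alpha> = r powr - \<alpha>" using assms by (simp add: powr_minus powr_divide inverse_eq_divide)
  finally show ?thesis using C_ge_1 N_pos d by (simp add: mult_left_mono mult_right_mono)
qed

lemma trunc_le: "t \<notin> Z \<Longrightarrow> trunc t \<le> H t"
proof (cases "\<exists>z\<in>Z. \<bar>t - z\<bar> < \<delta> z")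
  case True
  then obtain z where z: "z \<in> Z" "\<bar>t - z\<bar> < \<delta> z" by blast
  assume "t \<notin> Z"
  then have "t - z \<noteq> 0" using z by auto
  then have "N * \<delta> z \<le> C * H (z + (t - z))" using z by (intro critical_le) auto
  then show ?thesis unfolding trunc_near[OF z] using C_ge_1 by (simp add: divide_le_eq mult.commute)
next
  case False
  then show ?thesis unfolding trunc_def by simp
qed

lemma trunc_nonneg: "0 \<le> trunc t"
proof (cases "\<exists>z\<in>Z. \<bar>t - z\<bar> < \<delta> z")
  case True
  then obtain z where z: "z \<in> Z" "\<bar>t - z\<bar> < \<delta> z" by blast
  then show ?thesis using trunc_near[OF z] C_ge_1 N_pos \<delta>_pos[OF z(1)] by simp
next
  case False
  then have "t \<notin> Z" using \<delta>_pos by fastforce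
  then show ?thesis using trunc_good[of t] ge_1[of t] False by force
qed

lemma trunc_le_decay:
  assumes "z \<in> Z" "1 \<le> r" "r * \<delta> z \<le> \<bar>s - z\<bar>" "\<bar>s - z\<bar> \<le> 2 * c"
  shows "trunc s \<le> C * r powr - \<alpha> * (N * \<delta> z)"
proof -
  have "\<delta> z \<le> r * \<delta> z" using \<delta>_pos assms by simp
  then have sz: "\<delta> z \<le> \<bar>s - z\<bar>" using assms by linarith
  have "trunc s = H s"
    by (rule trunc_good) (use near_unique[OF assms(1) _ assms(4)] sz in force)
  then show ?thesis using decay_critical[OF assms] by simp
qed

lemma trunc_le_near:
  assumes "z \<in> Z" "\<bar>s - z\<bar> \<le> 2 * c"
  shows "trunc s \<le> C * (N * \<delta> z)"
proof (cases "\<bar>s - z\<bar> < \<delta> z")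
  case True
  have "0 \<le> N * \<delta> z" using N_pos \<delta>_pos[OF assms(1)] by simp
  then have "N * \<delta> z / C \<le> N * \<delta> z / 1" using C_ge_1 by (intro divide_left_mono) auto
  also have "\<dots> \<le> N * \<delta> z * C" using mult_left_mono[OF C_ge_1 \<open>0 \<le> N * \<delta> z\<close>] by simp
  finally show ?thesis using trunc_near[OF assms(1) True] by (simp add: mult.commute)
next
  case False
  then show ?thesis using trunc_le_decay[OF assms(1), of 1 s] assms by simp
qed

text \<open>
  The global bound is a small multiple of \<open>N\<close>, because the critical scales are at most \<open>\<theta>\<close>.  This
  makes the influence of distant zeros negligible.
\<close>

lemma trunc_le_global:
  assumes "\<And>t. (\<forall>z\<in>Z. c \<le> \<bar>t - z\<bar>) \<Longrightarrow> H t \<le> B" "0 \<le> B" "0 \<le> \<theta>"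
  shows "trunc s \<le> C * \<theta> * N + B"
proof (cases "\<exists>z\<in>Z. \<bar>s - z\<bar> < c")
  case True
  then obtain z where z: "z \<in> Z" "\<bar>s - z\<bar> < c" by blast
  then have "trunc s \<le> C * (N * \<delta> z)" using trunc_le_near c_pos by simp
  also have "\<dots> \<le> C * (N * \<theta>)" using C_ge_1 N_pos \<delta>_le[OF z(1)] by simp
  finally show ?thesis using assms by (simp add: mult_ac)
next
  case False
  have "trunc s = H s"
  proof (rule trunc_good)
    fix z assume "z \<in> Z"
    then show "\<delta> z \<le> \<bar>s - z\<bar>" using False \<delta>_le[of z] \<theta>_le by force
  qed
  also have "H s \<le> B" using assms False by force
  finally show ?thesis using C_ge_1 N_pos assms by (simp add: add_increasing)
qed

text \<open>
  Decay from the critical scale to the fixed distance \<open>c\<close>, where the exponent is at least one, forces the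
  critical value to be large when the scale is small.
\<close>

lemma critical_large:
  assumes "z \<in> Z" "0 < \<theta>"
  shows "(c / \<theta>) powr \<alpha> \<le> C * (N * \<delta> z)"
proof -
  have d: "0 < \<delta> z" "\<delta> z \<le> \<theta>" using assms \<delta>_pos \<delta>_le by auto
  have "z + c \<notin> Z" using not_singular_near[OF assms(1), of c] c_pos by simp
  then have "1 \<le> H (z + c)" by (rule ge_1)
  also have "H (z + c) \<le> C * (\<delta> z / c) powr \<alpha> * (N * \<delta> z)"
    using decay[OF assms(1), of "\<delta> z" c] d \<theta>_le c_pos critical[OF assms(1)] by simp
  finally have 1: "1 \<le> (\<delta> z / c) powr \<alpha> * (C * (N * \<delta> z))" by (simp add: mult_ac)
  have "(c / \<theta>) powr \<alpha> \<le> (c / \<delta> z) powr \<alpha>"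
    using d c_pos \<alpha>_pos by (intro powr_mono2) (auto simp: frac_le)
  also have "(c / \<delta> z) powr \<alpha> = 1 / (\<delta> z / c) powr \<alpha>"
    using d c_pos by (simp add: powr_divide)
  also have "\<dots> \<le> C * (N * \<delta> z)" using 1 d c_pos by (simp add: field_simps)
  finally show ?thesis .
qed

end

section \<open>Polynomials bounded on complex discs\<close>

text \<open>
  At distance \<open>\<bar>y\<bar>\<close> from the centre the linear growth is compensated by the decay of the
  multiplier \<open>1 - half_plane_map\<close>, up to the growth at distance \<open>\<rho>\<close>.
\<close>

lemma growth_damped:
  fixes y \<rho> a :: real
  assumes "0 < \<rho>" "0 \<le> a" "\<bar>y'\<bar> \<le> \<bar>y\<bar> + \<rho>"
  shows "(1 + a * \<bar>y'\<bar>) * (\<rho> / sqrt (y\<^sup>2 + \<rho>\<^sup>2)) \<le> 1 + 2 * a * \<rho>"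
proof -
  let ?s = "sqrt (y\<^sup>2 + \<rho>\<^sup>2)"
  have s: "\<rho> \<le> ?s" "\<bar>y\<bar> \<le> ?s" using assms by (auto intro!: real_le_rsqrt)
  have "0 < ?s" using s assms by linarith
  have "(1 + a * \<bar>y'\<bar>) * \<rho> = \<rho> + (a * \<rho>) * \<bar>y'\<bar>" by (simp add: algebra_simps)
  also have "\<dots> \<le> ?s + (a * \<rho>) * (2 * ?s)"
    using assms s by (intro add_mono mult_left_mono mult_nonneg_nonneg) linarith+
  also have "\<dots> = (1 + 2 * a * \<rho>) * ?s" by (simp add: algebra_simps)
  finally show ?thesis using \<open>0 < ?s\<close> by (simp add: divide_le_eq)
qed

locale weighted_polynomial = truncated_exponent +
  fixes n k :: nat and v :: "real \<Rightarrow> real" and S :: real and P :: "complex poly"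
  assumes n_pos: "1 \<le> n" and deg: "degree P \<le> n"
    and v_nonneg: "\<And>t::real. 0 \<le> v t" and v_growth: "\<And>s t::real. v t \<le> (1 + n * \<bar>s - t\<bar>) ^ k * v s"
    and S_nonneg: "0 \<le> S"
    and bound: "\<And>s::real. norm (poly P (of_real (cos s))) * v s \<le> S * exp (trunc s)"
begin

lemma bound_shifted:
  fixes \<rho> s t t0 e E :: real
  assumes "0 < \<rho>" "\<bar>s - t0\<bar> \<le> \<bar>s - t\<bar> + \<rho>" "trunc s + e \<le> E"
  shows "norm (poly (smult (of_real (v t0)) P) (of_real (cos s))) * exp e * (\<rho> / sqrt ((s - t)\<^sup>2 + \<rho>\<^sup>2)) ^ k
    \<le> S * exp E * (1 + 2 * n * \<rho>) ^ k"
proof -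
  let ?q = "\<rho> / sqrt ((s - t)\<^sup>2 + \<rho>\<^sup>2)"
  let ?p = "norm (poly P (of_real (cos s)))"
  have q: "0 \<le> ?q" using assms by simp
  have "norm (poly (smult (of_real (v t0)) P) (of_real (cos s))) * exp e * ?q ^ k
      = (v t0 * ?q ^ k) * (?p * exp e)" using v_nonneg by (simp add: norm_mult)
  also have "v t0 * ?q ^ k \<le> ((1 + n * \<bar>s - t0\<bar>) ^ k * v s) * ?q ^ k"
    using q by (intro mult_right_mono v_growth) auto
  also have "\<dots> = v s * ((1 + n * \<bar>s - t0\<bar>) * ?q) ^ k" by (simp only: power_mult_distrib mult_ac)
  also have "\<dots> \<le> v s * (1 + 2 * n * \<rho>) ^ k"
    using growth_damped[OF assms(1), of n "s - t0" "s - t"] assms v_nonneg q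
    by (intro mult_left_mono power_mono mult_nonneg_nonneg) auto
  finally have "norm (poly (smult (of_real (v t0)) P) (of_real (cos s))) * exp e * ?q ^ k
      \<le> v s * (1 + 2 * n * \<rho>) ^ k * (?p * exp e)" by (simp add: mult_right_mono)
  also have "\<dots> = (?p * v s) * (exp e * (1 + 2 * n * \<rho>) ^ k)" by simp
  also have "\<dots> \<le> (S * exp (trunc s)) * (exp e * (1 + 2 * n * \<rho>) ^ k)"
    using assms by (intro mult_right_mono bound) auto
  also have "\<dots> = S * exp (trunc s + e) * (1 + 2 * n * \<rho>) ^ k" by (simp add: exp_add)
  also have "\<dots> \<le> S * exp E * (1 + 2 * n * \<rho>) ^ k"
    using assms S_nonneg by (intro mult_right_mono mult_left_mono) auto
  finally show ?thesis .
qed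

text \<open>
  The multipliers turn the bound on the real line into \<open>E\<close> and cost at most \<open>D\<close> on the upper half of the
  circle of radius \<open>r\<close>.  Both halves of the circle are covered by the two half plane principles, and its
  interior by the maximum principle.
\<close>

lemma bound_on_disc:
  fixes A A' :: complex and d1 d2 \<rho> r t t0 E D :: real
  assumes pos: "0 < d1" "0 < d2" "0 < \<rho>" "0 < r" and t0: "\<bar>t0 - t\<bar> \<le> \<rho>"
    and real: "\<And>s. trunc s + (Re (A * half_plane_map t d1 (of_real s)) + Re (A' * half_plane_map t d2 (of_real s))) \<le> E"
    and cost: "\<And>w. 0 \<le> Im w \<Longrightarrow> norm (w - of_real t) = r \<Longrightarrow>
      - D \<le> Re (A * half_plane_map t d1 w) + Re (A' * half_plane_map t d2 w)"
    and w: "norm (w - of_real t) \<le> r"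
  shows "norm (poly P (cos w)) * v t0 \<le> S * exp (E + D + n * r) * (1 + 2 * n * \<rho>) ^ k * (1 + r / \<rho>) ^ k"
proof -
  define Q where "Q = smult (of_real (v t0)) P"
  have nQ: "norm (poly Q x) = norm (poly P x) * v t0" for x
    unfolding Q_def using v_nonneg by (simp add: norm_mult)
  have degQ: "degree Q \<le> n" unfolding Q_def using deg degree_smult_le le_trans by blast
  let ?m = "\<lambda>w. Re (A * half_plane_map t d1 w) + Re (A' * half_plane_map t d2 w)"
  let ?B = "S * exp E * (1 + 2 * n * \<rho>) ^ k"
  have realQ: "norm (poly Q (of_real (cos x))) * exp (?m (of_real x)) * (\<rho> / sqrt ((x - t)\<^sup>2 + \<rho>\<^sup>2)) ^ k \<le> ?B" for x
    unfolding Q_def by (rule bound_shifted) (use pos t0 real in auto)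
  have main: "norm (poly Q u) \<le> ?B * exp (D + n * r) * (1 + r / \<rho>) ^ k"
    if w: "0 \<le> Im w" "norm (w - of_real t) = r"
      and le: "norm (poly Q u) * exp (?m w) * norm (1 - half_plane_map t \<rho> w) ^ k \<le> ?B * exp (n * Im w)"
    for u w
  proof -
    have "0 \<le> ?B" using S_nonneg pos by simp
    have "1 / (1 + r / \<rho>) = \<rho> / (r + \<rho>)" using pos by (simp add: field_simps)
    then have "1 / (1 + r / \<rho>) \<le> norm (1 - half_plane_map t \<rho> w)"
      using norm_half_plane_map_comp_ge[OF pos(3) w(1), of t] w by simp
    then have 1: "(1 / (1 + r / \<rho>)) ^ k \<le> norm (1 - half_plane_map t \<rho> w) ^ k"
      using pos by (intro power_mono) auto
    have "Im w = Im (w - of_real t)" by simp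
    also have "\<dots> \<le> r" using abs_Im_le_cmod[of "w - of_real t"] w by simp
    finally have 2: "exp (n * Im w) \<le> exp (n * r)" by (simp add: mult_left_mono)
    have "norm (poly Q u) * exp (- D) * (1 / (1 + r / \<rho>)) ^ k \<le> norm (poly Q u) * exp (?m w) * norm (1 - half_plane_map t \<rho> w) ^ k"
      using cost[OF w] 1 pos by (intro mult_mono) auto
    also have "\<dots> \<le> ?B * exp (n * Im w)" by (rule le)
    also have "\<dots> \<le> ?B * exp (n * r)" by (rule mult_left_mono[OF 2 \<open>0 \<le> ?B\<close>])
    finally have *: "norm (poly Q u) * exp (- D) * (1 / (1 + r / \<rho>)) ^ k \<le> ?B * exp (n * r)" .
    define X where "X = (1 + r / \<rho>) ^ k"
    have "0 < X" unfolding X_def using pos by (simp add: add_pos_pos)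
    have "norm (poly Q u) * exp (- D) / X \<le> ?B * exp (n * r)" using * unfolding X_def by (simp add: power_one_over)
    then have "norm (poly Q u) \<le> ?B * exp (n * r) * X * exp D"
      using \<open>0 < X\<close> by (simp add: exp_minus field_simps)
    then show ?thesis unfolding X_def by (simp add: exp_add mult_ac)
  qed
  have "norm (poly Q (cos w)) \<le> ?B * exp (D + n * r) * (1 + r / \<rho>) ^ k"
  proof (rule norm_le_on_disc_of_sphere[OF _ w pos(4)])
    fix u :: complex assume u: "norm (u - of_real t) = r"
    show "norm (poly Q (cos u)) \<le> ?B * exp (D + n * r) * (1 + r / \<rho>) ^ k"
    proof (cases "0 \<le> Im u")
      case True
      show ?thesis
        by (rule main[OF True u weighted_max_principle_upper[OF degQ pos(1-3) realQ True]])
    next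
      case False
      have Im: "0 \<le> Im (cnj u)" using False by simp
      have "cnj u - of_real t = cnj (u - of_real t)" by simp
      then have n: "norm (cnj u - of_real t) = r" using u complex_mod_cnj by metis
      show ?thesis
        using main[OF Im n weighted_max_principle_lower[OF degQ pos(1-3) realQ Im]] by simp
    qed
  qed
  then show ?thesis unfolding nQ by (simp add: exp_add mult_ac)
qed

text \<open>
  The multiplier with \<open>A = 2 * C * T\<close> is \<open>exp (- 2 * C * T * (1 - \<zeta>))\<close> up to normalisation: it
  removes the truncated exponent, which is at most \<open>C * T\<close>, within distance \<open>r * \<delta> z\<close> of \<open>z\<close>, and
  costs little on a circle of much larger radius \<open>R * \<delta> z\<close>.  Between \<open>r * \<delta> z\<close> and \<open>c\<close> the exponent has
  decayed to \<open>\<epsilon> * T\<close>.  The second multiplier removes everything at distance more than \<open>c\<close>.  Each of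
  the seven contributions is at most \<open>\<epsilon> * T\<close>.
\<close>

lemma disc_bound_near_zero:
  fixes K B r R \<epsilon> z t0 :: real
  assumes N: "N = K * n" and "0 < K" and z: "z \<in> Z" and t0: "\<bar>t0 - z\<bar> \<le> \<delta> z"
    and B: "\<And>t. (\<forall>z\<in>Z. c \<le> \<bar>t - z\<bar>) \<Longrightarrow> H t \<le> B" "0 \<le> B" and "0 < \<theta>" "0 \<le> \<epsilon>"
    and r: "1 \<le> r" "r < R" "C * r powr - \<alpha> \<le> \<epsilon>" "2 * C * (r / (R - r)) \<le> \<epsilon>"
    and K: "2 * k / K \<le> \<epsilon>" "R / K \<le> \<epsilon>" "2 * C * \<theta> * R / c \<le> \<epsilon>" "2 * B * R / (c * N) \<le> \<epsilon>"
    and T: "k * ln (1 + R) \<le> \<epsilon> * (N * \<delta> z)"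
    and w: "norm (w - of_real z) \<le> R * \<delta> z"
  shows "norm (poly P (cos w)) * v t0 \<le> S * exp (7 * \<epsilon> * (N * \<delta> z))"
proof -
  define T where "T = N * \<delta> z"
  define a where "a = 2 * (C * \<theta> * N + B)"
  have d: "0 < \<delta> z" using \<delta>_pos z by simp
  have "0 < T" unfolding T_def using d N_pos by simp
  have "0 \<le> C * T" using C_ge_1 \<open>0 < T\<close> by simp
  have "0 \<le> a" unfolding a_def using C_ge_1 \<open>0 < \<theta>\<close> N_pos B by simp
  have rd: "0 < r * \<delta> z" using r d by simp
  have "norm (poly P (cos w)) * v t0 \<le> S * exp ((\<epsilon> * T + 2 * C * T) + (3 * \<epsilon> * T - 2 * C * T) + n * (R * \<delta> z))
      * (1 + 2 * n * \<delta> z) ^ k * (1 + (R * \<delta> z) / \<delta> z) ^ k"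
  proof (rule bound_on_disc[where A = "of_real (2 * C * T)" and A' = "- of_real a", OF rd c_pos d _ t0 _ _ w])
    show "0 < R * \<delta> z" using r d by simp
  next
    fix s
    define y where "y = s - z"
    let ?X1 = "y\<^sup>2 / (y\<^sup>2 + (r * \<delta> z)\<^sup>2)"
    let ?X2 = "y\<^sup>2 / (y\<^sup>2 + c\<^sup>2)"
    have X1: "?X1 \<le> 1" "\<bar>y\<bar> \<le> r * \<delta> z \<Longrightarrow> ?X1 \<le> 1 / 2"
    proof -
      have pos: "0 < y\<^sup>2 + (r * \<delta> z)\<^sup>2" using rd by (intro add_nonneg_pos) auto
      then show "?X1 \<le> 1" by (simp add: divide_le_eq)
      assume "\<bar>y\<bar> \<le> r * \<delta> z"
      then have "y\<^sup>2 \<le> (r * \<delta> z)\<^sup>2" using abs_le_square_iff[of y "r * \<delta> z"] rd by simp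
      then show "?X1 \<le> 1 / 2" using pos by (simp add: divide_le_eq)
    qed
    have X2: "0 \<le> ?X2" "c \<le> \<bar>y\<bar> \<Longrightarrow> 1 / 2 \<le> ?X2"
    proof -
      show "0 \<le> ?X2" by simp
      assume "c \<le> \<bar>y\<bar>"
      then have "c\<^sup>2 \<le> y\<^sup>2" using abs_le_square_iff[of c y] c_pos by simp
      moreover have "0 < y\<^sup>2 + c\<^sup>2" using c_pos by (simp add: add_nonneg_pos)
      ultimately show "1 / 2 \<le> ?X2" by (simp add: le_divide_eq)
    qed
    have "trunc s + 2 * C * T * ?X1 - a * ?X2 \<le> \<epsilon> * T + 2 * C * T"
    proof -
      have CX: "C * T * ?X1 \<le> C * T * 1" by (intro mult_left_mono X1 \<open>0 \<le> C * T\<close>)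
      have aX: "0 \<le> a * ?X2" using X2 \<open>0 \<le> a\<close> by simp
      have eT: "0 \<le> \<epsilon> * T" using assms \<open>0 < T\<close> by simp
      consider "c \<le> \<bar>y\<bar>" | "\<bar>y\<bar> \<le> c" "\<bar>y\<bar> \<le> r * \<delta> z" | "\<bar>y\<bar> \<le> c" "r * \<delta> z \<le> \<bar>y\<bar>" by linarith
      then show ?thesis
      proof cases
        case 1
        have "a * (1 / 2) \<le> a * ?X2" by (intro mult_left_mono X2 1 \<open>0 \<le> a\<close>)
        moreover have "trunc s \<le> a / 2" using trunc_le_global[OF B, of s] \<open>0 < \<theta>\<close> unfolding a_def by simp
        ultimately show ?thesis using CX eT by linarith
      next
        case 2
        have "C * T * ?X1 \<le> C * T * (1 / 2)" by (intro mult_left_mono X1 2 \<open>0 \<le> C * T\<close>)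
        moreover have "trunc s \<le> C * T" unfolding T_def by (rule trunc_le_near[OF z]) (use 2 c_pos y_def in auto)
        ultimately show ?thesis using aX eT by linarith
      next
        case 3
        have "trunc s \<le> (C * r powr - \<alpha>) * (N * \<delta> z)" by (rule trunc_le_decay[OF z r(1)]) (use 3 c_pos y_def in auto)
        also have "\<dots> \<le> \<epsilon> * T" unfolding T_def by (intro mult_right_mono r) (use \<open>0 < T\<close> T_def in simp)
        finally show ?thesis using aX CX by linarith
      qed
    qed
    then show "trunc s + (Re (of_real (2 * C * T) * half_plane_map z (r * \<delta> z) (of_real s)) +
          Re (- of_real a * half_plane_map z c (of_real s))) \<le> \<epsilon> * T + 2 * C * T"
      by (simp add: half_plane_map_of_real[OF rd] half_plane_map_of_real[OF c_pos] flip: y_def)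
  next
    fix w :: complex
    assume Im: "0 \<le> Im w" and nw: "norm (w - of_real z) = R * \<delta> z"
    have "norm (1 - half_plane_map z (r * \<delta> z) w) \<le> r * \<delta> z / (R * \<delta> z - r * \<delta> z)"
      using norm_half_plane_map_comp_le[OF rd Im, of z] nw r d by simp
    also have "\<dots> = r / (R - r)" using d r by (simp add: field_simps)
    finally have "Re (1 - half_plane_map z (r * \<delta> z) w) \<le> r / (R - r)"
      using complex_Re_le_cmod order_trans by blast
    then have "2 * C * T * Re (1 - half_plane_map z (r * \<delta> z) w) \<le> 2 * C * T * (r / (R - r))"
      using \<open>0 \<le> C * T\<close> by (intro mult_left_mono) auto
    also have "\<dots> = (2 * C * (r / (R - r))) * T" by simp
    also have "\<dots> \<le> \<epsilon> * T" using \<open>0 < T\<close> by (intro mult_right_mono r) auto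
    finally have 1: "2 * C * T - \<epsilon> * T \<le> 2 * C * T * Re (half_plane_map z (r * \<delta> z) w)" by (simp add: algebra_simps)
    have "Re (half_plane_map z c w) \<le> R * \<delta> z / c"
      using norm_half_plane_map_le[OF c_pos Im, of z] nw complex_Re_le_cmod order_trans by metis
    then have "a * Re (half_plane_map z c w) \<le> a * (R * \<delta> z / c)" by (rule mult_left_mono[OF _ \<open>0 \<le> a\<close>])
    also have "\<dots> = (2 * C * \<theta> * R / c) * T + (2 * B * R / (c * N)) * T"
      unfolding a_def T_def using c_pos N_pos by (simp add: field_simps)
    also have "\<dots> \<le> \<epsilon> * T + \<epsilon> * T" using \<open>0 < T\<close> by (intro add_mono mult_right_mono K) auto
    finally have 2: "a * Re (half_plane_map z c w) \<le> \<epsilon> * T + \<epsilon> * T" .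
    have "Re (of_real (2 * C * T) * half_plane_map z (r * \<delta> z) w) + Re (- of_real a * half_plane_map z c w)
        = 2 * C * T * Re (half_plane_map z (r * \<delta> z) w) - a * Re (half_plane_map z c w)" by simp
    then show "- (3 * \<epsilon> * T - 2 * C * T) \<le> Re (of_real (2 * C * T) * half_plane_map z (r * \<delta> z) w) +
          Re (- of_real a * half_plane_map z c w)" using 1 2 by linarith
  qed
  also have "\<dots> = S * (exp (4 * \<epsilon> * T + n * (R * \<delta> z)) * (1 + 2 * n * \<delta> z) ^ k * (1 + R) ^ k)"
    using d by (simp add: algebra_simps)
  also have "\<dots> \<le> S * (exp (4 * \<epsilon> * T + \<epsilon> * T) * exp (\<epsilon> * T) * exp (\<epsilon> * T))"
  proof (intro mult_left_mono mult_mono S_nonneg)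
    have "n * (R * \<delta> z) = (R / K) * T" unfolding T_def N using \<open>0 < K\<close> by simp
    also have "\<dots> \<le> \<epsilon> * T" using \<open>0 < T\<close> K by (intro mult_right_mono) auto
    finally show "exp (4 * \<epsilon> * T + n * (R * \<delta> z)) \<le> exp (4 * \<epsilon> * T + \<epsilon> * T)"
      unfolding exp_le_cancel_iff by linarith
    have "(1 + 2 * n * \<delta> z) ^ k \<le> exp (2 * n * \<delta> z) ^ k"
      using d by (intro power_mono exp_ge_add_one_self) auto
    also have "\<dots> = exp ((2 * k / K) * T)" unfolding T_def N using \<open>0 < K\<close> by (simp add: mult_ac flip: exp_of_nat_mult)
    also have "\<dots> \<le> exp (\<epsilon> * T)" using mult_right_mono[OF K(1), of T] \<open>0 < T\<close> by simp
    finally show "(1 + 2 * n * \<delta> z) ^ k \<le> exp (\<epsilon> * T)" .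
    have "(1 + R) ^ k = exp (k * ln (1 + R))" using r by (simp add: exp_of_nat_mult)
    then show "(1 + R) ^ k \<le> exp (\<epsilon> * T)" using T unfolding T_def by simp
  qed (use d r in auto)
  also have "\<dots> = S * exp (7 * \<epsilon> * T)" by (simp add: algebra_simps flip: exp_add)
  finally show ?thesis unfolding T_def .
qed

text \<open>
  A length scale suited to \<open>t\<close>: the distance to the nearest zero if that is less than \<open>c\<close>, and \<open>c\<close> otherwise.
  Beyond half of this scale the truncated exponent is at most \<open>C * N * d\<close>, except at a fixed
  distance, where only the global bound is available.
\<close>

lemma tangent_scale:
  fixes K B t :: real
  assumes N: "N = K * n" and "0 < K" and good: "\<And>z. z \<in> Z \<Longrightarrow> \<delta> z \<le> \<bar>t - z\<bar>"
    and B: "\<And>t. (\<forall>z\<in>Z. c \<le> \<bar>t - z\<bar>) \<Longrightarrow> H t \<le> B" "0 \<le> B" "B \<le> K * c"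
  obtains d where "0 < d" "d \<le> c" "\<And>z. z \<in> Z \<Longrightarrow> d \<le> \<bar>t - z\<bar>" "H t \<le> C * (N * d)"
    "(\<exists>z\<in>Z. \<delta> z \<le> d) \<or> d = c"
    "\<And>s. d / 2 \<le> \<bar>s - t\<bar> \<Longrightarrow> trunc s \<le> C * (N * d) \<or> c / 2 \<le> \<bar>s - t\<bar>"
proof -
  have "K \<le> N" unfolding N using n_pos \<open>0 < K\<close> by simp
  have tr: "trunc t = H t" using trunc_good good by blast
  show thesis
  proof (cases "\<exists>z\<in>Z. \<bar>t - z\<bar> < c")
    case True
    then obtain z where z: "z \<in> Z" "\<bar>t - z\<bar> < c" by blast
    have dz: "\<delta> z \<le> \<bar>t - z\<bar>" "0 < \<delta> z" using good \<delta>_pos z by auto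
    have le: "C * (N * \<delta> z) \<le> C * (N * \<bar>t - z\<bar>)" using dz N_pos C_ge_1 by simp
    show thesis
    proof (rule that[of "\<bar>t - z\<bar>"])
      show "\<bar>t - z\<bar> \<le> \<bar>t - z'\<bar>" if "z' \<in> Z" for z'
        using separated[OF z(1) that] z(2) by (cases "z = z'") auto
      show "H t \<le> C * (N * \<bar>t - z\<bar>)" using trunc_le_near[OF z(1), of t] z c_pos tr le by simp
      show "trunc s \<le> C * (N * \<bar>t - z\<bar>) \<or> c / 2 \<le> \<bar>s - t\<bar>" for s
        using trunc_le_near[OF z(1), of s] le z by linarith
    qed (use z dz in auto)
  next
    case False
    have "H t \<le> B" using B(1) False by force
    also have "B \<le> K * c" by (rule B(3))
    also have "\<dots> \<le> N * c" using \<open>K \<le> N\<close> c_pos by simp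
    also have "\<dots> \<le> C * (N * c)"
      using mult_right_mono[OF C_ge_1, of "N * c"] c_pos N_pos by simp
    finally show thesis using that[of c] False c_pos by force
  qed
qed

text \<open>
  The multiplier at scale \<open>d\<close> has the complex parameter \<open>- d * (8 * M + \<i> * b)\<close>.  Its imaginary part reproduces
  the slope \<open>b\<close> of the tangent up to a cubic error, and its real part dominates this error, the
  quadratic remainder, and the exponent beyond distance \<open>d / 2\<close>.  The multiplier at scale \<open>c\<close>
  takes care of points at a fixed distance.
\<close>

lemma disc_bound_away_from_zeros:
  fixes K B t :: real
  assumes N: "N = K * n" and "0 < K" and good: "\<And>z. z \<in> Z \<Longrightarrow> \<delta> z \<le> \<bar>t - z\<bar>"
    and B: "\<And>t. (\<forall>z\<in>Z. c \<le> \<bar>t - z\<bar>) \<Longrightarrow> H t \<le> B" "0 \<le> B" "B \<le> K * c" and "0 < \<theta>"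
    and w: "norm (w - of_real t) \<le> 1 / n"
  shows "norm (poly P (cos w)) * v t \<le>
    exp (9 * C\<^sup>2 * K + 10 * C * K / c + 1) * 6 ^ k * S * exp (trunc t)"
proof -
  have Z: "t \<notin> Z" using good \<delta>_pos by fastforce
  have Ht: "1 \<le> H t" using ge_1 Z by simp
  have tr: "trunc t = H t" using trunc_good good by blast
  have n0: "0 < real n" "1 \<le> real n" using n_pos by auto
  have "K \<le> N" unfolding N using n0 \<open>0 < K\<close> by simp
  obtain d where d: "0 < d" "d \<le> c" "\<And>z. z \<in> Z \<Longrightarrow> d \<le> \<bar>t - z\<bar>" "H t \<le> C * (N * d)"
    and dH: "\<And>s. d / 2 \<le> \<bar>s - t\<bar> \<Longrightarrow> trunc s \<le> C * (N * d) \<or> c / 2 \<le> \<bar>s - t\<bar>"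
    by (rule tangent_scale[OF N \<open>0 < K\<close> good B]) (auto intro: that)
  obtain b where b: "\<bar>b\<bar> \<le> C * H t / d"
    "\<And>s. \<bar>s - t\<bar> \<le> d / 2 \<Longrightarrow> H s \<le> H t + b * (s - t) + C * H t * (s - t)\<^sup>2 / d\<^sup>2"
    using tangent[OF d(1) _ d(3)] d(2) c_le_1 by force
  define M where "M = C\<^sup>2 * N"
  have M: "0 < M" "C * N \<le> M" unfolding M_def using C_ge_1 N_pos by (auto simp: power2_eq_square)
  have CH: "C * H t \<le> M * d" unfolding M_def using mult_left_mono[OF d(4), of C] C_ge_1 by (simp add: power2_eq_square mult_ac)
  have bM: "\<bar>b\<bar> \<le> M"
  proof -
    have "C * H t / d \<le> M * d / d" using CH d(1) by (intro divide_right_mono) auto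
    then show ?thesis using b(1) d(1) by simp
  qed
  have n1: "0 < 1 / real n" using n0 by simp
  have main: "norm (poly P (cos w)) * v t \<le> S * exp (H t + (9 * M / n + 10 * C * N / (c * n)) + n * (1 / n))
      * (1 + 2 * n * (1 / n)) ^ k * (1 + (1 / n) / (1 / n)) ^ k"
  proof (rule bound_on_disc[where A = "- of_real d * Complex (8 * M) b" and A' = "- of_real (10 * C * N)", OF d(1) c_pos n1 n1 _ _ _ w])
    show "\<bar>t - t\<bar> \<le> 1 / real n" by simp
  next
    fix s
    define y where "y = s - t"
    define X1 where "X1 = y\<^sup>2 / (y\<^sup>2 + d\<^sup>2)"
    define Y1 where "Y1 = d * y / (y\<^sup>2 + d\<^sup>2)"
    define X2 where "X2 = y\<^sup>2 / (y\<^sup>2 + c\<^sup>2)"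
    have pd: "0 < y\<^sup>2 + d\<^sup>2" using d by (simp add: add_nonneg_pos)
    have X0: "0 \<le> X1" "0 \<le> X2" unfolding X1_def X2_def by auto
    have Xc: "0 \<le> 10 * C * N * X2" using C_ge_1 N_pos X0 by simp
    have "trunc s - d * (8 * M * X1 + b * Y1) - 10 * C * N * X2 \<le> H t"
    proof (cases "\<bar>y\<bar> \<le> d / 2")
      case True
      have "s \<notin> Z" using d(3)[of s] d(1) True unfolding y_def by (auto simp: abs_minus_commute)
      then have "trunc s \<le> H s" by (rule trunc_le)
      also have "\<dots> \<le> H t + b * y + (C * H t) * y\<^sup>2 / d\<^sup>2" using b(2) True unfolding y_def by simp
      also have "\<dots> \<le> H t + b * y + (M * d) * y\<^sup>2 / d\<^sup>2"
        using CH by (intro add_left_mono divide_right_mono mult_right_mono) auto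
      also have "(M * d) * y\<^sup>2 / d\<^sup>2 \<le> 2 * M * d * X1"
      proof -
        have "y\<^sup>2 \<le> (d / 2)\<^sup>2" using True abs_le_square_iff[of y "d / 2"] d by simp
        then have "4 * y\<^sup>2 \<le> d\<^sup>2" by (simp add: power_divide)
        then have "y\<^sup>2 + d\<^sup>2 \<le> 2 * d\<^sup>2" using zero_le_power2[of y] by linarith
        then have "y\<^sup>2 * (y\<^sup>2 + d\<^sup>2) \<le> y\<^sup>2 * (2 * d\<^sup>2)" by (intro mult_left_mono) auto
        then have "y\<^sup>2 / d\<^sup>2 \<le> 2 * X1" unfolding X1_def using pd d by (simp add: field_simps)
        then have "(M * d) * (y\<^sup>2 / d\<^sup>2) \<le> (M * d) * (2 * X1)" using M d by (intro mult_left_mono) auto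
        then show ?thesis by simp
      qed
      finally have 1: "trunc s \<le> H t + b * y + 2 * M * d * X1" by simp
      have "y * X1 + d * Y1 = y * (y\<^sup>2 + d\<^sup>2) / (y\<^sup>2 + d\<^sup>2)"
        unfolding X1_def Y1_def by (simp add: power2_eq_square algebra_simps flip: add_divide_distrib)
      then have "y * X1 = y - d * Y1" using d(1) by simp
      then have "b * (y * X1) = b * y - b * (d * Y1)" by (simp only: right_diff_distrib)
      then have "b * y - d * (b * Y1) = b * (y * X1)" by simp
      also have "\<dots> \<le> \<bar>b\<bar> * (\<bar>y\<bar> * X1)" using X0 abs_ge_self[of "b * (y * X1)"] by (simp add: abs_mult)
      also have "\<dots> \<le> M * (d * X1)" using bM True d X0 M by (intro mult_mono mult_right_mono) auto
      finally have "b * y - d * (b * Y1) \<le> M * d * X1" by simp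
      moreover have "0 \<le> M * d * X1" using M d X0 by simp
      ultimately show ?thesis using 1 Xc by (simp add: algebra_simps)
    next
      case False
      have X1: "1 / 5 \<le> X1"
      proof -
        have "(d / 2)\<^sup>2 \<le> y\<^sup>2" using False abs_le_square_iff[of "d / 2" y] d by simp
        then have "d\<^sup>2 \<le> 4 * y\<^sup>2" by (simp add: power_divide)
        then show ?thesis unfolding X1_def using pd by (simp add: le_divide_eq)
      qed
      have "2 * (d * \<bar>y\<bar>) \<le> y\<^sup>2 + d\<^sup>2" using sum_squares_bound[of d "\<bar>y\<bar>"] by (simp add: mult_ac)
      then have "\<bar>Y1\<bar> \<le> 1 / 2" unfolding Y1_def using pd d by (simp add: abs_mult divide_le_eq)
      then have "\<bar>b * Y1\<bar> \<le> M * (1 / 2)" unfolding abs_mult using bM M by (intro mult_mono) auto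
      then have bY: "- (M / 2) \<le> b * Y1" by linarith
      have "8 * M * (1 / 5) \<le> 8 * M * X1" using M X1 by (intro mult_left_mono) auto
      then have "M \<le> 8 * M * X1 + b * Y1" using bY M by linarith
      then have 2: "d * M \<le> d * (8 * M * X1 + b * Y1)" using d by (intro mult_left_mono) auto
      have "trunc s \<le> C * (N * d) \<or> c / 2 \<le> \<bar>y\<bar>" using dH[of s] False unfolding y_def by simp
      then show ?thesis
      proof
        assume "trunc s \<le> C * (N * d)"
        also have "\<dots> \<le> d * M" using mult_left_mono[OF M(2), of d] d by (simp add: mult_ac)
        finally show ?thesis using 2 Xc Ht by linarith
      next
        assume "c / 2 \<le> \<bar>y\<bar>"
        then have "(c / 2)\<^sup>2 \<le> y\<^sup>2" using abs_le_square_iff[of "c / 2" y] c_pos by simp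
        then have "c\<^sup>2 \<le> 4 * y\<^sup>2" by (simp add: power_divide)
        moreover have "0 < y\<^sup>2 + c\<^sup>2" using c_pos by (simp add: add_nonneg_pos)
        ultimately have "1 / 5 \<le> X2" unfolding X2_def by (simp add: le_divide_eq)
        then have "10 * C * N * (1 / 5) \<le> 10 * C * N * X2" using C_ge_1 N_pos by (intro mult_left_mono) auto
        moreover have "trunc s \<le> 2 * C * N"
        proof -
          have "trunc s \<le> C * \<theta> * N + B" using trunc_le_global[OF B(1,2), of s] \<open>0 < \<theta>\<close> by simp
          also have "C * \<theta> * N \<le> C * 1 * N" using C_ge_1 N_pos \<theta>_le c_le_1 by (intro mult_right_mono mult_left_mono) auto
          also have "B \<le> C * N"
          proof -
            have "K * c \<le> K * 1" using c_le_1 \<open>0 < K\<close> by (intro mult_left_mono) auto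
            then have "B \<le> K * 1" using B(3) by linarith
            also have "\<dots> \<le> 1 * N" using \<open>K \<le> N\<close> by simp
            also have "\<dots> \<le> C * N" using C_ge_1 N_pos by (intro mult_right_mono) auto
            finally show ?thesis .
          qed
          finally show ?thesis by simp
        qed
        moreover have "0 \<le> d * M" using d M by simp
        ultimately show ?thesis using 2 Ht by linarith
      qed
    qed
    then show "trunc s + (Re (- of_real d * Complex (8 * M) b * half_plane_map t d (of_real s)) +
          Re (- of_real (10 * C * N) * half_plane_map t c (of_real s))) \<le> H t"
      by (simp add: half_plane_map_of_real[OF d(1)] half_plane_map_of_real[OF c_pos] X1_def X2_def Y1_def algebra_simps flip: y_def)
  next
    fix w :: complex
    assume Im: "0 \<le> Im w" and nw: "norm (w - of_real t) = 1 / n"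
    have r: "- (norm a * (1 / n / e)) \<le> Re (a * half_plane_map t e w)" if "0 < e" for a e
    proof -
      have "\<bar>Re (a * half_plane_map t e w)\<bar> \<le> norm a * norm (half_plane_map t e w)"
        using abs_Re_le_cmod norm_mult by metis
      also have "\<dots> \<le> norm a * (1 / n / e)"
        using norm_half_plane_map_le[OF that Im, of t] nw by (intro mult_left_mono) auto
      finally show ?thesis by linarith
    qed
    have "norm (- of_real d * Complex (8 * M) b) \<le> d * (8 * M + \<bar>b\<bar>)"
      using cmod_le[of "Complex (8 * M) b"] d M by (simp add: norm_mult mult_left_mono)
    also have "\<dots> \<le> d * (9 * M)" using bM d by (intro mult_left_mono) auto
    finally have "norm (- of_real d * Complex (8 * M) b) * (1 / n / d) \<le> d * (9 * M) * (1 / n / d)"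
      using d by (intro mult_right_mono) auto
    also have "\<dots> = 9 * M / n" using d by simp
    finally have 1: "norm (- of_real d * Complex (8 * M) b) * (1 / n / d) \<le> 9 * M / n" .
    have "norm (- of_real (10 * C * N) :: complex) * (1 / n / c) = 10 * C * N / (c * n)"
      using C_ge_1 N_pos by (simp add: norm_mult)
    then show "- (9 * M / n + 10 * C * N / (c * n)) \<le> Re (- of_real d * Complex (8 * M) b * half_plane_map t d w) +
          Re (- of_real (10 * C * N) * half_plane_map t c w)"
      using r[OF d(1), of "- of_real d * Complex (8 * M) b"] r[OF c_pos, of "- of_real (10 * C * N)"] 1 by linarith
  qed
  have e: "9 * M / n + 10 * C * N / (c * n) = 9 * C\<^sup>2 * K + 10 * C * K / c"
    unfolding M_def N using n0 by simp
  have six: "(3 :: real) ^ k * 2 ^ k = 6 ^ k" by (simp flip: power_mult_distrib)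
  have "norm (poly P (cos w)) * v t \<le> S * exp (H t + (9 * C\<^sup>2 * K + 10 * C * K / c) + 1) * 6 ^ k"
    using main n0 six unfolding e by (simp add: mult.assoc)
  also have "\<dots> = exp (9 * C\<^sup>2 * K + 10 * C * K / c + 1) * 6 ^ k * S * exp (trunc t)"
    unfolding tr by (simp add: exp_add mult_ac)
  finally show ?thesis .
qed

end

section \<open>A weighted Bernstein theorem\<close>

text \<open>
  The exponent \<open>h\<close> may replace \<open>H\<close> in weighted estimates for degree \<open>n\<close>: bounds with \<open>h\<close> extend to discs of
  radius \<open>\<kappa> / n\<close>, and near-maximal points of the weighted polynomial lie where \<open>h\<close> equals \<open>H\<close> and
  \<open>H\<close> does not increase by more than a constant at that scale.  The weight \<open>v\<close> is arbitrary
  apart from its growth.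
\<close>

definition bernstein_majorant ::
    "(real \<Rightarrow> real) \<Rightarrow> real set \<Rightarrow> nat \<Rightarrow> real \<Rightarrow> real \<Rightarrow> nat \<Rightarrow> (real \<Rightarrow> real) \<Rightarrow> bool" where
  "bernstein_majorant H Z k \<kappa> M n h \<longleftrightarrow> (\<forall>t. 0 \<le> h t) \<and> (\<forall>t. t \<notin> Z \<longrightarrow> h t \<le> H t) \<and>
    (\<forall>(P :: complex poly) v S. degree P \<le> n \<longrightarrow> (\<forall>t. 0 \<le> v t) \<longrightarrow>
      (\<forall>s t. v t \<le> (1 + real n * \<bar>s - t\<bar>) ^ k * v s) \<longrightarrow> 0 \<le> S \<longrightarrow>
      (\<forall>s. norm (poly P (of_real (cos s))) * v s \<le> S * exp (h s)) \<longrightarrow>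
      (\<forall>t w. norm (w - of_real t) \<le> \<kappa> / n \<longrightarrow> norm (poly P (cos w)) * v t \<le> M * S * exp (h t)) \<and>
      (\<forall>t. norm (poly P (of_real (cos t))) * v t \<le> S * exp (h t) / 4 \<or>
        h t = H t \<and> (\<forall>s. \<bar>s - t\<bar> \<le> \<kappa> / n \<longrightarrow> s \<notin> Z \<and> H s \<le> H t + M)))"

text \<open>
  The exponent \<open>h\<close> is \<open>H\<close> truncated near its singularities.  The constants have to be chosen in the order
  \<open>\<epsilon>\<close>, \<open>r\<close>, \<open>R\<close>, \<open>\<theta>\<close>, \<open>K\<close>.  With \<open>\<epsilon> = 1 / (16 * C)\<close> the seven contributions near a zero sum up
  to less than half of the truncated exponent \<open>T / C\<close>.
\<close>

theorem (in singular_exponent) weighted_bernstein: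
  "\<exists>\<kappa>>0. \<exists>M. \<forall>n\<ge>1. \<exists>h. bernstein_majorant H Z k \<kappa> M n h"
proof -
  obtain B0 where B0: "\<And>t. (\<forall>z\<in>Z. c \<le> \<bar>t - z\<bar>) \<Longrightarrow> H t \<le> B0" using bounded_away[OF c_pos] by blast
  define B where "B = max B0 0"
  have B: "(\<forall>z\<in>Z. c \<le> \<bar>t - z\<bar>) \<Longrightarrow> H t \<le> B" "0 \<le> B" for t unfolding B_def using B0 by fastforce+
  \<comment> \<open>\<open>7 * \<epsilon> * T\<close> has to stay below \<open>T / (2 * C)\<close>\<close>
  define \<epsilon> where "\<epsilon> = 1 / (16 * C)"
  have \<epsilon>: "0 < \<epsilon>" unfolding \<epsilon>_def using C_ge_1 by simp
  \<comment> \<open>the distance, in units of \<open>\<delta> z\<close>, at which the exponent has decayed to \<open>\<epsilon> * T\<close>\<close>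
  define r where "r = max 1 ((C / \<epsilon>) powr (1 / \<alpha>))"
  have r1: "1 \<le> r" unfolding r_def by simp
  have r2: "C * r powr - \<alpha> \<le> \<epsilon>"
  proof -
    have "((C / \<epsilon>) powr (1 / \<alpha>)) powr \<alpha> \<le> r powr \<alpha>" unfolding r_def using \<alpha>_pos by (intro powr_mono2) auto
    then have "C / \<epsilon> \<le> r powr \<alpha>" using \<alpha>_pos C_ge_1 \<epsilon> by (simp add: powr_powr)
    then show ?thesis using \<epsilon> r1 by (simp add: powr_minus field_simps)
  qed
  \<comment> \<open>chosen so that \<open>2 * C * (r / (R - r)) = \<epsilon>\<close>\<close>
  define R where "R = r * (1 + 2 * C / \<epsilon>)"
  have C\<epsilon>: "0 < C / \<epsilon>" using C_ge_1 \<epsilon> by simp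
  have rR: "r < R"
  proof -
    have "0 < r * (2 * (C / \<epsilon>))" using r1 C\<epsilon> by (intro mult_pos_pos) auto
    then show ?thesis unfolding R_def by (simp add: distrib_left)
  qed
  have R2: "2 \<le> R"
  proof -
    have "1 \<le> 2 * C / \<epsilon>" unfolding \<epsilon>_def using C_ge_1 mult_mono[OF C_ge_1 C_ge_1] by simp
    then have "1 * 2 \<le> r * (1 + 2 * C / \<epsilon>)" using r1 by (intro mult_mono) auto
    then show ?thesis unfolding R_def by simp
  qed
  have R3: "2 * C * (r / (R - r)) \<le> \<epsilon>"
  proof -
    have "R - r = r * (2 * C / \<epsilon>)" unfolding R_def by (simp add: algebra_simps)
    then show ?thesis using r1 \<epsilon> C_ge_1 by simp
  qed
  define T0 where "T0 = max (k * ln (1 + R) / \<epsilon>) (4 * C)"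
  have T0: "0 < T0" unfolding T0_def using C_ge_1 by simp
  define \<theta> where "\<theta> = min c (min (\<epsilon> * c / (2 * C * R)) (c / ((C * T0) powr (1 / \<alpha>))))"
  have \<theta>: "0 < \<theta>" "\<theta> \<le> c" "2 * C * \<theta> * R / c \<le> \<epsilon>" "C * T0 \<le> (c / \<theta>) powr \<alpha>"
  proof -
    have CT: "0 < C * T0" using C_ge_1 T0 by simp
    have "C * T0 \<noteq> 0" using CT by linarith
    then have "0 < c / ((C * T0) powr (1 / \<alpha>))" using c_pos by (intro divide_pos_pos) (simp_all only: powr_gt_zero not_False_eq_True)
    then show "0 < \<theta>" "\<theta> \<le> c" unfolding \<theta>_def using c_pos \<epsilon> C_ge_1 R2 CT by auto
    have "\<theta> \<le> \<epsilon> * c / (2 * C * R)" unfolding \<theta>_def by simp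
    then show "2 * C * \<theta> * R / c \<le> \<epsilon>" using c_pos C_ge_1 R2 by (simp add: field_simps)
    have "\<theta> \<le> c / ((C * T0) powr (1 / \<alpha>))" unfolding \<theta>_def by simp
    moreover have "0 < (C * T0) powr (1 / \<alpha>)" using \<open>C * T0 \<noteq> 0\<close> by (simp only: powr_gt_zero not_False_eq_True)
    ultimately have "(C * T0) powr (1 / \<alpha>) \<le> c / \<theta>" using \<open>0 < \<theta>\<close> by (simp add: pos_le_divide_eq mult.commute)
    then have "((C * T0) powr (1 / \<alpha>)) powr \<alpha> \<le> (c / \<theta>) powr \<alpha>" using \<alpha>_pos by (intro powr_mono2) auto
    then show "C * T0 \<le> (c / \<theta>) powr \<alpha>" using CT \<alpha>_pos by (simp add: powr_powr)
  qed
  obtain K0 where K0: "0 < K0" "\<And>N z. K0 \<le> N \<Longrightarrow> z \<in> Z \<Longrightarrow> \<exists>\<delta>. 0 < \<delta> \<and> \<delta> \<le> \<theta> \<and> H (z + \<delta>) = N * \<delta>"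
    using exists_critical_scale[OF \<theta>(1,2)] by blast
  define K where "K = K0 + 1 / c + B / c + 2 * k / \<epsilon> + R / \<epsilon> + 2 * B * R / (c * \<epsilon>)"
  have K_ge: "K0 \<le> K" "1 / c \<le> K" "B / c \<le> K" "2 * k / \<epsilon> \<le> K" "R / \<epsilon> \<le> K" "2 * B * R / (c * \<epsilon>) \<le> K"
    unfolding K_def using K0 c_pos B(2) \<epsilon> R2 by (auto intro!: add_nonneg_nonneg simp: add_increasing add_increasing2)
  have "0 < K" using K_ge K0 by simp
  have K: "2 * k / K \<le> \<epsilon>" "R / K \<le> \<epsilon>" "B \<le> K * c" "1 \<le> K * c"
    using K_ge \<open>0 < K\<close> \<epsilon> c_pos by (simp_all add: field_simps)
  define \<kappa> where "\<kappa> = 1 / (2 * K)"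
  define M1 where "M1 = exp (9 * C\<^sup>2 * K + 10 * C * K / c + 1) * 6 ^ k"
  define M where "M = max 1 M1 + C\<^sup>2"
  have M: "1 \<le> M" "M1 \<le> M" "C\<^sup>2 \<le> M" unfolding M_def by (auto simp: add_increasing2)
  have "0 < \<kappa>" unfolding \<kappa>_def using \<open>0 < K\<close> by simp
  show ?thesis
  proof (rule exI[of _ \<kappa>], intro exI[of _ M] conjI allI impI \<open>0 < \<kappa>\<close>)
    fix n :: nat assume n: "1 \<le> n"
    define N where "N = K * n"
    have KN: "K \<le> N" unfolding N_def using n \<open>0 < K\<close> by simp
    have "\<forall>z\<in>Z. \<exists>\<delta>. 0 < \<delta> \<and> \<delta> \<le> \<theta> \<and> H (z + \<delta>) = N * \<delta>" using K0(2)[of N] KN K_ge by simp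
    then obtain \<delta> where \<delta>: "\<And>z. z \<in> Z \<Longrightarrow> 0 < \<delta> z \<and> \<delta> z \<le> \<theta> \<and> H (z + \<delta> z) = N * \<delta> z" by metis
    interpret T: truncated_exponent H Z c C \<alpha> \<delta> N \<theta>
      by unfold_locales (use \<delta> \<theta> KN \<open>0 < K\<close> in auto)
    let ?h = T.trunc
    have K4: "2 * B * R / (c * N) \<le> \<epsilon>"
    proof -
      have "2 * B * R / (c * \<epsilon>) \<le> N" using KN K_ge by linarith
      then show ?thesis using c_pos \<epsilon> \<open>0 < K\<close> KN by (simp add: field_simps)
    qed
    have main: "norm (w - of_real t) \<le> \<kappa> / n \<longrightarrow> norm (poly P (cos w)) * v t \<le> M * S * exp (?h t)" (is "?A t w")
      and alt: "norm (poly P (of_real (cos t))) * v t \<le> S * exp (?h t) / 4 \<or>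
        ?h t = H t \<and> (\<forall>s. \<bar>s - t\<bar> \<le> \<kappa> / n \<longrightarrow> s \<notin> Z \<and> H s \<le> H t + M)" (is "?B t")
      if degP: "degree P \<le> n" and v0: "\<forall>t. 0 \<le> v t" and vg: "\<forall>s t. v t \<le> (1 + real n * \<bar>s - t\<bar>) ^ k * v s"
        and S0: "0 \<le> S" and bd: "\<forall>s. norm (poly P (of_real (cos s))) * v s \<le> S * exp (?h s)"
      for P :: "complex poly" and v S t w
    proof -
      interpret W: weighted_polynomial H Z c C \<alpha> \<delta> N \<theta> n k v S P
        by unfold_locales (use n degP v0 vg S0 bd in auto)
      have "?A t w \<and> ?B t"
      proof (cases "\<exists>z\<in>Z. \<bar>t - z\<bar> < \<delta> z")
        case True
        then obtain z where z: "z \<in> Z" "\<bar>t - z\<bar> < \<delta> z" by blast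
        define T where "T = N * \<delta> z"
        have "C * T0 \<le> C * T" unfolding T_def using T.critical_large[OF z(1) \<theta>(1)] \<theta>(4) by linarith
        then have TT: "T0 \<le> T" using C_ge_1 by simp
        have T1: "k * ln (1 + R) \<le> \<epsilon> * T" "4 * C \<le> T"
          using TT \<epsilon> unfolding T0_def by (auto simp: field_simps)
        have h: "?h t = T / C" unfolding T_def by (rule T.trunc_near[OF z])
        have disc: "norm (poly P (cos u)) * v t \<le> S * exp (?h t - T / (2 * C))"
          if "norm (u - of_real z) \<le> R * \<delta> z" for u
        proof -
          have "norm (poly P (cos u)) * v t \<le> S * exp (7 * \<epsilon> * (N * \<delta> z))"
            by (rule W.disc_bound_near_zero[OF N_def \<open>0 < K\<close> z(1) _ B \<theta>(1) _ r1 rR r2 R3 K(1,2) \<theta>(3) K4 T1(1)[unfolded T_def] that])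
              (use z \<epsilon> in auto)
          also have "7 * \<epsilon> * (N * \<delta> z) \<le> ?h t - T / (2 * C)"
            unfolding h \<epsilon>_def T_def[symmetric] using T1 C_ge_1 by (simp add: field_simps)
          finally show ?thesis using S0 by (simp add: mult_left_mono)
        qed
        have d: "0 < \<delta> z" "\<delta> z \<le> R * \<delta> z - \<delta> z" using \<delta>[OF z(1)] mult_right_mono[OF R2, of "\<delta> z"] by auto
        have "?A t w"
        proof
          assume w: "norm (w - of_real t) \<le> \<kappa> / n"
          have "1 \<le> T" using T1 C_ge_1 by simp
          then have "\<kappa> / n \<le> \<delta> z" unfolding \<kappa>_def T_def N_def using \<open>0 < K\<close> n by (simp add: field_simps)
          moreover have "norm (of_real t - of_real z :: complex) \<le> \<delta> z"
            using z by (simp flip: of_real_diff)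
          moreover have "w - of_real z = (w - of_real t) + (of_real t - of_real z)" by simp
          ultimately have "norm (w - of_real z) \<le> R * \<delta> z" using d w
            by (smt (verit, best) norm_triangle_ineq)
          then have "norm (poly P (cos w)) * v t \<le> S * exp (?h t - T / (2 * C))" by (rule disc)
          also have "\<dots> \<le> S * exp (?h t)" using S0 T1 C_ge_1 by (intro mult_left_mono) auto
          also have "\<dots> \<le> M * (S * exp (?h t))" using mult_right_mono[OF M(1), of "S * exp (?h t)"] S0 by simp
          finally show "norm (poly P (cos w)) * v t \<le> M * S * exp (?h t)" by (simp add: mult.assoc)
        qed
        moreover have "norm (poly P (of_real (cos t))) * v t \<le> S * exp (?h t) / 4"
        proof -
          have "\<bar>t - z\<bar> \<le> R * \<delta> z" using z(2) d by linarith
          then have "norm (of_real t - of_real z :: complex) \<le> R * \<delta> z"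
            by (simp flip: of_real_diff)
          then have "norm (poly P (of_real (cos t))) * v t \<le> S * exp (?h t - T / (2 * C))"
            using disc[of "of_real t"] by (simp add: cos_of_real)
          also have "exp (?h t - T / (2 * C)) \<le> exp (?h t) / 4"
          proof -
            have "2 \<le> T / (2 * C)" using T1 C_ge_1 by (simp add: field_simps)
            then have "exp 2 \<le> exp (T / (2 * C))" by simp
            moreover have "4 \<le> exp (2 :: real)"
            proof -
              have "2 \<le> exp (1 :: real)" using exp_ge_add_one_self[of 1] by simp
              then have "2 * 2 \<le> exp (1 :: real) * exp 1" by (intro mult_mono) auto
              then show ?thesis by (simp flip: exp_add)
            qed
            ultimately have "4 \<le> exp (T / (2 * C))" by linarith
            then show ?thesis unfolding exp_diff by (intro divide_left_mono) auto
          qed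
          finally show ?thesis using S0 by (simp add: mult_left_mono)
        qed
        ultimately show ?thesis by blast
      next
        case False
        then have good: "\<And>z. z \<in> Z \<Longrightarrow> \<delta> z \<le> \<bar>t - z\<bar>" by force
        have n0: "0 < real n" using n by simp
        have "?A t w"
        proof
          assume w: "norm (w - of_real t) \<le> \<kappa> / n"
          have "K * c \<le> K * 1" using c_le_1 \<open>0 < K\<close> by (intro mult_left_mono) auto
          then have "1 \<le> K" using K(4) by linarith
          then have "\<kappa> / n \<le> 1 / n" unfolding \<kappa>_def using n0 by (simp add: field_simps)
          then have "norm (poly P (cos w)) * v t \<le> M1 * S * exp (?h t)"
            unfolding M1_def by (intro W.disc_bound_away_from_zeros[OF N_def \<open>0 < K\<close> good B K(3) \<theta>(1)]) (use w in auto)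
          also have "\<dots> \<le> M * S * exp (?h t)" using M S0 by (intro mult_right_mono) auto
          finally show "norm (poly P (cos w)) * v t \<le> M * S * exp (?h t)" .
        qed
        moreover have "?h t = H t" by (rule T.trunc_good[OF good])
        moreover have "s \<notin> Z \<and> H s \<le> H t + M" if s: "\<bar>s - t\<bar> \<le> \<kappa> / n" for s
        proof -
          obtain d where d: "0 < d" "d \<le> 1" "1 \<le> N * d" "\<And>z. z \<in> Z \<Longrightarrow> d \<le> \<bar>t - z\<bar>" "H t \<le> C * (N * d)"
          proof (rule W.tangent_scale[OF N_def \<open>0 < K\<close> good B(1) B(2) K(3)])
            fix d assume d: "0 < d" "d \<le> c" "\<And>z. z \<in> Z \<Longrightarrow> d \<le> \<bar>t - z\<bar>" "H t \<le> C * (N * d)"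
            assume "(\<exists>z\<in>Z. \<delta> z \<le> d) \<or> d = c"
            moreover have "1 \<le> N * d" if z: "z \<in> Z" "\<delta> z \<le> d" for z
            proof -
              have "C * 1 \<le> C * (N * \<delta> z)"
                using T.critical_large[OF z(1) \<theta>(1)] \<theta>(4) mult_left_mono[of 1 T0 C] C_ge_1 unfolding T0_def by linarith
              then have "1 \<le> N * \<delta> z" using C_ge_1 by simp
              also have "\<dots> \<le> N * d" using z KN \<open>0 < K\<close> by simp
              finally show ?thesis .
            qed
            moreover have "1 \<le> N * c" using K(4) mult_right_mono[OF KN, of c] c_pos by linarith
            ultimately have "1 \<le> N * d" by blast
            then show thesis using that d c_le_1 by force
          qed
          obtain b where b: "\<bar>b\<bar> \<le> C * H t / d"
            "\<And>s. \<bar>s - t\<bar> \<le> d / 2 \<Longrightarrow> H s \<le> H t + b * (s - t) + C * H t * (s - t)\<^sup>2 / d\<^sup>2"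
            using tangent[OF d(1,2,4)] by blast
          define y where "y = s - t"
          have Ny: "N * \<bar>y\<bar> \<le> 1 / 2"
            using s n0 \<open>0 < K\<close> mult_left_mono[of "\<bar>s - t\<bar>" "\<kappa> / n" N] unfolding y_def \<kappa>_def N_def by simp
          then have "N * \<bar>y\<bar> \<le> N * (d / 2)" using d(3) by simp
          then have yd: "\<bar>y\<bar> \<le> d / 2" using KN \<open>0 < K\<close> by simp
          have CH: "C * H t / d \<le> C\<^sup>2 * N"
            using d(1) mult_left_mono[OF d(5), of C] C_ge_1 by (simp add: divide_le_eq power2_eq_square mult_ac)
          have b_le: "b * y \<le> C\<^sup>2 * (1 / 2)"
          proof -
            have "b * y \<le> \<bar>b\<bar> * \<bar>y\<bar>" using abs_ge_self[of "b * y"] by (simp add: abs_mult)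
            also have "\<dots> \<le> (C\<^sup>2 * N) * \<bar>y\<bar>" using b(1) CH by (intro mult_right_mono) auto
            also have "\<dots> = C\<^sup>2 * (N * \<bar>y\<bar>)" by simp
            also have "\<dots> \<le> C\<^sup>2 * (1 / 2)" using Ny by (intro mult_left_mono) auto
            finally show ?thesis .
          qed
          have "C * H t * y\<^sup>2 / d\<^sup>2 = (C * H t / d) * (\<bar>y\<bar> * (\<bar>y\<bar> / d))"
            using d(1) by (simp add: power2_eq_square)
          also have "\<dots> \<le> (C\<^sup>2 * N) * (\<bar>y\<bar> * 1)"
            using CH yd d(1) KN \<open>0 < K\<close> by (intro mult_mono) (auto simp: divide_le_eq)
          also have "\<dots> = C\<^sup>2 * (N * \<bar>y\<bar>)" by simp
          also have "\<dots> \<le> C\<^sup>2 * (1 / 2)" using Ny by (intro mult_left_mono) auto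
          finally have quadratic: "C * H t * y\<^sup>2 / d\<^sup>2 \<le> C\<^sup>2 * (1 / 2)" .
          have "H s \<le> H t + b * y + C * H t * y\<^sup>2 / d\<^sup>2" using b(2)[of s] yd unfolding y_def by simp
          then have "H s \<le> H t + M" using quadratic b_le M(3) by linarith
          moreover have "s \<notin> Z" using d(4)[of s] yd d(1) unfolding y_def by (auto simp: abs_minus_commute)
          ultimately show ?thesis by simp
        qed
        ultimately show ?thesis by blast
      qed
      then show "?A t w" and "?B t" by blast+
    qed
    show "\<exists>h. bernstein_majorant H Z k \<kappa> M n h" unfolding bernstein_majorant_def
      by (intro exI[of _ ?h] conjI allI impI T.trunc_nonneg T.trunc_le)
        (assumption | (rule main[THEN mp]; assumption) | (rule alt; assumption))+
  qed
qed

section \<open>Factors from the class Omega\<close>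

text \<open>
  The properties of the exponent of a single factor from the class \<open>\<Omega>\<close> that are needed for sums.  Periodicity and
  finiteness on an interval slightly longer than a period replace the separation of the zeros, because the
  union of finitely many separated sets need not be separated.  The lower bound \<open>1 \<le> C * h (z + y)\<close>
  makes \<open>h\<close> dominate near its zeros any summand that is bounded there.
\<close>

locale singular_factor =
  fixes Z :: "real set" and h :: "real \<Rightarrow> real"
  assumes periodic: "t \<in> Z \<Longrightarrow> t + 2 * pi \<in> Z \<and> t - 2 * pi \<in> Z"
    and finite_on_period: "finite (Z \<inter> {-1..2 * pi + 1})"
    and nonneg: "t \<notin> Z \<Longrightarrow> 0 \<le> h t"
    and continuous: "continuous_on (- Z) h"
    and bounded_away: "0 < \<eta> \<Longrightarrow> \<exists>B. \<forall>t. (\<forall>z\<in>Z. \<eta> \<le> \<bar>t - z\<bar>) \<longrightarrow> h t \<le> B"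
    and tangent: "\<exists>C. \<forall>d t. 0 < d \<longrightarrow> d \<le> 1 \<longrightarrow> (\<forall>z\<in>Z. d \<le> \<bar>t - z\<bar>) \<longrightarrow>
      (\<exists>b. \<bar>b\<bar> \<le> C * h t / d \<and>
        (\<forall>s. \<bar>s - t\<bar> \<le> d / 2 \<longrightarrow> h s \<le> h t + b * (s - t) + C * h t * (s - t)\<^sup>2 / d\<^sup>2))"
    and decay: "\<exists>\<sigma> C \<alpha>. 0 < \<sigma> \<and> 0 < \<alpha> \<and> (\<forall>z\<in>Z. \<forall>x y. 0 < \<bar>x\<bar> \<longrightarrow> \<bar>x\<bar> \<le> \<bar>y\<bar> \<longrightarrow> \<bar>y\<bar> \<le> \<sigma> \<longrightarrow>
      h (z + y) \<le> C * (\<bar>x\<bar> / \<bar>y\<bar>) powr \<alpha> * h (z + x) \<and> 1 \<le> C * h (z + y))"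

locale outer_function =
  fixes A :: real and F F1 F2 :: "real \<Rightarrow> real" and C0 a b :: real
  assumes A: "0 < A"
    and pos: "0 < x \<Longrightarrow> x \<le> A \<Longrightarrow> 0 < F x"
    and even: "x \<noteq> 0 \<Longrightarrow> - A \<le> x \<Longrightarrow> x \<le> A \<Longrightarrow> F x = F \<bar>x\<bar>"
    and anti: "0 < x \<Longrightarrow> x \<le> y \<Longrightarrow> y \<le> A \<Longrightarrow> F y \<le> F x"
    and F1: "0 < x \<Longrightarrow> x \<le> A \<Longrightarrow> (F has_real_derivative F1 x) (at x within {0<..A})"
    and F2: "0 < x \<Longrightarrow> x \<le> A \<Longrightarrow> (F1 has_real_derivative F2 x) (at x within {0<..A})"
    and C0: "0 < C0" and c1: "0 < x \<Longrightarrow> x \<le> A \<Longrightarrow> \<bar>F1 x\<bar> \<le> C0 * F x / x"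
    and c2: "0 < x \<Longrightarrow> x \<le> A \<Longrightarrow> \<bar>F2 x\<bar> \<le> C0 * F x / x\<^sup>2"
    and ab: "0 < a" "0 < b" "0 < x \<Longrightarrow> x \<le> A \<Longrightarrow> F1 x \<le> - (a * F x / x)"
    "0 < x \<Longrightarrow> x \<le> A \<Longrightarrow> - (b * F x / x) \<le> F1 x"

locale inner_function =
  fixes A :: real and g g1 g2 :: "real \<Rightarrow> real" and D \<kappa> :: real
  assumes g1: "(g has_real_derivative g1 t) (at t)" and g2: "(g1 has_real_derivative g2 t) (at t)"
    and D: "1 \<le> D" "\<bar>g1 t\<bar> \<le> D" "\<bar>g2 t\<bar> \<le> D" and \<kappa>: "0 < \<kappa>"
    and low: "d \<le> 1 \<Longrightarrow> (\<And>z. g z = 0 \<Longrightarrow> d \<le> \<bar>t - z\<bar>) \<Longrightarrow> \<kappa> * d \<le> \<bar>g t\<bar>"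
    and fin: "compact K \<Longrightarrow> finite ({t. g t = 0} \<inter> K)"
    and per: "g (t + 2 * pi) = g t" and gA: "\<bar>g t\<bar> \<le> A"

text \<open>
  Monotonicity determines the sign of the derivative, so the two-sided bound on \<open>\<bar>F'\<bar> * x / F\<close> becomes
  a two-sided bound on the logarithmic derivative of \<open>F\<close>.
\<close>

lemma Omega_outer_function:
  assumes F: "Omega_outer A F" and A: "0 < A"
  shows "\<exists>F1 F2 C a b. outer_function A F F1 F2 C a b"
proof -
  obtain \<Phi> B A1 A2 where \<Phi>: "derivs_on {0<..A} F \<Phi>" and B: "0 < B"
    "\<And>n x. 1 \<le> n \<Longrightarrow> x \<in> {0<..A} \<Longrightarrow> \<bar>\<Phi> n x\<bar> \<le> B ^ n * real n ^ n * F x / x ^ n"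
    and A12: "0 < A1" "0 < A2" "\<And>x. x \<in> {0<..A} \<Longrightarrow> A2 \<le> \<bar>\<Phi> 1 x\<bar> * x / F x"
    "\<And>x. x \<in> {0<..A} \<Longrightarrow> \<bar>\<Phi> 1 x\<bar> * x / F x \<le> A1"
    using F unfolding Omega_outer_def by blast
  have pos: "0 < F x" if "0 < x" "x \<le> A" for x using F that unfolding Omega_outer_def by force
  have even: "F x = F \<bar>x\<bar>" if "x \<noteq> 0" "- A \<le> x" "x \<le> A" for x
  proof (cases "0 \<le> x")
    case False
    then have "F (- x) = F x" using F that unfolding Omega_outer_def by force
    then show ?thesis using False by simp
  qed simp
  have anti: "F y \<le> F x" if "0 < x" "x \<le> y" "y \<le> A" for x y
  proof -
    have "antimono_on {0<..A} F" using F unfolding Omega_outer_def by blast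
    then show ?thesis using that by (auto simp: monotone_on_def)
  qed
  have \<Phi>0: "\<Phi> 0 x = F x" if "0 < x" "x \<le> A" for x using \<Phi> that unfolding derivs_on_def by simp
  have \<Phi>n: "(\<Phi> n has_real_derivative \<Phi> (Suc n) x) (at x within {0<..A})" if "0 < x" "x \<le> A" for n x
    using \<Phi> that unfolding derivs_on_def by simp
  have d1: "(F has_real_derivative \<Phi> 1 x) (at x within {0<..A})" if "0 < x" "x \<le> A" for x
    using has_field_derivative_transform_within[OF \<Phi>n[OF that, of 0], of 1 F] \<Phi>0 that by simp
  have neg: "\<Phi> 1 x \<le> 0" if x: "0 < x" "x \<le> A" for x
  proof (rule ccontr)
    assume "\<not> \<Phi> 1 x \<le> 0"
    then obtain d where d: "0 < d" "\<And>h. 0 < h \<Longrightarrow> x - h \<in> {0<..A} \<Longrightarrow> h < d \<Longrightarrow> F (x - h) < F x"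
      using has_real_derivative_pos_inc_left[OF d1[OF x]] by auto
    define h where "h = min d x / 2"
    have h: "0 < h" "h < d" "h < x" unfolding h_def using d x by auto
    then have "F (x - h) < F x" using d x by simp
    moreover have "F x \<le> F (x - h)" using anti[of "x - h" x] h x by simp
    ultimately show False by simp
  qed
  have ab: "\<Phi> 1 x \<le> - (A2 * F x / x)" "- (A1 * F x / x) \<le> \<Phi> 1 x" if "0 < x" "x \<le> A" for x
    using A12(3,4)[of x] that pos[OF that] neg[OF that] by (auto simp: field_simps)
  define C where "C = B + 4 * B\<^sup>2"
  have C: "0 < C" "B \<le> C" "4 * B\<^sup>2 \<le> C" unfolding C_def using B by (auto simp: add_pos_nonneg)
  have c1: "\<bar>\<Phi> 1 x\<bar> \<le> C * F x / x" if x: "0 < x" "x \<le> A" for x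
  proof -
    have "\<bar>\<Phi> 1 x\<bar> \<le> B * F x / x" using B(2)[of 1 x] x by simp
    also have "\<dots> \<le> C * F x / x" using C x pos[OF x] by (intro divide_right_mono mult_right_mono) auto
    finally show ?thesis .
  qed
  have c2: "\<bar>\<Phi> 2 x\<bar> \<le> C * F x / x\<^sup>2" if x: "0 < x" "x \<le> A" for x
  proof -
    have "\<bar>\<Phi> 2 x\<bar> \<le> (4 * B\<^sup>2) * F x / x\<^sup>2" using B(2)[of 2 x] x by (simp add: mult_ac)
    also have "\<dots> \<le> C * F x / x\<^sup>2" using C x pos[OF x] by (intro divide_right_mono mult_right_mono) auto
    finally show ?thesis .
  qed
  have d2: "(\<Phi> 1 has_real_derivative \<Phi> 2 x) (at x within {0<..A})" if "0 < x" "x \<le> A" for x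
    using \<Phi>n[OF that, of 1] by (simp add: numeral_2_eq_2)
  have "outer_function A F (\<Phi> 1) (\<Phi> 2) C A2 A1"
    by unfold_locales (fact A pos even anti d1 d2 C(1) c1 c2 A12(1,2) ab)+
  then show ?thesis by blast
qed

text \<open>
  The function \<open>ln (F x) + a * ln x\<close> has derivative \<open>F' / F + a / x\<close>, of known sign.  The derivative of \<open>F\<close> is
  one-sided at the endpoint \<open>A\<close>, whence the mean value theorem relative to an interval.
\<close>

lemma (in outer_function) power_comparison:
  assumes "0 < p" "p \<le> q" "q \<le> A"
  shows "F q \<le> (p / q) powr a * F p" and "F p \<le> (q / p) powr b * F q"
proof -
  have key: "\<exists>x. 0 < x \<and> x \<le> A \<and>
      (ln (F q) + e * ln q) - (ln (F p) + e * ln p) = (F1 x + e * F x / x) / F x * (q - p)" for e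
  proof -
    define f where "f = (\<lambda>x. ln (F x) + e * ln x)"
    have "(f has_derivative (*) (F1 x / F x + e / x)) (at x within {p..q})" if "p \<le> x" "x \<le> q" for x
    proof -
      have x: "0 < x" "x \<le> A" using that assms by auto
      have "(F has_real_derivative F1 x) (at x within {p..q})"
        by (rule has_field_derivative_subset[OF F1[OF x]]) (use assms in auto)
      then have "(f has_real_derivative F1 x / F x + e / x) (at x within {p..q})"
        unfolding f_def using x pos[OF x] by (auto intro!: derivative_eq_intros simp: field_simps)
      then show ?thesis by (simp add: has_field_derivative_def)
    qed
    then obtain x where x: "p \<le> x" "x \<le> q" "f q - f p = (F1 x / F x + e / x) * (q - p)"
      using mvt_very_simple[OF assms(2), of f "\<lambda>x. (*) (F1 x / F x + e / x)"] by auto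
    have xA: "0 < x" "x \<le> A" using x assms by auto
    have "F1 x / F x + e / x = (F1 x + e * F x / x) / F x" using pos[OF xA] xA by (simp add: field_simps)
    then show ?thesis using x(3) xA unfolding f_def by auto
  qed
  have pq: "0 < F p" "0 < F q" "0 < q" using assms pos by auto
  obtain x where x: "0 < x" "x \<le> A"
    "(ln (F q) + a * ln q) - (ln (F p) + a * ln p) = (F1 x + a * F x / x) / F x * (q - p)" using key by blast
  have "(F1 x + a * F x / x) / F x \<le> 0" using ab(3)[OF x(1,2)] pos[OF x(1,2)] by (intro divide_nonpos_pos) auto
  then have "(F1 x + a * F x / x) / F x * (q - p) \<le> 0" using assms by (intro mult_nonpos_nonneg) auto
  then have "ln (F q) \<le> ln (F p) + a * ln (p / q)"
    using x(3) assms pq by (simp add: ln_div algebra_simps)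
  also have "\<dots> = ln ((p / q) powr a * F p)" using assms pq by (simp add: ln_mult ln_powr)
  finally show "F q \<le> (p / q) powr a * F p" using pq assms by simp
  obtain x where x: "0 < x" "x \<le> A"
    "(ln (F q) + b * ln q) - (ln (F p) + b * ln p) = (F1 x + b * F x / x) / F x * (q - p)" using key by blast
  have "0 \<le> (F1 x + b * F x / x) / F x" using ab(4)[OF x(1,2)] pos[OF x(1,2)] by (intro divide_nonneg_pos) auto
  then have "0 \<le> (F1 x + b * F x / x) / F x * (q - p)" using assms by (intro mult_nonneg_nonneg) auto
  then have "ln (F p) \<le> ln (F q) + b * ln (q / p)"
    using x(3) assms pq by (simp add: ln_div algebra_simps)
  also have "\<dots> = ln ((q / p) powr b * F q)" using assms pq by (simp add: ln_mult ln_powr)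
  finally show "F p \<le> (q / p) powr b * F q" using pq assms by simp
qed

text \<open>
  A simple zero \<open>x\<close> has a neighbourhood where \<open>\<bar>g t\<bar> \<ge> \<kappa> * \<bar>t - x\<bar>\<close>; any other point has a neighbourhood
  where \<open>\<bar>g\<bar>\<close> is bounded below.  Finitely many of these cover a period.  The restriction
  \<open>d \<le> 1\<close> is needed because \<open>g\<close> is bounded.
\<close>

lemma Omega_inner_function:
  assumes g: "Omega_inner A g"
  shows "\<exists>g1 g2 D \<kappa>. inner_function A g g1 g2 D \<kappa>"
proof -
  obtain G D where G: "derivs_on UNIV g G" and D: "0 < D" "\<And>n t. 1 \<le> n \<Longrightarrow> \<bar>G n t\<bar> \<le> D ^ n * fact n"
    and simple: "\<And>t. g t = 0 \<Longrightarrow> G 1 t \<noteq> 0"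
    using g unfolding Omega_inner_def by blast
  have per: "g (t + 2 * pi) = g t" for t using g unfolding Omega_inner_def by blast
  have per_nat: "g (t + 2 * pi * real m) = g t" for m t
  proof (induction m)
    case (Suc m)
    have "t + 2 * pi * real (Suc m) = (t + 2 * pi * real m) + 2 * pi" by (simp add: algebra_simps)
    then show ?case using per[of "t + 2 * pi * real m"] Suc by (simp only:)
  qed simp
  have per_int: "g (t + 2 * pi * of_int m) = g t" for m t
  proof (cases m)
    case (nonneg k)
    then show ?thesis using per_nat[of t k] by simp
  next
    case (neg k)
    then have "of_int m = - real (Suc k)" by simp
    then have "t + 2 * pi * of_int m + 2 * pi * real (Suc k) = t" by (simp only: algebra_simps)
    then show ?thesis using per_nat[of "t + 2 * pi * of_int m" "Suc k"] by (simp only:)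
  qed
  have Gn: "(G n has_real_derivative G (Suc n) t) (at t)" for n t using G unfolding derivs_on_def by simp
  have G0: "G 0 = g" using G unfolding derivs_on_def by auto
  have g1: "(g has_real_derivative G 1 t) (at t)" for t using Gn[of 0 t] G0 by simp
  have g2: "(G 1 has_real_derivative G 2 t) (at t)" for t using Gn[of 1 t] by (simp add: numeral_2_eq_2)
  have cont: "continuous (at t) g" for t using g1 DERIV_isCont by blast
  have local: "\<exists>e>0. \<exists>\<kappa>>0. \<forall>t. \<bar>t - x\<bar> < e \<longrightarrow> g x \<noteq> 0 \<and> \<kappa> \<le> \<bar>g t\<bar> \<or> g x = 0 \<and> \<kappa> * \<bar>t - x\<bar> \<le> \<bar>g t\<bar>" for x
  proof (cases "g x = 0")
    case True
    define m where "m = \<bar>G 1 x\<bar> / 2"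
    have "0 < m" unfolding m_def using simple[OF True] by simp
    have "((\<lambda>t. (g t - g x) / (t - x)) \<longlongrightarrow> G 1 x) (at x)"
      using g1[of x] by (simp add: has_field_derivative_iff)
    then have "((\<lambda>t. \<bar>g t / (t - x)\<bar>) \<longlongrightarrow> \<bar>G 1 x\<bar>) (at x)" using True by (intro tendsto_rabs) simp
    then have "eventually (\<lambda>t. m < \<bar>g t / (t - x)\<bar>) (at x)"
      by (rule order_tendstoD(1)) (use simple[OF True] m_def in simp)
    then obtain e where e: "0 < e" "\<And>t. t \<noteq> x \<Longrightarrow> dist t x < e \<Longrightarrow> m < \<bar>g t / (t - x)\<bar>"
      unfolding eventually_at by auto
    have "m * \<bar>t - x\<bar> \<le> \<bar>g t\<bar>" if "\<bar>t - x\<bar> < e" for t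
    proof (cases "t = x")
      case False
      then show ?thesis using e(2)[of t] that by (simp add: dist_real_def abs_divide field_simps)
    qed simp
    then show ?thesis using True e(1) \<open>0 < m\<close> by blast
  next
    case False
    have "((\<lambda>t. \<bar>g t\<bar>) \<longlongrightarrow> \<bar>g x\<bar>) (at x)" using cont[of x] by (intro tendsto_rabs) (simp add: continuous_within)
    then have "eventually (\<lambda>t. \<bar>g x\<bar> / 2 < \<bar>g t\<bar>) (at x)"
      by (rule order_tendstoD(1)) (use False in simp)
    then obtain e where e: "0 < e" "\<And>t. t \<noteq> x \<Longrightarrow> dist t x < e \<Longrightarrow> \<bar>g x\<bar> / 2 < \<bar>g t\<bar>"
      unfolding eventually_at by auto
    have "\<bar>g x\<bar> / 2 \<le> \<bar>g t\<bar>" if "\<bar>t - x\<bar> < e" for t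
      using e(2)[of t] that by (cases "t = x") (auto simp: dist_real_def)
    then show ?thesis using False e(1) by (intro exI[of _ e] conjI exI[of _ "\<bar>g x\<bar> / 2"]) auto
  qed
  then obtain e k where ek: "\<And>x. 0 < e x" "\<And>x. 0 < k x"
    "\<And>x t. \<bar>t - x\<bar> < e x \<Longrightarrow> g x \<noteq> 0 \<and> k x \<le> \<bar>g t\<bar> \<or> g x = 0 \<and> k x * \<bar>t - x\<bar> \<le> \<bar>g t\<bar>"
    by metis
  have fin: "finite ({t. g t = 0} \<inter> K)" if K: "compact K" for K
  proof (subst Int_commute, rule finite_not_islimpt_in_compact[OF K])
    fix x
    show "\<not> x islimpt {t. g t = 0}"
    proof
      assume "x islimpt {t. g t = 0}"
      then obtain t where t: "t \<noteq> x" "g t = 0" "dist t x < e x" using ek(1)[of x] unfolding islimpt_approachable by auto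
      then have "k x * \<bar>t - x\<bar> \<le> 0" "0 < \<bar>t - x\<bar>"
        using ek(3)[of t x] ek(2)[of x] by (auto simp: dist_real_def)
      then show False using ek(2)[of x] by (simp add: mult_le_0_iff)
    qed
  qed
  obtain T where T: "T \<subseteq> {0..2 * pi}" "finite T" "{0..2 * pi} \<subseteq> (\<Union>x\<in>T. ball x (e x))"
    by (rule compactE_image[of "{0..2 * pi}" "{0..2 * pi}" "\<lambda>x. ball x (e x)"]) (use ek(1) in auto)
  have "0 \<in> {0..2 * pi}" using pi_ge_zero by simp
  then have "T \<noteq> {}" using T(3) by blast
  define \<kappa> where "\<kappa> = Min (k ` T)"
  have \<kappa>: "0 < \<kappa>" "\<And>x. x \<in> T \<Longrightarrow> \<kappa> \<le> k x" unfolding \<kappa>_def using T(2) \<open>T \<noteq> {}\<close> ek(2) by auto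
  have low: "\<kappa> * d \<le> \<bar>g t\<bar>" if d: "d \<le> 1" "\<And>z. g z = 0 \<Longrightarrow> d \<le> \<bar>t - z\<bar>" for d t
  proof (cases "0 \<le> d")
    case True
    define m where "m = \<lfloor>t / (2 * pi)\<rfloor>"
    define t' where "t' = t - 2 * pi * of_int m"
    have "of_int m \<le> t / (2 * pi)" "t / (2 * pi) < of_int m + 1" unfolding m_def by linarith+
    then have "t' \<in> {0..2 * pi}" unfolding t'_def by (simp add: field_simps)
    then obtain x where x: "x \<in> T" "\<bar>t' - x\<bar> < e x" using T(3) by (auto simp: dist_real_def abs_minus_commute)
    have gt: "g t' = g t" using per_int[of t' m] unfolding t'_def by simp
    from ek(3)[OF x(2)] show ?thesis
    proof
      assume "g x \<noteq> 0 \<and> k x \<le> \<bar>g t'\<bar>"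
      moreover have "\<kappa> * d \<le> \<kappa> * 1" using \<kappa> d by (intro mult_left_mono) auto
      ultimately show ?thesis using gt \<kappa>(2)[OF x(1)] by simp
    next
      assume h: "g x = 0 \<and> k x * \<bar>t' - x\<bar> \<le> \<bar>g t'\<bar>"
      then have "g (x + 2 * pi * of_int m) = 0" using per_int by simp
      then have "d \<le> \<bar>t' - x\<bar>" using d(2)[of "x + 2 * pi * of_int m"] unfolding t'_def by (simp add: algebra_simps)
      then have "\<kappa> * d \<le> k x * \<bar>t' - x\<bar>" using \<kappa>(2)[OF x(1)] True \<kappa>(1) by (intro mult_mono) auto
      then show ?thesis using h gt by simp
    qed
  next
    case False
    then have "\<kappa> * d \<le> 0" using \<kappa> by (simp add: mult_nonneg_nonpos)
    then show ?thesis by (rule order_trans) simp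
  qed
  define E where "E = 1 + D + 2 * D\<^sup>2"
  have E: "1 \<le> E" "D \<le> E" "2 * D\<^sup>2 \<le> E" unfolding E_def using D(1) by (auto simp: add_nonneg_nonneg)
  have "\<bar>G 1 t\<bar> \<le> E" "\<bar>G 2 t\<bar> \<le> E" for t using D(2)[of 1 t] D(2)[of 2 t] E by (auto simp: fact_numeral mult.commute)
  moreover have "\<bar>g t\<bar> \<le> A" for t
  proof -
    have "g t \<in> {-A..A}" using g unfolding Omega_inner_def by blast
    then show ?thesis by (simp add: abs_le_iff minus_le_iff)
  qed
  ultimately have "inner_function A g (G 1) (G 2) E \<kappa>"
    using g1 g2 E(1) \<kappa>(1) low fin per by (unfold_locales; blast)
  then show ?thesis by blast
qed

lemma abs_same_sign:
  fixes x y :: real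
  assumes "0 < x * y"
  shows "\<bar>y\<bar> = sgn x * y"
  using assms by (cases "0 < x") (simp_all add: zero_less_mult_iff)

text \<open>
  Two points at distance at most one can be translated by a multiple of the period into a fixed interval, where
  the set is finite.
\<close>

lemma periodic_separated:
  assumes per: "\<And>t. t \<in> Z \<Longrightarrow> t + 2 * pi \<in> Z \<and> t - 2 * pi \<in> Z" and fin: "finite (Z \<inter> {-1..2 * pi + 1})"
  obtains e where "0 < e" "e \<le> 1" "\<And>z z'. z \<in> Z \<Longrightarrow> z' \<in> Z \<Longrightarrow> z \<noteq> z' \<Longrightarrow> e \<le> \<bar>z - z'\<bar>"
proof -
  have up: "t + 2 * pi * real m \<in> Z" and down: "t - 2 * pi * real m \<in> Z" if "t \<in> Z" for t m
  proof (induction m)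
    case (Suc m)
    case 1
    have "t + 2 * pi * real (Suc m) = (t + 2 * pi * real m) + 2 * pi" by (simp add: algebra_simps)
    then show ?case using per[OF Suc(1)] by (simp only:)
  next
    case (Suc m)
    case 2
    have "t - 2 * pi * real (Suc m) = (t - 2 * pi * real m) - 2 * pi" by (simp add: algebra_simps)
    then show ?case using per[OF Suc(2)] by (simp only:)
  qed (use that in auto)
  have shift: "t - 2 * pi * of_int m \<in> Z" if "t \<in> Z" for t m
    using up[OF that] down[OF that] by (cases m rule: int_cases2) (auto simp: algebra_simps)
  define S where "S = Z \<inter> {-1..2 * pi + 1}"
  define E where "E = (\<lambda>(z, z'). \<bar>z - z'\<bar>) ` ({(z, z'). z \<noteq> z'} \<inter> S \<times> S)"
  have "finite E" unfolding E_def S_def using fin by auto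
  define e where "e = Min (insert 1 E)"
  show thesis
  proof (rule that)
    show "0 < e" unfolding e_def using \<open>finite E\<close> by (auto simp: E_def)
    show "e \<le> 1" unfolding e_def using \<open>finite E\<close> by simp
    fix z z' assume z: "z \<in> Z" "z' \<in> Z" "z \<noteq> z'"
    show "e \<le> \<bar>z - z'\<bar>"
    proof (cases "\<bar>z - z'\<bar> \<le> 1")
      case True
      define m where "m = \<lfloor>z / (2 * pi)\<rfloor>"
      have "of_int m \<le> z / (2 * pi)" "z / (2 * pi) < of_int m + 1" unfolding m_def by linarith+
      then have "0 \<le> z - 2 * pi * of_int m" "z - 2 * pi * of_int m \<le> 2 * pi" by (simp_all add: field_simps)
      then have "z - 2 * pi * of_int m \<in> S" "z' - 2 * pi * of_int m \<in> S"
        unfolding S_def using shift z True by auto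
      then have "\<bar>(z - 2 * pi * of_int m) - (z' - 2 * pi * of_int m)\<bar> \<in> E"
        unfolding E_def using z by (intro image_eqI[of _ _ "(z - 2 * pi * of_int m, z' - 2 * pi * of_int m)"]) auto
      then have "\<bar>z - z'\<bar> \<in> E" by simp
      then show ?thesis unfolding e_def using \<open>finite E\<close> by simp
    next
      case False
      then show ?thesis using \<open>e \<le> 1\<close> by simp
    qed
  qed
qed

locale inner_outer = outer_function A F F1 F2 C0 a b + inner_function A g g1 g2 D \<kappa>
  for A F F1 F2 C0 a b g g1 g2 D \<kappa>
begin

definition Z :: "real set" where "Z = {t. g t = 0}"

definition h :: "real \<Rightarrow> real" where "h t = F \<bar>g t\<bar>"

lemma hpos: assumes "t \<notin> Z" shows "0 < h t"
  unfolding h_def using assms pos gA unfolding Z_def by simp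
lemma gcont: "continuous_on UNIV g" using g1 DERIV_isCont by (intro continuous_at_imp_continuous_on) blast
lemma lip: "\<bar>g s - g t\<bar> \<le> D * \<bar>s - t\<bar>"
    using field_differentiable_bound[of UNIV g g1 D s t] g1 D(2) by (simp add: dist_real_def)
lemma lowZ: assumes "d \<le> 1" "\<And>z. z \<in> Z \<Longrightarrow> d \<le> \<bar>t - z\<bar>" shows "\<kappa> * d \<le> \<bar>g t\<bar>"
  using low[OF assms(1)] assms(2) unfolding Z_def by simp

text \<open>
  On the interval of length \<open>d\<close> around \<open>t\<close> the sign of \<open>g\<close> is constant, so \<open>\<bar>g\<bar>\<close> is twice
  differentiable there, and it is comparable to its value at \<open>t\<close>.  The chain rule bounds the second derivative of
  \<open>F \<bar>g\<bar>\<close> by a multiple of \<open>F \<bar>g\<bar> / \<bar>g\<bar>\<^sup>2\<close>, hence of \<open>h t / d\<^sup>2\<close>, and Taylor's formula applies.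
\<close>

lemma h_tangent:
  "\<exists>C. \<forall>d t. 0 < d \<longrightarrow> d \<le> 1 \<longrightarrow> (\<forall>z\<in>Z. d \<le> \<bar>t - z\<bar>) \<longrightarrow>
    (\<exists>b. \<bar>b\<bar> \<le> C * h t / d \<and>
      (\<forall>s. \<bar>s - t\<bar> \<le> d / 2 \<longrightarrow> h s \<le> h t + b * (s - t) + C * h t * (s - t)\<^sup>2 / d\<^sup>2))"
proof -
  define \<beta> where "\<beta> = (1 + D / \<kappa>) powr b"
  define C where "C = 1 + C0 * D / \<kappa> + (C0 * D\<^sup>2 + C0 * A * D) * \<beta> * 4 / \<kappa>\<^sup>2"
  have \<beta>: "0 \<le> \<beta>" unfolding \<beta>_def by simp
  have Cp: "0 \<le> C0 * D / \<kappa>" "0 \<le> (C0 * D\<^sup>2 + C0 * A * D) * \<beta> * 4 / \<kappa>\<^sup>2"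
    using C0 D(1) \<kappa> A \<beta> by (auto intro!: mult_nonneg_nonneg divide_nonneg_nonneg add_nonneg_nonneg)
  have C: "1 \<le> C" "C0 * D / \<kappa> \<le> C" "(C0 * D\<^sup>2 + C0 * A * D) * \<beta> * 4 / \<kappa>\<^sup>2 \<le> C"
    unfolding C_def using Cp by auto
  have "\<exists>\<beta>. \<bar>\<beta>\<bar> \<le> C * h t / d \<and> (\<forall>s. \<bar>s - t\<bar> \<le> d / 2 \<longrightarrow> h s \<le> h t + \<beta> * (s - t) + C * h t * (s - t)\<^sup>2 / d\<^sup>2)"
    if d: "0 < d" "d \<le> 1" "\<forall>z\<in>Z. d \<le> \<bar>t - z\<bar>" for d t
  proof -
    let ?S = "{t - d / 2..t + d / 2}"
    define \<gamma> where "\<gamma> = (\<lambda>s. sgn (g t) * g s)"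
    have tZ: "t \<notin> Z" using d by force
    have gt: "\<kappa> * d \<le> \<bar>g t\<bar>" by (rule lowZ) (use d in auto)
    have gs: "\<kappa> * (d / 2) \<le> \<bar>g s\<bar>" if "s \<in> ?S" for s
    proof (rule lowZ)
      fix z assume "z \<in> Z"
      then have "d \<le> \<bar>t - z\<bar>" using d by blast
      moreover have "\<bar>s - t\<bar> \<le> d / 2" using that unfolding atLeastAtMost_iff by linarith
      ultimately show "d / 2 \<le> \<bar>s - z\<bar>" by linarith
    qed (use d in simp)
    have kd: "0 < \<kappa> * (d / 2)" using d \<kappa> by simp
    have sgn: "\<bar>sgn (g t)\<bar> = 1" using tZ unfolding Z_def by (simp add: abs_sgn_eq)
    have abs\<gamma>: "\<bar>g s\<bar> = \<gamma> s" if s: "s \<in> ?S" for s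
    proof -
      have "0 < g t * g s"
      proof (rule ccontr)
        assume "\<not> 0 < g t * g s"
        then have "g t \<le> 0 \<and> 0 \<le> g s \<or> g s \<le> 0 \<and> 0 \<le> g t" by (auto simp: zero_less_mult_iff)
        moreover have "t \<in> ?S" "is_interval ?S" using d by auto
        moreover have "connected (g ` ?S)"
          by (intro connected_continuous_image continuous_on_subset[OF gcont]) auto
        ultimately have "0 \<in> g ` ?S"
          unfolding connected_contains_Icc[of "g ` ?S"] using s
          by (meson atLeastAtMost_iff imageI is_interval_connected_1 connected_contains_Icc subsetD)
        then obtain x where "x \<in> ?S" "g x = 0" by auto
        then show False using gs kd by fastforce
      qed
      then show ?thesis unfolding \<gamma>_def by (rule abs_same_sign)
    qed
    have \<gamma>S: "0 < \<gamma> s" "\<gamma> s \<le> A" "\<kappa> * (d / 2) \<le> \<gamma> s" if "s \<in> ?S" for s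
      using abs\<gamma>[OF that] gs[OF that] kd gA[of s] by auto
    have h\<gamma>: "h s = F (\<gamma> s)" if "s \<in> ?S" for s unfolding h_def using abs\<gamma>[OF that] by simp
    have tS: "t \<in> ?S" using d by simp
    have img: "\<gamma> ` ?S \<subseteq> {0<..A}" using \<gamma>S by auto
    define h1 where "h1 = (\<lambda>s. F1 (\<gamma> s) * (sgn (g t) * g1 s))"
    define h2 where "h2 = (\<lambda>s. F2 (\<gamma> s) * (sgn (g t) * g1 s) * (sgn (g t) * g1 s) + F1 (\<gamma> s) * (sgn (g t) * g2 s))"
    define f where "f = (\<lambda>i::nat. if i = 0 then F \<circ> \<gamma> else if i = 1 then h1 else h2)"
    have d\<gamma>: "(\<gamma> has_real_derivative sgn (g t) * g1 s) (at s within ?S)" for s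
      unfolding \<gamma>_def using has_field_derivative_at_within[OF g1] by (intro DERIV_cmult)
    have dF: "(F \<circ> \<gamma> has_real_derivative h1 s) (at s within ?S)" if "s \<in> ?S" for s
      unfolding h1_def
      by (rule DERIV_image_chain[OF has_field_derivative_subset[OF F1 img] d\<gamma>]) (use \<gamma>S that in auto)
    have dF1: "(F1 \<circ> \<gamma> has_real_derivative F2 (\<gamma> s) * (sgn (g t) * g1 s)) (at s within ?S)" if "s \<in> ?S" for s
      by (rule DERIV_image_chain[OF has_field_derivative_subset[OF F2 img] d\<gamma>]) (use \<gamma>S that in auto)
    have dh1: "(h1 has_real_derivative h2 s) (at s within ?S)" if "s \<in> ?S" for s
    proof -
      have "((\<lambda>s. (F1 \<circ> \<gamma>) s * (sgn (g t) * g1 s)) has_real_derivative h2 s) (at s within ?S)"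
        using DERIV_mult[OF dF1[OF that] DERIV_cmult[OF has_field_derivative_at_within[OF g2], of "sgn (g t)" s ?S]]
        unfolding h2_def by (simp add: algebra_simps)
      then show ?thesis unfolding h1_def by (simp add: o_def)
    qed
    have Fc: "F (\<gamma> s) \<le> \<beta> * h t" if s: "s \<in> ?S" for s
    proof (cases "\<gamma> s \<le> \<gamma> t")
      case True
      have "\<gamma> t - \<gamma> s \<le> D * (d / 2)"
      proof -
        have "\<gamma> t - \<gamma> s \<le> \<bar>g s - g t\<bar>" using abs\<gamma>[OF s] abs\<gamma>[OF tS] by linarith
        also have "\<dots> \<le> D * \<bar>s - t\<bar>" by (rule lip)
        also have "\<bar>s - t\<bar> \<le> d / 2" using s unfolding atLeastAtMost_iff by linarith
        finally show ?thesis using D(1) by simp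
      qed
      also have "D * (d / 2) = (D / \<kappa>) * (\<kappa> * (d / 2))" using \<kappa> by simp
      also have "\<dots> \<le> (D / \<kappa>) * \<gamma> s" using \<gamma>S[OF s] D(1) \<kappa> by (intro mult_left_mono) auto
      finally have r: "\<gamma> t / \<gamma> s \<le> 1 + D / \<kappa>" using \<gamma>S[OF s] by (simp add: field_simps)
      have "F (\<gamma> s) \<le> (\<gamma> t / \<gamma> s) powr b * F (\<gamma> t)"
        by (rule power_comparison(2)[OF _ True]) (use \<gamma>S s tS in auto)
      also have "\<dots> \<le> \<beta> * F (\<gamma> t)" unfolding \<beta>_def
        using r \<gamma>S[OF s] \<gamma>S[OF tS] ab(2) pos by (intro mult_right_mono powr_mono2) (auto intro: less_imp_le)
      finally show ?thesis using h\<gamma>[OF tS] by simp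
    next
      case False
      have "1 \<le> \<beta>" unfolding \<beta>_def using D(1) \<kappa> ab(2) by (intro ge_one_powr_ge_zero) auto
      have "F (\<gamma> s) \<le> F (\<gamma> t)" using anti[of "\<gamma> t" "\<gamma> s"] False \<gamma>S[OF s] \<gamma>S[OF tS] by simp
      also have "\<dots> = 1 * h t" using h\<gamma>[OF tS] by simp
      also have "\<dots> \<le> \<beta> * h t" using \<open>1 \<le> \<beta>\<close> hpos[OF tZ] by (intro mult_right_mono) auto
      finally show ?thesis .
    qed
    have h2b: "\<bar>h2 s\<bar> \<le> C * h t / d\<^sup>2" if s: "s \<in> ?S" for s
    proof -
      note \<gamma>s = \<gamma>S[OF s]
      have Fs: "0 \<le> F (\<gamma> s)" using pos \<gamma>s less_imp_le by blast
      have "\<bar>h2 s\<bar> \<le> \<bar>F2 (\<gamma> s)\<bar> * \<bar>g1 s\<bar> * \<bar>g1 s\<bar> + \<bar>F1 (\<gamma> s)\<bar> * \<bar>g2 s\<bar>"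
        unfolding h2_def using sgn by (intro order_trans[OF abs_triangle_ineq]) (simp add: abs_mult)
      also have "\<dots> \<le> (C0 * F (\<gamma> s) / (\<gamma> s)\<^sup>2) * D * D + (C0 * F (\<gamma> s) / \<gamma> s) * D"
        using c1[OF \<gamma>s(1,2)] c2[OF \<gamma>s(1,2)] D(2)[of s] D(3)[of s] D(1) C0 Fs \<gamma>s(1)
        by (intro add_mono mult_mono) (auto intro!: mult_nonneg_nonneg divide_nonneg_nonneg)
      also have "(C0 * F (\<gamma> s) / \<gamma> s) * D = (C0 * F (\<gamma> s) / (\<gamma> s)\<^sup>2) * \<gamma> s * D"
        using \<gamma>s by (simp add: power2_eq_square)
      also have "\<dots> \<le> (C0 * F (\<gamma> s) / (\<gamma> s)\<^sup>2) * A * D"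
        using \<gamma>s C0 Fs D(1) by (intro mult_right_mono mult_left_mono) auto
      also have "(C0 * F (\<gamma> s) / (\<gamma> s)\<^sup>2) * D * D + (C0 * F (\<gamma> s) / (\<gamma> s)\<^sup>2) * A * D
          = (C0 * D\<^sup>2 + C0 * A * D) * (F (\<gamma> s) / (\<gamma> s)\<^sup>2)" by (simp add: algebra_simps power2_eq_square)
      also have "\<dots> \<le> (C0 * D\<^sup>2 + C0 * A * D) * (\<beta> * h t / (\<kappa> * (d / 2))\<^sup>2)"
        using Fc[OF s] \<gamma>s kd Fs C0 A D(1) hpos[OF tZ] \<beta> d(1) \<kappa>
        by (intro mult_left_mono frac_le power_mono add_nonneg_nonneg mult_nonneg_nonneg) auto
      also have "\<dots> = ((C0 * D\<^sup>2 + C0 * A * D) * \<beta> * 4 / \<kappa>\<^sup>2) * h t / d\<^sup>2"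
        by (simp add: power_mult_distrib power_divide)
      also have "\<dots> \<le> C * h t / d\<^sup>2" using C(3) hpos[OF tZ] by (intro divide_right_mono mult_right_mono) auto
      finally show ?thesis by simp
    qed
    have taylor: "h s \<le> h t + h1 t * (s - t) + C * h t * (s - t)\<^sup>2 / d\<^sup>2" if "\<bar>s - t\<bar> \<le> d / 2" for s
    proof -
      have s: "s \<in> ?S" using that unfolding atLeastAtMost_iff by linarith
      have "norm (f 0 s - (\<Sum>i\<le>1. f i t * (s - t) ^ i / fact i)) \<le> (C * h t / d\<^sup>2) * norm (s - t) ^ Suc 1 / fact 1"
      proof (rule field_Taylor[of ?S 1 f])
        show "(f i has_real_derivative f (Suc i) x) (at x within ?S)" if "x \<in> ?S" "i \<le> 1" for i x
          using that dF dh1 unfolding f_def by (cases "i = 0") auto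
        show "norm (f (Suc 1) x) \<le> C * h t / d\<^sup>2" if "x \<in> ?S" for x
          using h2b[OF that] unfolding f_def by simp
      qed (use s tS in auto)
      moreover have "norm (s - t) ^ Suc 1 = (s - t)\<^sup>2"
        using power2_abs[of "s - t"] by (simp add: numeral_2_eq_2)
      moreover have "(\<Sum>i\<le>1. f i t * (s - t) ^ i / fact i) = F (\<gamma> t) + h1 t * (s - t)"
        by (simp add: f_def)
      moreover have "f 0 s = F (\<gamma> s)" by (simp add: f_def)
      ultimately have "\<bar>F (\<gamma> s) - (F (\<gamma> t) + h1 t * (s - t))\<bar> \<le> (C * h t / d\<^sup>2) * (s - t)\<^sup>2 / fact 1"
        by (simp only: real_norm_def)
      then have "\<bar>F (\<gamma> s) - (F (\<gamma> t) + h1 t * (s - t))\<bar> \<le> C * h t * (s - t)\<^sup>2 / d\<^sup>2" by simp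
      then show ?thesis using h\<gamma>[OF s] h\<gamma>[OF tS] by linarith
    qed
    have "\<bar>h1 t\<bar> \<le> C * h t / d"
    proof -
      note \<gamma>t = \<gamma>S[OF tS]
      have "\<bar>h1 t\<bar> = \<bar>F1 (\<gamma> t)\<bar> * \<bar>g1 t\<bar>" unfolding h1_def using sgn by (simp add: abs_mult)
      also have "\<dots> \<le> (C0 * F (\<gamma> t) / \<gamma> t) * D"
        using c1[OF \<gamma>t(1,2)] D(2) by (intro mult_mono) auto
      also have "\<dots> = C0 * D * h t / \<gamma> t" using h\<gamma>[OF tS] by simp
      also have "\<dots> \<le> C0 * D * h t / (\<kappa> * d)"
        using gt abs\<gamma>[OF tS] \<gamma>t(1) C0 D(1) hpos[OF tZ] d(1) \<kappa>
        by (intro divide_left_mono mult_pos_pos mult_nonneg_nonneg) auto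
      also have "\<dots> = (C0 * D / \<kappa>) * h t / d" by simp
      also have "\<dots> \<le> C * h t / d" using C(2) hpos[OF tZ] d by (intro divide_right_mono mult_right_mono) auto
      finally show ?thesis .
    qed
    then show ?thesis using taylor by blast
  qed
  then show ?thesis by blast
qed

lemma Z_periodic: "t \<in> Z \<Longrightarrow> t + 2 * pi \<in> Z \<and> t - 2 * pi \<in> Z"
  unfolding Z_def using per per[of "t - 2 * pi"] by simp

text \<open>
  Near a zero \<open>z\<close> the quantity \<open>\<bar>g (z + y)\<bar>\<close> lies between \<open>\<kappa> * \<bar>y\<bar>\<close> and \<open>D * \<bar>y\<bar>\<close>, so \<open>power_comparison\<close>
  at the points \<open>\<kappa> * \<bar>y\<bar>\<close> and \<open>D * \<bar>x\<bar>\<close> gives the decay.  These two points can be in either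
  order, but in the unfavourable one their ratio is bounded.
\<close>

lemma h_decay:
  "\<exists>\<sigma> C \<alpha>. 0 < \<sigma> \<and> 0 < \<alpha> \<and> (\<forall>z\<in>Z. \<forall>x y. 0 < \<bar>x\<bar> \<longrightarrow> \<bar>x\<bar> \<le> \<bar>y\<bar> \<longrightarrow> \<bar>y\<bar> \<le> \<sigma> \<longrightarrow>
    h (z + y) \<le> C * (\<bar>x\<bar> / \<bar>y\<bar>) powr \<alpha> * h (z + x) \<and> 1 \<le> C * h (z + y))"
proof -
  have "finite (Z \<inter> {-1..2 * pi + 1})" unfolding Z_def by (rule fin) simp
  then obtain e where e: "0 < e" "e \<le> 1" "\<And>z z'. z \<in> Z \<Longrightarrow> z' \<in> Z \<Longrightarrow> z \<noteq> z' \<Longrightarrow> e \<le> \<bar>z - z'\<bar>"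
    using periodic_separated[OF Z_periodic] by blast
  define \<sigma> where "\<sigma> = min (e / 2) (A / D)"
  define C where "C = 1 + 1 / F A + (1 + D / \<kappa>) powr (a + b)"
  have FA: "0 < F A" using pos A by simp
  have \<sigma>: "0 < \<sigma>" "\<sigma> \<le> e / 2" "D * \<sigma> \<le> A" unfolding \<sigma>_def using e A D(1) by (auto simp: min_def field_simps)
  have C: "1 \<le> C" "1 / F A \<le> C" "(1 + D / \<kappa>) powr (a + b) \<le> C" unfolding C_def using FA by auto
  have "h (z + y) \<le> C * (\<bar>x\<bar> / \<bar>y\<bar>) powr a * h (z + x) \<and> 1 \<le> C * h (z + y)"
    if z: "z \<in> Z" and x: "0 < \<bar>x\<bar>" and xy: "\<bar>x\<bar> \<le> \<bar>y\<bar>" and y: "\<bar>y\<bar> \<le> \<sigma>" for z x y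
  proof -
    have far: "\<bar>v\<bar> \<le> \<bar>z + v - z'\<bar>" if "z' \<in> Z" "\<bar>v\<bar> \<le> \<sigma>" for z' v
      using e(3)[OF z that(1)] \<sigma>(2) that by (cases "z = z'") auto
    have lower: "\<kappa> * \<bar>v\<bar> \<le> \<bar>g (z + v)\<bar>" if "\<bar>v\<bar> \<le> \<sigma>" for v
      using lowZ[of "\<bar>v\<bar>" "z + v"] far that \<sigma> e by simp
    define p where "p = \<kappa> * \<bar>y\<bar>"
    define q where "q = D * \<bar>x\<bar>"
    have p: "0 < p" "p \<le> \<bar>g (z + y)\<bar>" "p \<le> A"
      unfolding p_def using lower[OF y] \<kappa> x xy gA[of "z + y"] by auto
    have q: "0 < q" "\<bar>g (z + x)\<bar> \<le> q" "q \<le> A"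
    proof -
      show "0 < q" unfolding q_def using x D(1) by simp
      show "\<bar>g (z + x)\<bar> \<le> q" using lip[of "z + x" z] z unfolding q_def Z_def by simp
      have "q \<le> D * \<sigma>" unfolding q_def using xy y D(1) by (intro mult_left_mono) auto
      then show "q \<le> A" using \<sigma> by simp
    qed
    have gx: "0 < \<bar>g (z + x)\<bar>" using lower[of x] xy y mult_pos_pos[OF \<kappa> x] by linarith
    have hy: "h (z + y) \<le> F p" unfolding h_def by (rule anti[OF p(1,2) gA])
    have hx: "F q \<le> h (z + x)" unfolding h_def by (rule anti[OF gx q(2,3)])
    define r where "r = \<bar>x\<bar> / \<bar>y\<bar>"
    have r: "0 < r" "r \<le> 1" "q / p = (D / \<kappa>) * r" unfolding r_def q_def p_def using x xy by auto
    have Fpq: "F p \<le> C * r powr a * F q"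
    proof (cases "q \<le> p")
      case True
      have "F p \<le> (q / p) powr a * F q"
        by (rule power_comparison(1)[OF q(1) True p(3)])
      also have "(q / p) powr a = (D / \<kappa>) powr a * r powr a"
        unfolding r(3) using r(1) D(1) \<kappa> by (subst powr_mult) auto
      also have "(D / \<kappa>) powr a \<le> (1 + D / \<kappa>) powr (a + b)"
      proof -
        have "(D / \<kappa>) powr a \<le> (1 + D / \<kappa>) powr a" using ab D(1) \<kappa> by (intro powr_mono2) auto
        also have "\<dots> \<le> (1 + D / \<kappa>) powr (a + b)" using ab D(1) \<kappa> by (intro powr_mono) auto
        finally show ?thesis .
      qed
      also have "\<dots> \<le> C" by (rule C(3))
      finally show ?thesis using pos[OF q(1,3)] by (simp add: mult_right_mono)
    next
      case False
      have "1 \<le> q / p" using False p(1) by simp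
      then have rr: "1 / r \<le> D / \<kappa>" unfolding r(3) using r by (simp add: divide_le_eq)
      have dk: "0 < D / \<kappa>" using D(1) \<kappa> by simp
      have "F p \<le> (q / p) powr b * F q"
        by (rule power_comparison(2)[OF p(1) _ q(3)]) (use False in auto)
      also have "(q / p) powr b \<le> C * r powr a"
      proof -
        have "(q / p) powr b \<le> (1 + D / \<kappa>) powr b"
        proof (rule powr_mono2)
          have "(D / \<kappa>) * r \<le> (D / \<kappa>) * 1" using r dk by (intro mult_left_mono) auto
          then show "q / p \<le> 1 + D / \<kappa>" unfolding r(3) by simp
        qed (use ab p q in auto)
        also have "\<dots> = (1 + D / \<kappa>) powr b * ((1 / r) powr a * r powr a)" using r by (simp add: powr_divide)
        also have "\<dots> \<le> (1 + D / \<kappa>) powr b * ((1 + D / \<kappa>) powr a * r powr a)"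
          using rr r ab by (intro mult_left_mono mult_right_mono powr_mono2) auto
        also have "\<dots> = (1 + D / \<kappa>) powr (a + b) * r powr a" by (simp add: powr_add)
        also have "\<dots> \<le> C * r powr a" by (intro mult_right_mono C(3)) simp
        finally show ?thesis .
      qed
      finally show ?thesis using pos[OF q(1,3)] by (simp add: mult_right_mono)
    qed
    have "h (z + y) \<le> C * r powr a * F q" using hy Fpq by linarith
    also have "\<dots> \<le> C * r powr a * h (z + x)" using hx C(1) by (intro mult_left_mono) auto
    finally have 1: "h (z + y) \<le> C * r powr a * h (z + x)" .
    have "F A \<le> h (z + y)" unfolding h_def using p(1,2) by (intro anti gA) auto
    then have "(1 / F A) * F A \<le> C * h (z + y)" using C(1,2) FA by (intro mult_mono) auto
    then have "1 \<le> C * h (z + y)" using FA by simp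
    then show ?thesis using 1 unfolding r_def by simp
  qed
  then show ?thesis
    using \<sigma>(1) ab(1) by (intro exI[of _ \<sigma>] exI[of _ C] exI[of _ a]) auto
qed

lemma singular_factor: "singular_factor Z h"
proof (unfold_locales, fact Z_periodic)
  show "finite (Z \<inter> {-1..2 * pi + 1})" unfolding Z_def by (rule fin) simp
  show "0 \<le> h t" if "t \<notin> Z" for t using hpos[OF that] by simp
  show "continuous_on (- Z) h"
  proof (rule continuous_on_cong[THEN iffD2, OF refl h_def], rule continuous_on_compose2[of "{0<..A}" F])
    show "continuous_on {0<..A} F" by (rule DERIV_continuous_on[OF F1]) auto
    show "continuous_on (- Z) (\<lambda>t. \<bar>g t\<bar>)" by (intro continuous_intros continuous_on_subset[OF gcont]) auto
    show "(\<lambda>t. \<bar>g t\<bar>) ` (- Z) \<subseteq> {0<..A}" using gA unfolding Z_def by auto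
  qed
  show "\<exists>B. \<forall>t. (\<forall>z\<in>Z. \<eta> \<le> \<bar>t - z\<bar>) \<longrightarrow> h t \<le> B" if \<eta>: "0 < \<eta>" for \<eta>
  proof (intro exI allI impI)
    fix t assume far: "\<forall>z\<in>Z. \<eta> \<le> \<bar>t - z\<bar>"
    have "\<kappa> * min \<eta> 1 \<le> \<bar>g t\<bar>" by (rule lowZ) (use far in \<open>auto simp: min_le_iff_disj\<close>)
    then show "h t \<le> F (\<kappa> * min \<eta> 1)" unfolding h_def using \<eta> \<kappa> gA by (intro anti) auto
  qed
qed (fact h_tangent h_decay)+

end

lemma Omega_singular_factor:
  assumes "w \<in> Omega"
  obtains Z h where "singular_factor Z h" "\<And>t. w t = (if t \<in> Z then 0 else exp (- h t))"
proof -
  obtain A g F where A: "0 < A" and inner: "Omega_inner A g" and outer: "Omega_outer A F"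
    and w: "\<And>t. w t = (if g t = 0 then 0 else exp (- F (g t)))"
    using assms unfolding Omega_def by blast
  obtain F1 F2 C0 a b where O: "outer_function A F F1 F2 C0 a b"
    using Omega_outer_function[OF outer A] by blast
  obtain g1 g2 D \<kappa> where G: "inner_function A g g1 g2 D \<kappa>"
    using Omega_inner_function[OF inner] by blast
  interpret I: inner_outer A F F1 F2 C0 a b g g1 g2 D \<kappa> by (intro inner_outer.intro O G)
  have "w t = (if t \<in> I.Z then 0 else exp (- I.h t))" for t
    unfolding w I.Z_def I.h_def using I.even[of "g t"] I.gA[of t] by (simp add: abs_le_iff minus_le_iff)
  with I.singular_factor show thesis by (rule that)
qed

section \<open>Sums of singular exponents\<close>

lemma finite_family_lower_bound:
  fixes f :: "'a \<Rightarrow> real"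
  assumes "finite I" "\<And>i. i \<in> I \<Longrightarrow> 0 < f i"
  obtains m where "0 < m" "m \<le> 1" "\<And>i. i \<in> I \<Longrightarrow> m \<le> f i"
proof (rule that[of "Min (insert 1 (f ` I))"])
  show "0 < Min (insert 1 (f ` I))" using assms by auto
qed (use assms in auto)

lemma finite_family_upper_bound:
  fixes f :: "'a \<Rightarrow> real"
  assumes "finite I"
  obtains M where "1 \<le> M" "\<And>i. i \<in> I \<Longrightarrow> f i \<le> M"
proof (rule that[of "Max (insert 1 (f ` I))"])
qed (use assms in auto)

text \<open>
  Near \<open>z\<close> the summands singular at \<open>z\<close> satisfy the decay individually, and the remaining ones are bounded and
  therefore dominated by any singular summand.  The tangent parabolas add up.
\<close>

lemma singular_exponent_sum:
  fixes Zi :: "'i \<Rightarrow> real set" and h :: "'i \<Rightarrow> real \<Rightarrow> real"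
  assumes I: "finite I" and fac: "\<And>i. i \<in> I \<Longrightarrow> singular_factor (Zi i) (h i)"
  defines "Z \<equiv> \<Union>i\<in>I. Zi i" and "H \<equiv> \<lambda>t. 1 + (\<Sum>i\<in>I. h i t)"
  shows "\<exists>c C \<alpha>. singular_exponent H Z c C \<alpha>"
proof -
  note per = singular_factor.periodic[OF fac] and fin = singular_factor.finite_on_period[OF fac]
    and nonneg = singular_factor.nonneg[OF fac] and cont = singular_factor.continuous[OF fac]
    and away = singular_factor.bounded_away[OF fac]
  obtain Ct where Ct: "\<And>i d t. i \<in> I \<Longrightarrow> 0 < d \<Longrightarrow> d \<le> 1 \<Longrightarrow> (\<forall>z\<in>Zi i. d \<le> \<bar>t - z\<bar>) \<Longrightarrow>
      (\<exists>b. \<bar>b\<bar> \<le> Ct i * h i t / d \<and>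
        (\<forall>s. \<bar>s - t\<bar> \<le> d / 2 \<longrightarrow> h i s \<le> h i t + b * (s - t) + Ct i * h i t * (s - t)\<^sup>2 / d\<^sup>2))"
    using singular_factor.tangent[OF fac] by metis
  obtain \<sigma> Cd \<alpha>' where \<sigma>: "\<And>i. i \<in> I \<Longrightarrow> 0 < \<sigma> i" and \<alpha>': "\<And>i. i \<in> I \<Longrightarrow> 0 < \<alpha>' i"
    and Cd: "\<And>i z x y. i \<in> I \<Longrightarrow> z \<in> Zi i \<Longrightarrow> 0 < \<bar>x\<bar> \<Longrightarrow> \<bar>x\<bar> \<le> \<bar>y\<bar> \<Longrightarrow> \<bar>y\<bar> \<le> \<sigma> i \<Longrightarrow>
        h i (z + y) \<le> Cd i * (\<bar>x\<bar> / \<bar>y\<bar>) powr \<alpha>' i * h i (z + x) \<and> 1 \<le> Cd i * h i (z + y)"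
    using singular_factor.decay[OF fac] by metis
  have "finite (Z \<inter> {-1..2 * pi + 1})"
  proof -
    have "Z \<inter> {-1..2 * pi + 1} = (\<Union>i\<in>I. Zi i \<inter> {-1..2 * pi + 1})" unfolding Z_def by blast
    moreover have "finite (\<Union>i\<in>I. Zi i \<inter> {-1..2 * pi + 1})" using I fin by (rule finite_UN_I)
    ultimately show ?thesis by (simp only:)
  qed
  moreover have "t + 2 * pi \<in> Z \<and> t - 2 * pi \<in> Z" if "t \<in> Z" for t
    using that per unfolding Z_def by blast
  ultimately obtain e where e: "0 < e" "e \<le> 1" "\<And>z z'. z \<in> Z \<Longrightarrow> z' \<in> Z \<Longrightarrow> z \<noteq> z' \<Longrightarrow> e \<le> \<bar>z - z'\<bar>"
    using periodic_separated[of Z] by blast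
  obtain m where m: "0 < m" "m \<le> 1" "\<And>i. i \<in> I \<Longrightarrow> m \<le> \<sigma> i"
    using finite_family_lower_bound[of I \<sigma>, OF I] \<sigma> by blast
  obtain \<alpha> where \<alpha>: "0 < \<alpha>" "\<alpha> \<le> 1" "\<And>i. i \<in> I \<Longrightarrow> \<alpha> \<le> \<alpha>' i"
    using finite_family_lower_bound[of I \<alpha>', OF I] \<alpha>' by blast
  define c where "c = min (e / 4) (m / 2)"
  have c: "0 < c" "c \<le> 1" "4 * c \<le> e" "\<And>i. i \<in> I \<Longrightarrow> 2 * c \<le> \<sigma> i"
    unfolding c_def using e m by (auto simp: min_def field_simps) (smt (verit) m(3))
  obtain CT where CT: "1 \<le> CT" "\<And>i. i \<in> I \<Longrightarrow> Ct i \<le> CT" using finite_family_upper_bound[OF I] by metis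
  obtain CD where CD: "1 \<le> CD" "\<And>i. i \<in> I \<Longrightarrow> Cd i \<le> CD" using finite_family_upper_bound[OF I] by metis
  have "\<forall>i\<in>I. \<exists>B. \<forall>t. (\<forall>z\<in>Zi i. 2 * c \<le> \<bar>t - z\<bar>) \<longrightarrow> h i t \<le> B" using away c by simp
  then obtain B where B: "\<And>i t. i \<in> I \<Longrightarrow> (\<forall>z\<in>Zi i. 2 * c \<le> \<bar>t - z\<bar>) \<Longrightarrow> h i t \<le> B i" by metis
  define E where "E = 1 + (\<Sum>i\<in>I. \<bar>B i\<bar>)"
  have E: "1 \<le> E" unfolding E_def by (simp add: sum_nonneg)
  define CE where "CE = (1 + E * CD) * CD"
  define C where "C = max CT CE"
  have C: "1 \<le> C" "CT \<le> C" "CE \<le> C" unfolding C_def using CT by auto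
  have ZiZ: "z \<in> Z" if "i \<in> I" "z \<in> Zi i" for i z using that unfolding Z_def by blast
  have nn: "0 \<le> h i t" if "i \<in> I" "t \<notin> Z" for i t using nonneg that ZiZ by blast
  have Hge: "(\<Sum>i\<in>I. h i t) \<le> H t" for t unfolding H_def by simp
  have H1: "1 \<le> H t" if "t \<notin> Z" for t unfolding H_def using nn that by (simp add: sum_nonneg)
  have "singular_exponent H Z c C \<alpha>"
  proof
    show "0 < c" "c \<le> 1" "1 \<le> C" "0 < \<alpha>" by fact+
    show "4 * c \<le> \<bar>z - z'\<bar>" if "z \<in> Z" "z' \<in> Z" "z \<noteq> z'" for z z' using e(3)[OF that] c by simp
    show "1 \<le> H t" if "t \<notin> Z" for t by (rule H1[OF that])
    show "continuous_on (- Z) H" unfolding H_def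
      by (intro continuous_intros continuous_on_subset[OF cont]) (auto intro: ZiZ)
    show "\<exists>B. \<forall>t. (\<forall>z\<in>Z. \<eta> \<le> \<bar>t - z\<bar>) \<longrightarrow> H t \<le> B" if \<eta>: "0 < \<eta>" for \<eta>
    proof -
      have "\<forall>i\<in>I. \<exists>B. \<forall>t. (\<forall>z\<in>Zi i. \<eta> \<le> \<bar>t - z\<bar>) \<longrightarrow> h i t \<le> B" using away \<eta> by simp
      then obtain B' where B': "\<And>i t. i \<in> I \<Longrightarrow> (\<forall>z\<in>Zi i. \<eta> \<le> \<bar>t - z\<bar>) \<Longrightarrow> h i t \<le> B' i" by metis
      have "H t \<le> 1 + (\<Sum>i\<in>I. B' i)" if "\<forall>z\<in>Z. \<eta> \<le> \<bar>t - z\<bar>" for t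
        unfolding H_def by (intro add_left_mono sum_mono B') (use that ZiZ in auto)
      then show ?thesis by blast
    qed
  next
    fix d t assume d: "0 < d" "d \<le> 1" and far: "\<And>z. z \<in> Z \<Longrightarrow> d \<le> \<bar>t - z\<bar>"
    have t: "t \<notin> Z" using far[of t] d by auto
    have "\<forall>i\<in>I. \<exists>b. \<bar>b\<bar> \<le> Ct i * h i t / d \<and>
        (\<forall>s. \<bar>s - t\<bar> \<le> d / 2 \<longrightarrow> h i s \<le> h i t + b * (s - t) + Ct i * h i t * (s - t)\<^sup>2 / d\<^sup>2)"
      using Ct d far ZiZ by blast
    then obtain b where b: "\<And>i. i \<in> I \<Longrightarrow> \<bar>b i\<bar> \<le> Ct i * h i t / d"
      "\<And>i s. i \<in> I \<Longrightarrow> \<bar>s - t\<bar> \<le> d / 2 \<Longrightarrow> h i s \<le> h i t + b i * (s - t) + Ct i * h i t * (s - t)\<^sup>2 / d\<^sup>2"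
      by metis
    have Ch: "Ct i * h i t \<le> C * h i t" if "i \<in> I" for i
      using CT(2)[OF that] C nn[OF that t] by (intro mult_right_mono) auto
    have CH: "C * (\<Sum>i\<in>I. h i t) \<le> C * H t" using Hge C by (intro mult_left_mono) auto
    have "\<bar>\<Sum>i\<in>I. b i\<bar> \<le> (\<Sum>i\<in>I. C * h i t / d)"
    proof (rule order_trans[OF sum_abs], rule sum_mono)
      fix i assume i: "i \<in> I"
      have "Ct i * h i t / d \<le> C * h i t / d" using Ch[OF i] d by (intro divide_right_mono) auto
      then show "\<bar>b i\<bar> \<le> C * h i t / d" using b(1)[OF i] by linarith
    qed
    also have "\<dots> = C * (\<Sum>i\<in>I. h i t) / d" by (simp add: sum_distrib_left sum_divide_distrib)
    also have "\<dots> \<le> C * H t / d" using CH d by (intro divide_right_mono) auto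
    finally have 1: "\<bar>\<Sum>i\<in>I. b i\<bar> \<le> C * H t / d" .
    have "H s \<le> H t + (\<Sum>i\<in>I. b i) * (s - t) + C * H t * (s - t)\<^sup>2 / d\<^sup>2" if s: "\<bar>s - t\<bar> \<le> d / 2" for s
    proof -
      let ?q = "(s - t)\<^sup>2 / d\<^sup>2"
      have "(\<Sum>i\<in>I. h i s) \<le> (\<Sum>i\<in>I. h i t + b i * (s - t) + (C * h i t) * ?q)"
      proof (rule sum_mono)
        fix i assume i: "i \<in> I"
        have "(Ct i * h i t) * ?q \<le> (C * h i t) * ?q" using Ch[OF i] by (rule mult_right_mono) auto
        then show "h i s \<le> h i t + b i * (s - t) + (C * h i t) * ?q" using b(2)[OF i s] by simp
      qed
      also have "\<dots> = (\<Sum>i\<in>I. h i t) + (\<Sum>i\<in>I. b i) * (s - t) + C * (\<Sum>i\<in>I. h i t) * ?q"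
        by (simp add: sum.distrib sum_distrib_left sum_distrib_right sum_divide_distrib mult_ac)
      also have "C * (\<Sum>i\<in>I. h i t) * ?q \<le> C * H t * ?q" using CH by (intro mult_right_mono) auto
      finally show ?thesis unfolding H_def by simp
    qed
    then show "\<exists>b. \<bar>b\<bar> \<le> C * H t / d \<and>
        (\<forall>s. \<bar>s - t\<bar> \<le> d / 2 \<longrightarrow> H s \<le> H t + b * (s - t) + C * H t * (s - t)\<^sup>2 / d\<^sup>2)" using 1 by blast
  next
    fix z x y assume z: "z \<in> Z" and x: "0 < \<bar>x\<bar>" and xy: "\<bar>x\<bar> \<le> \<bar>y\<bar>" and y: "\<bar>y\<bar> \<le> 2 * c"
    have notZ: "z + v \<notin> Z" if "0 < \<bar>v\<bar>" "\<bar>v\<bar> \<le> 2 * c" for v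
      using e(3)[OF z, of "z + v"] that c by fastforce
    have yZ: "z + y \<notin> Z" and xZ: "z + x \<notin> Z" using notZ x xy y by auto
    define r where "r = (\<bar>x\<bar> / \<bar>y\<bar>) powr \<alpha>"
    have r: "0 \<le> r" unfolding r_def by simp
    define J where "J = {i \<in> I. z \<in> Zi i}"
    have J: "J \<subseteq> I" "finite J" unfolding J_def using I by auto
    obtain i0 where i0: "i0 \<in> J" using z unfolding Z_def J_def by blast
    have regular: "(\<Sum>i\<in>I - J. h i (z + y)) \<le> (\<Sum>i\<in>I. \<bar>B i\<bar>)"
    proof -
      have "(\<Sum>i\<in>I - J. h i (z + y)) \<le> (\<Sum>i\<in>I - J. \<bar>B i\<bar>)"
      proof (rule sum_mono)
        fix i assume i: "i \<in> I - J"
        have "\<forall>z'\<in>Zi i. 2 * c \<le> \<bar>(z + y) - z'\<bar>"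
        proof
          fix z' assume z': "z' \<in> Zi i"
          then have "z' \<noteq> z" using i unfolding J_def by blast
          then have "4 * c \<le> \<bar>z' - z\<bar>" using e(3)[OF ZiZ z] i z' c(3) by fastforce
          then show "2 * c \<le> \<bar>(z + y) - z'\<bar>" using y by linarith
        qed
        then show "h i (z + y) \<le> \<bar>B i\<bar>" using B[of i "z + y"] i by fastforce
      qed
      also have "\<dots> \<le> (\<Sum>i\<in>I. \<bar>B i\<bar>)" using I by (intro sum_mono2) auto
      finally show ?thesis .
    qed
    have Cd': "h i (z + y) \<le> CD * r * h i (z + x)" "1 \<le> CD * h i (z + y)" if i: "i \<in> J" for i
    proof -
      have iI: "i \<in> I" "z \<in> Zi i" using i unfolding J_def by auto
      note * = Cd[OF iI x xy order_trans[OF y c(4)[OF iI(1)]]]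
      have "(\<bar>x\<bar> / \<bar>y\<bar>) powr \<alpha>' i \<le> r" unfolding r_def
        using \<alpha>(3)[OF iI(1)] x xy by (intro powr_mono') (auto simp: divide_le_eq)
      then have "Cd i * (\<bar>x\<bar> / \<bar>y\<bar>) powr \<alpha>' i \<le> CD * r"
        using CD(2)[OF iI(1)] CD(1) by (intro mult_mono) auto
      then have "Cd i * (\<bar>x\<bar> / \<bar>y\<bar>) powr \<alpha>' i * h i (z + x) \<le> CD * r * h i (z + x)"
        using nn[OF iI(1) xZ] by (rule mult_right_mono)
      then show "h i (z + y) \<le> CD * r * h i (z + x)" using * by linarith
      have "Cd i * h i (z + y) \<le> CD * h i (z + y)" using CD(2)[OF iI(1)] nn[OF iI(1) yZ] by (rule mult_right_mono)
      then show "1 \<le> CD * h i (z + y)" using * by linarith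
    qed
    have SJ: "h i0 (z + y) \<le> (\<Sum>i\<in>J. h i (z + y))"
      by (rule member_le_sum[OF i0]) (use J nn yZ in auto)
    have "1 \<le> CD * (\<Sum>i\<in>J. h i (z + y))"
      using Cd'(2)[OF i0] mult_left_mono[OF SJ, of CD] CD(1) by linarith
    then have "E * 1 \<le> E * (CD * (\<Sum>i\<in>J. h i (z + y)))" using E by (intro mult_left_mono) auto
    moreover have "H (z + y) = 1 + (\<Sum>i\<in>I - J. h i (z + y)) + (\<Sum>i\<in>J. h i (z + y))"
      unfolding H_def using sum.subset_diff[OF J(1) I] by simp
    ultimately have "H (z + y) \<le> (1 + E * CD) * (\<Sum>i\<in>J. h i (z + y))"
      using regular unfolding E_def by (simp add: algebra_simps)
    also have "\<dots> \<le> (1 + E * CD) * (\<Sum>i\<in>J. CD * r * h i (z + x))"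
      using Cd'(1) E CD(1) by (intro mult_left_mono sum_mono) auto
    also have "\<dots> = CE * r * (\<Sum>i\<in>J. h i (z + x))" unfolding CE_def by (simp add: sum_distrib_left mult_ac)
    also have "(\<Sum>i\<in>J. h i (z + x)) \<le> (\<Sum>i\<in>I. h i (z + x))" using I J nn xZ by (intro sum_mono2) auto
    also have "\<dots> \<le> H (z + x)" by (rule Hge)
    finally have "H (z + y) \<le> CE * r * H (z + x)" using r E CD(1) unfolding CE_def by (simp add: mult_left_mono)
    also have "\<dots> \<le> C * r * H (z + x)" using C r H1[OF xZ] by (intro mult_right_mono) auto
    finally show "H (z + y) \<le> C * (\<bar>x\<bar> / \<bar>y\<bar>) powr \<alpha> * H (z + x)" unfolding r_def .
  qed
  then show ?thesis by blast
qed

section \<open>Doubling of A-star weights\<close>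

lemma exists_half_mean_le:
  fixes u :: "real \<Rightarrow> real"
  assumes ab: "a < b" and int: "u integrable_on {a..b}" and nonneg: "\<And>x. x \<in> {a..b} \<Longrightarrow> 0 \<le> u x"
    and N: "negligible N"
  obtains x where "x \<in> {a..b}" "x \<notin> N" "integral {a..b} u / (b - a) / 2 \<le> u x"
proof (rule ccontr)
  assume "\<not> thesis"
  then have lt: "u x < integral {a..b} u / (b - a) / 2" if "x \<in> {a..b}" "x \<notin> N" for x
    using that \<open>\<And>x. x \<in> {a..b} \<Longrightarrow> x \<notin> N \<Longrightarrow> integral {a..b} u / (b - a) / 2 \<le> u x \<Longrightarrow> thesis\<close> by force
  define m where "m = integral {a..b} u / (b - a) / 2"
  define u' where "u' = (\<lambda>x. if x \<in> N then m else u x)"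
  have "integral {a..b} u' = integral {a..b} u"
    by (rule integral_spike[OF N]) (auto simp: u'_def)
  moreover have "u' integrable_on {a..b}"
    by (rule integrable_spike[OF int N]) (auto simp: u'_def)
  then have "integral {a..b} u' \<le> integral {a..b} (\<lambda>x. m)"
    by (rule integral_le) (use lt in \<open>auto simp: u'_def m_def intro: less_imp_le\<close>)
  ultimately have "integral {a..b} u \<le> m * (b - a)" using ab by (simp add: mult.commute)
  also have "\<dots> = integral {a..b} u / 2" unfolding m_def using ab by (simp add: field_simps)
  finally have "m \<le> 0" unfolding m_def using ab by (simp add: divide_le_0_iff)
  have "\<not> negligible {a..b}" using ab by (simp add: negligible_interval(1)[of a b, simplified])
  then obtain x where "x \<in> {a..b}" "x \<notin> N" using N negligible_subset[of N "{a..b}"] by blast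
  then show False using lt[of x] nonneg[of x] \<open>m \<le> 0\<close> unfolding m_def by simp
qed

lemma A_star_bounds:
  assumes "A_star_weight u"
  obtains L where "1 \<le> L" "\<And>x. x \<in> {-1..1} \<Longrightarrow> 0 \<le> u x"
    "\<And>a b. -1 \<le> a \<Longrightarrow> b \<le> 1 \<Longrightarrow> u integrable_on {a..b}"
    "\<And>a b x. -1 \<le> a \<Longrightarrow> a < b \<Longrightarrow> b \<le> 1 \<Longrightarrow> x \<in> {a..b} \<Longrightarrow> u x \<le> L / (b - a) * integral {a..b} u"
proof -
  obtain L where nonneg: "\<And>x. x \<in> {-1..1} \<Longrightarrow> 0 \<le> u x" and int: "set_integrable lebesgue {-1..1} u"
    and L: "\<And>I x. is_interval I \<Longrightarrow> I \<subseteq> {-1..1} \<Longrightarrow> measure lebesgue I > 0 \<Longrightarrow> x \<in> I \<Longrightarrow>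
      u x \<le> L / measure lebesgue I * (LINT y:I|lebesgue. u y)"
    using assms unfolding A_star_weight_def weight_def by blast
  have sub: "set_integrable lebesgue {a..b} u" if "-1 \<le> a" "b \<le> 1" for a b
    by (rule set_integrable_subset[OF int]) (use that in auto)
  have bound: "u x \<le> max 1 L / (b - a) * integral {a..b} u" if "-1 \<le> a" "a < b" "b \<le> 1" "x \<in> {a..b}" for a b x
  proof -
    have eq: "(LINT y:{a..b}|lebesgue. u y) = integral {a..b} u"
      using sub[OF that(1,3)] by (rule set_lebesgue_integral_eq_integral)
    have "0 \<le> integral {a..b} u"
      by (rule Henstock_Kurzweil_Integration.integral_nonneg[OF set_lebesgue_integral_eq_integral(1)[OF sub]])
        (use that nonneg in auto)
    then have "L / (b - a) * integral {a..b} u \<le> max 1 L / (b - a) * integral {a..b} u"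
      using that by (intro mult_right_mono divide_right_mono) auto
    moreover have "u x \<le> L / (b - a) * integral {a..b} u"
      using L[of "{a..b}" x] that unfolding eq by (simp add: is_interval_cc subset_eq)
    ultimately show ?thesis by simp
  qed
  show thesis
    by (rule that[of "max 1 L"]) (use nonneg bound set_lebesgue_integral_eq_integral(1)[OF sub] in auto)
qed

text \<open>
  A piece of relative length \<open>1 / (2 * L)\<close> carries at most half of the integral over an interval, since \<open>u\<close> is
  at most \<open>L\<close> times the mean there.  Iterating the removal of such pieces bounds the integral over
  an interval by that over a subinterval, with a power of the ratio of the lengths as factor.
\<close>

lemma A_star_doubling:
  assumes "A_star_weight u"
  obtains C k where "0 < C"
    "\<And>a a' b' b y N. -1 \<le> a \<Longrightarrow> a \<le> a' \<Longrightarrow> a' < b' \<Longrightarrow> b' \<le> b \<Longrightarrow> b \<le> 1 \<Longrightarrow> y \<in> {a..b} \<Longrightarrow> negligible N \<Longrightarrow>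
      \<exists>x\<in>{a'..b'} - N. u y \<le> C * ((b - a) / (b' - a')) ^ k * u x"
proof -
  obtain L where L: "1 \<le> L" and nonneg: "\<And>x. x \<in> {-1..1} \<Longrightarrow> 0 \<le> u x"
    and int: "\<And>a b. -1 \<le> a \<Longrightarrow> b \<le> 1 \<Longrightarrow> u integrable_on {a..b}"
    and mean: "\<And>a b x. -1 \<le> a \<Longrightarrow> a < b \<Longrightarrow> b \<le> 1 \<Longrightarrow> x \<in> {a..b} \<Longrightarrow> u x \<le> L / (b - a) * integral {a..b} u"
    by (fact A_star_bounds[OF assms])
  define J where "J = (\<lambda>a b. integral {a..b} u)"
  have J_nonneg: "0 \<le> J a b" if "-1 \<le> a" "b \<le> 1" for a b
    unfolding J_def by (rule Henstock_Kurzweil_Integration.integral_nonneg[OF int]) (use that nonneg in auto)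
  define q where "q = 1 - 1 / (2 * L)"
  have q: "0 < q" "q < 1" unfolding q_def using L by (auto simp: field_simps)
  have shrink: "J a b \<le> 2 * J a' b'"
    if h: "-1 \<le> a" "a \<le> a'" "a' \<le> b'" "b' \<le> b" "b \<le> 1" "q * (b - a) \<le> b' - a'" "a < b" for a a' b' b
  proof -
    define W where "W = L / (b - a) * J a b"
    have piece: "J p r \<le> (r - p) * W" if "a \<le> p" "p \<le> r" "r \<le> b" for p r
    proof -
      have "J p r \<le> integral {p..r} (\<lambda>_. W)" unfolding J_def W_def
        by (rule integral_le) (use that h mean[of a b] int in auto)
      then show ?thesis using that by simp
    qed
    have "J a a' + J a' b = J a b" "J a' b' + J b' b = J a' b"
      unfolding J_def using h int by (auto intro!: Henstock_Kurzweil_Integration.integral_combine)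
    then have "J a b - J a' b' \<le> (a' - a) * W + (b - b') * W"
      using piece[of a a'] piece[of b' b] h by simp
    also have "\<dots> = ((b - a) - (b' - a')) * W" by (simp add: algebra_simps)
    also have "\<dots> \<le> ((b - a) / (2 * L)) * W"
      using h L J_nonneg[OF h(1,5)] unfolding q_def W_def by (intro mult_right_mono) (auto simp: algebra_simps)
    also have "\<dots> = J a b / 2"
    proof -
      have "l / (2 * L) * (L / l * J a b) = J a b / 2" if "l \<noteq> 0" for l using that L by simp
      from this[of "b - a"] show ?thesis unfolding W_def using h by simp
    qed
    finally show ?thesis by simp
  qed
  have iterate: "J a b \<le> 2 ^ m * J a' b'"
    if "-1 \<le> a" "a \<le> a'" "a' < b'" "b' \<le> b" "b \<le> 1" "q ^ m * (b - a) \<le> b' - a'" for a a' b' b m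
    using that
  proof (induction m arbitrary: a b)
    case 0
    then have "a = a'" "b = b'" by auto
    then show ?case by simp
  next
    case (Suc m)
    show ?case
    proof (cases "q * (b - a) \<le> b' - a'")
      case True
      have "J a b \<le> 2 * J a' b'" by (rule shrink) (use Suc.prems True in auto)
      also have "\<dots> \<le> 2 ^ Suc m * J a' b'"
        using J_nonneg[of a' b'] Suc.prems by (intro mult_right_mono) auto
      finally show ?thesis .
    next
      case False
      \<comment> \<open>the intermediate interval interpolates between the two and has length exactly \<open>q * (b - a)\<close>\<close>
      define \<mu> where "\<mu> = (b - a - q * (b - a)) / (b - a - (b' - a'))"
      have qb: "q * (b - a) \<le> 1 * (b - a)" using q Suc.prems by (intro mult_right_mono) auto
      moreover have "b' - a' < q * (b - a)" using False by simp
      ultimately have "b' - a' < 1 * (b - a)" by (rule order.strict_trans2[rotated])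
      then have den: "0 < b - a - (b' - a')" by simp
      have \<mu>: "0 \<le> \<mu>" "\<mu> \<le> 1"
        unfolding \<mu>_def using den False qb by (auto simp: divide_le_eq)
      define a1 b1 where "a1 = a + \<mu> * (a' - a)" and "b1 = b - \<mu> * (b - b')"
      have "\<mu> * (a' - a) \<le> 1 * (a' - a)" "\<mu> * (b - b') \<le> 1 * (b - b')"
        using \<mu> Suc.prems by (auto intro!: mult_left_le_one_le)
      moreover have "0 \<le> \<mu> * (a' - a)" "0 \<le> \<mu> * (b - b')" using \<mu> Suc.prems by auto
      ultimately have ab1: "a \<le> a1" "a1 \<le> a'" "b' \<le> b1" "b1 \<le> b" unfolding a1_def b1_def by auto
      have "b1 - a1 = (b - a) - \<mu> * (b - a - (b' - a'))" unfolding a1_def b1_def by (simp add: algebra_simps)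
      also have "\<mu> * (b - a - (b' - a')) = b - a - q * (b - a)" unfolding \<mu>_def using den by simp
      finally have len: "b1 - a1 = q * (b - a)" by simp
      have "J a b \<le> 2 * J a1 b1" by (rule shrink) (use Suc.prems ab1 len in auto)
      also have "J a1 b1 \<le> 2 ^ m * J a' b'"
        by (rule Suc.IH) (use Suc.prems ab1 len in \<open>auto simp: mult_ac\<close>)
      finally show ?thesis by simp
    qed
  qed
  obtain k where k: "q ^ k < 1 / 2" using real_arch_pow_inv[of "1 / 2" q] q by auto
  have ratio: "J a b \<le> 2 * ((b - a) / (b' - a')) ^ k * J a' b'"
    if h: "-1 \<le> a" "a \<le> a'" "a' < b'" "b' \<le> b" "b \<le> 1" for a a' b' b
  proof -
    define \<rho> where "\<rho> = (b' - a') / (b - a)"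
    have \<rho>: "0 < \<rho>" "\<rho> \<le> 1" unfolding \<rho>_def using h by auto
    obtain m0 where "q ^ m0 < \<rho>" using real_arch_pow_inv[of \<rho> q] \<rho> q by auto
    then have ex: "q ^ m0 \<le> \<rho>" by simp
    define m where "m = (LEAST m. q ^ m \<le> \<rho>)"
    have m: "q ^ m \<le> \<rho>" unfolding m_def by (rule LeastI[of _ m0]) (rule ex)
    then have "q ^ m * (b - a) \<le> b' - a'" unfolding \<rho>_def using h by (simp add: field_simps)
    then have "J a b \<le> 2 ^ m * J a' b'" by (intro iterate h)
    also have "(2::real) ^ m \<le> 2 * ((b - a) / (b' - a')) ^ k"
    proof (cases m)
      case 0
      have "1 \<le> (b - a) / (b' - a')" using h by simp
      then have "1 \<le> ((b - a) / (b' - a')) ^ k" by (rule one_le_power)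
      then have "1 \<le> 2 * ((b - a) / (b' - a')) ^ k" by linarith
      then show ?thesis unfolding 0 by simp
    next
      case (Suc l)
      then have "\<not> q ^ l \<le> \<rho>" using not_less_Least[of l "\<lambda>m. q ^ m \<le> \<rho>"] unfolding m_def by auto
      then have "\<rho> \<le> q ^ l" by simp
      then have "\<rho> ^ k \<le> (q ^ l) ^ k" using \<rho> by (intro power_mono) auto
      also have "\<dots> = (q ^ k) ^ l" by (simp add: mult.commute flip: power_mult)
      also have "\<dots> \<le> (1 / 2) ^ l" using k q by (intro power_mono) auto
      finally have "2 ^ l \<le> 1 / \<rho> ^ k" using \<rho> by (simp add: field_simps power_one_over)
      also have "\<dots> = ((b - a) / (b' - a')) ^ k" unfolding \<rho>_def by (simp add: power_divide)
      finally show ?thesis unfolding Suc by simp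
    qed
    finally show ?thesis using J_nonneg[of a' b'] h by (simp add: mult_right_mono)
  qed
  show thesis
  proof (rule that[of "4 * L" k])
    show "0 < 4 * L" using L by simp
    fix a a' b' b y :: real and N :: "real set"
    assume h: "-1 \<le> a" "a \<le> a'" "a' < b'" "b' \<le> b" "b \<le> 1" and y: "y \<in> {a..b}" and N: "negligible N"
    obtain x where x: "x \<in> {a'..b'}" "x \<notin> N" "J a' b' / (b' - a') / 2 \<le> u x"
      unfolding J_def by (rule exists_half_mean_le[OF h(3) int _ N]) (use h nonneg in auto)
    let ?r = "((b - a) / (b' - a')) ^ k"
    have r: "0 \<le> ?r" using h by simp
    have "u y \<le> L / (b - a) * J a b" unfolding J_def by (rule mean) (use h y in auto)
    also have "\<dots> \<le> L / (b - a) * (2 * ?r * J a' b')" using h L by (intro mult_left_mono ratio) auto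
    also have "\<dots> \<le> L / (b' - a') * (2 * ?r * J a' b')"
      using h L r J_nonneg[of a' b'] by (intro mult_right_mono divide_left_mono) auto
    also have "\<dots> = 4 * L * ?r * (J a' b' / (b' - a') / 2)"
    proof -
      have "L / l * (2 * R * j) = 4 * L * R * (j / l / 2)" for l R j :: real by simp
      then show ?thesis .
    qed
    also have "\<dots> \<le> 4 * L * ?r * u x" using x(3) L r by (intro mult_left_mono) auto
    finally show "\<exists>x\<in>{a'..b'} - N. u y \<le> 4 * L * ?r * u x" using x by blast
  qed
qed

lemma sin_ge_half:
  fixes x :: real
  assumes "0 \<le> x" "x \<le> 1"
  shows "x / 2 \<le> sin x" "1 / 2 \<le> cos x"
proof -
  have c: "1 / 2 \<le> cos y" if "0 \<le> y" "y \<le> 1" for y :: real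
  proof -
    have "cos (pi / 3) \<le> cos y" by (rule cos_monotone_0_pi_le) (use that pi_gt3 in auto)
    then show ?thesis by (simp add: cos_60)
  qed
  show "1 / 2 \<le> cos x" using c assms by simp
  have "sin 0 - 0 / 2 \<le> sin x - x / 2"
  proof (rule DERIV_nonneg_imp_nondecreasing[OF assms(1)])
    fix y :: real assume "0 \<le> y" "y \<le> x"
    then have "0 \<le> cos y - 1 / 2" using c[of y] assms by simp
    moreover have "((\<lambda>x. sin x - x / 2) has_real_derivative cos y - 1 / 2) (at y)"
      by (auto intro!: derivative_eq_intros)
    ultimately show "\<exists>d. ((\<lambda>x. sin x - x / 2) has_real_derivative d) (at y) \<and> 0 \<le> d" by blast
  qed
  then show "x / 2 \<le> sin x" by simp
qed

lemma cos_distance_upper: "\<bar>cos s - cos t\<bar> \<le> \<bar>s - t\<bar> * (\<bar>sin t\<bar> + \<bar>s - t\<bar>)" for s t :: real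
proof -
  have "sin ((s + t) / 2) = sin (t + (s - t) / 2)" by (simp add: field_simps)
  also have "\<bar>\<dots>\<bar> \<le> \<bar>sin t * cos ((s - t) / 2)\<bar> + \<bar>cos t * sin ((s - t) / 2)\<bar>"
    unfolding sin_add by (rule abs_triangle_ineq)
  also have "\<dots> \<le> \<bar>sin t\<bar> * 1 + 1 * \<bar>(s - t) / 2\<bar>" unfolding abs_mult
    by (intro add_mono mult_mono abs_sin_x_le_abs_x abs_cos_le_one) auto
  also have "\<dots> \<le> \<bar>sin t\<bar> + \<bar>s - t\<bar>" by simp
  finally have 1: "\<bar>sin ((s + t) / 2)\<bar> \<le> \<bar>sin t\<bar> + \<bar>s - t\<bar>" .
  have "\<bar>sin ((t - s) / 2)\<bar> \<le> \<bar>s - t\<bar> / 2" using abs_sin_x_le_abs_x[of "(t - s) / 2"] by (simp add: abs_minus_commute)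
  then have "\<bar>sin ((s + t) / 2)\<bar> * \<bar>sin ((t - s) / 2)\<bar> \<le> (\<bar>sin t\<bar> + \<bar>s - t\<bar>) * (\<bar>s - t\<bar> / 2)"
    using 1 by (intro mult_mono) auto
  then show ?thesis unfolding cos_diff_cos abs_mult by (simp add: algebra_simps)
qed

text \<open>
  The sign of \<open>\<eta>\<close> is chosen so that the two terms of \<open>sin (t + \<eta> / 2)\<close> do not cancel; this handles points near
  the zeros of the sine, where the cosine is not locally injective.
\<close>

lemma cos_distance_lower:
  fixes h t :: real
  assumes "0 < h" "h \<le> 1"
  obtains \<eta> where "\<bar>\<eta>\<bar> = h" "h * (\<bar>sin t\<bar> + h) / 8 \<le> \<bar>cos (t + \<eta>) - cos t\<bar>"
proof -
  define e where "e = (if 0 \<le> sin t * cos t then 1 else -1 :: real)"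
  have e: "\<bar>e\<bar> = 1" "e = 1 \<or> e = -1" unfolding e_def by auto
  have sh: "h / 4 \<le> sin (h / 2)" "1 / 2 \<le> cos (h / 2)" using sin_ge_half[of "h / 2"] assms by auto
  have "sin (t + e * h / 2) = sin t * cos (h / 2) + e * (cos t * sin (h / 2))"
    using e(2) by (auto simp: sin_add)
  moreover have "\<bar>sin t * cos (h / 2) + e * (cos t * sin (h / 2))\<bar> = \<bar>sin t\<bar> * cos (h / 2) + \<bar>cos t\<bar> * sin (h / 2)"
  proof -
    have abs_add: "\<bar>x + y\<bar> = \<bar>x\<bar> + \<bar>y\<bar>" if "0 \<le> x * y" for x y :: real
      using that by (auto simp: zero_le_mult_iff)
    have "0 \<le> e * (sin t * cos t)" unfolding e_def by auto
    moreover have "0 \<le> cos (h / 2) * sin (h / 2)" using sh assms by (intro mult_nonneg_nonneg) auto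
    ultimately have "0 \<le> (e * (sin t * cos t)) * (cos (h / 2) * sin (h / 2))" by (rule mult_nonneg_nonneg)
    then have "0 \<le> (sin t * cos (h / 2)) * (e * (cos t * sin (h / 2)))" by (simp only: mult_ac)
    then have "\<bar>sin t * cos (h / 2) + e * (cos t * sin (h / 2))\<bar> = \<bar>sin t * cos (h / 2)\<bar> + \<bar>e * (cos t * sin (h / 2))\<bar>"
      by (rule abs_add)
    then show ?thesis using e(1) sh assms by (simp add: abs_mult)
  qed
  ultimately have s: "\<bar>sin (t + e * h / 2)\<bar> = \<bar>sin t\<bar> * cos (h / 2) + \<bar>cos t\<bar> * sin (h / 2)" by simp
  have sc: "1 \<le> \<bar>sin t\<bar> + \<bar>cos t\<bar>"
  proof -
    have "1 = (sin t)\<^sup>2 + (cos t)\<^sup>2" by simp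
    also have "\<dots> = \<bar>sin t\<bar> * \<bar>sin t\<bar> + \<bar>cos t\<bar> * \<bar>cos t\<bar>" by (simp add: power2_eq_square)
    also have "\<dots> \<le> \<bar>sin t\<bar> * 1 + \<bar>cos t\<bar> * 1" by (intro add_mono mult_left_mono) auto
    finally show ?thesis by simp
  qed
  have "(\<bar>sin t\<bar> + h) / 4 \<le> \<bar>sin t\<bar> / 2 + (1 - \<bar>sin t\<bar>) * (h / 4)"
    using mult_left_mono[OF assms(2), of "\<bar>sin t\<bar>"] by (simp add: field_simps)
  also have "\<dots> \<le> \<bar>sin t\<bar> * cos (h / 2) + \<bar>cos t\<bar> * sin (h / 2)"
  proof (rule add_mono)
    show "\<bar>sin t\<bar> / 2 \<le> \<bar>sin t\<bar> * cos (h / 2)" using mult_left_mono[OF sh(2), of "\<bar>sin t\<bar>"] by simp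
    have "(1 - \<bar>sin t\<bar>) * (h / 4) \<le> \<bar>cos t\<bar> * (h / 4)" using sc assms by (intro mult_right_mono) auto
    also have "\<dots> \<le> \<bar>cos t\<bar> * sin (h / 2)" using sh by (intro mult_left_mono) auto
    finally show "(1 - \<bar>sin t\<bar>) * (h / 4) \<le> \<bar>cos t\<bar> * sin (h / 2)" .
  qed
  finally have "(\<bar>sin t\<bar> + h) / 4 \<le> \<bar>sin (t + e * h / 2)\<bar>" unfolding s .
  moreover have "h / 4 \<le> \<bar>sin (- (e * h) / 2)\<bar>"
    using sh(1) e(2) assms by auto
  ultimately have "((\<bar>sin t\<bar> + h) / 4) * (h / 4) \<le> \<bar>sin (t + e * h / 2)\<bar> * \<bar>sin (- (e * h) / 2)\<bar>"
    using assms by (intro mult_mono) auto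
  moreover have eq: "cos (t + e * h) - cos t = 2 * sin (t + e * h / 2) * sin (- (e * h) / 2)"
    using cos_diff_cos[of "t + e * h" t] by (simp add: field_simps)
  moreover have "\<bar>cos (t + e * h) - cos t\<bar> = 2 * (\<bar>sin (t + e * h / 2)\<bar> * \<bar>sin (- (e * h) / 2)\<bar>)"
    unfolding eq abs_mult by simp
  moreover have "h * (\<bar>sin t\<bar> + h) / 8 = 2 * (((\<bar>sin t\<bar> + h) / 4) * (h / 4))" by (simp add: field_simps)
  ultimately have "h * (\<bar>sin t\<bar> + h) / 8 \<le> \<bar>cos (t + e * h) - cos t\<bar>" by linarith
  then show thesis using that[of "e * h"] e assms by (simp add: abs_mult)
qed

text \<open>
  The images of the intervals under the cosine have lengths comparable to
  \<open>\<bar>s - t\<bar> * (\<bar>sin t\<bar> + \<bar>s - t\<bar>)\<close> and \<open>h * (\<bar>sin t\<bar> + h)\<close>, whose ratio is at most quadratic in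
  \<open>\<bar>s - t\<bar> / h\<close>.
\<close>

lemma A_star_cos_doubling:
  assumes u: "A_star_weight u"
  obtains C k where "0 < C"
    "\<And>t s h N. 0 < h \<Longrightarrow> h \<le> 1 \<Longrightarrow> negligible N \<Longrightarrow>
      \<exists>t'. \<bar>t' - t\<bar> \<le> h \<and> cos t' \<notin> N \<and> u (cos s) \<le> C * (1 + \<bar>s - t\<bar> / h) ^ k * u (cos t')"
proof -
  obtain C k where C: "0 < C" and
    D: "\<And>a a' b' b y N. -1 \<le> a \<Longrightarrow> a \<le> a' \<Longrightarrow> a' < b' \<Longrightarrow> b' \<le> b \<Longrightarrow> b \<le> 1 \<Longrightarrow> y \<in> {a..b} \<Longrightarrow> negligible N \<Longrightarrow>
      \<exists>x\<in>{a'..b'} - N. u y \<le> C * ((b - a) / (b' - a')) ^ k * u x"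
    using A_star_doubling[OF u] by metis
  have nonneg: "0 \<le> u x" if "x \<in> {-1..1}" for x
    using u that unfolding A_star_weight_def weight_def by blast
  show thesis
  proof (rule that[of "C * 8 ^ k" "2 * k"])
    show "0 < C * 8 ^ k" using C by simp
    fix t s h :: real and N :: "real set"
    assume h: "0 < h" "h \<le> 1" and N: "negligible N"
    obtain \<eta> where \<eta>: "\<bar>\<eta>\<bar> = h" "h * (\<bar>sin t\<bar> + h) / 8 \<le> \<bar>cos (t + \<eta>) - cos t\<bar>"
      by (rule cos_distance_lower[OF h, of t])
    define a' b' where "a' = min (cos t) (cos (t + \<eta>))" and "b' = max (cos t) (cos (t + \<eta>))"
    define a b where "a = min a' (cos s)" and "b = max b' (cos s)"
    have len': "b' - a' = \<bar>cos (t + \<eta>) - cos t\<bar>" unfolding a'_def b'_def by auto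
    have pos: "0 < h * (\<bar>sin t\<bar> + h) / 8" using h by simp
    then have ab': "a' < b'" using \<eta>(2) len' by linarith
    have len: "b - a \<le> (b' - a') + \<bar>cos s - cos t\<bar>" unfolding a_def b_def a'_def b'_def by auto
    have "\<exists>x\<in>{a'..b'} - N. u (cos s) \<le> C * ((b - a) / (b' - a')) ^ k * u x"
      by (rule D[OF _ _ ab' _ _ _ N]) (auto simp: a_def b_def a'_def b'_def)
    then obtain x where x: "x \<in> {a'..b'}" "x \<notin> N" "u (cos s) \<le> C * ((b - a) / (b' - a')) ^ k * u x" by blast
    define \<rho> where "\<rho> = \<bar>s - t\<bar> / h"
    have \<rho>: "0 \<le> \<rho>" "\<bar>s - t\<bar> = \<rho> * h" unfolding \<rho>_def using h by auto
    have "(b - a) / (b' - a') \<le> 1 + \<bar>cos s - cos t\<bar> / (b' - a')"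
      using divide_right_mono[OF len, of "b' - a'"] ab' by (simp add: add_divide_distrib)
    also have "\<bar>cos s - cos t\<bar> / (b' - a') \<le> (\<rho> * h * (\<bar>sin t\<bar> + \<rho> * h)) / (h * (\<bar>sin t\<bar> + h) / 8)"
      using cos_distance_upper[of s t] \<eta>(2) pos len' unfolding \<rho>(2) by (intro frac_le) auto
    also have "\<dots> \<le> (\<rho> * h * ((1 + \<rho>) * (\<bar>sin t\<bar> + h))) / (h * (\<bar>sin t\<bar> + h) / 8)"
      using \<rho> h pos by (intro divide_right_mono mult_left_mono) (auto simp: algebra_simps)
    also have "\<dots> = 8 * \<rho> * (1 + \<rho>)"
    proof -
      have "\<bar>sin t\<bar> + h \<noteq> 0" using h by auto
      then show ?thesis using h by (simp add: divide_simps)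
    qed
    also have "1 + 8 * \<rho> * (1 + \<rho>) \<le> 8 * (1 + \<rho>)\<^sup>2" using \<rho> by (simp add: power2_eq_square algebra_simps)
    finally have ratio: "(b - a) / (b' - a') \<le> 8 * (1 + \<rho>)\<^sup>2" by simp
    have "-1 \<le> a'" "b' \<le> 1" unfolding a'_def b'_def by auto
    then have x1: "x \<in> {-1..1}" using x(1) by simp
    have ba: "0 \<le> (b - a) / (b' - a')" using ab' unfolding a_def b_def by (intro divide_nonneg_pos) auto
    have "u (cos s) \<le> C * ((b - a) / (b' - a')) ^ k * u x" by (rule x(3))
    also have "\<dots> \<le> C * (8 * (1 + \<rho>)\<^sup>2) ^ k * u x"
      using C nonneg[OF x1] ratio ba by (intro mult_right_mono mult_left_mono power_mono) auto
    also have "\<dots> = C * 8 ^ k * (1 + \<rho>) ^ (2 * k) * u x" by (simp add: power_mult_distrib power_mult)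
    finally have le: "u (cos s) \<le> C * 8 ^ k * (1 + \<rho>) ^ (2 * k) * u x" .
    have "connected (cos ` closed_segment t (t + \<eta>))"
      by (intro connected_continuous_image continuous_intros connected_segment)
    moreover have "a' \<in> cos ` closed_segment t (t + \<eta>)" "b' \<in> cos ` closed_segment t (t + \<eta>)"
      unfolding a'_def b'_def by (auto simp: min_def max_def)
    ultimately have "x \<in> cos ` closed_segment t (t + \<eta>)"
      using x(1) connected_contains_Icc by blast
    then obtain t' where t': "t' \<in> closed_segment t (t + \<eta>)" "x = cos t'" by blast
    then have "\<bar>t' - t\<bar> \<le> h" using \<eta>(1) segment_bound(1)[of t' t "t + \<eta>"] by simp
    then show "\<exists>t'. \<bar>t' - t\<bar> \<le> h \<and> cos t' \<notin> N \<and> u (cos s) \<le> C * 8 ^ k * (1 + \<bar>s - t\<bar> / h) ^ (2 * k) * u (cos t')"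
      using x(2) le t'(2) unfolding \<rho>_def by blast
  qed
qed

section \<open>The weighted Markov inequality\<close>

lemma has_field_derivative_poly_cos:
  fixes P :: "complex poly"
  shows "((\<lambda>w. poly P (cos w)) has_field_derivative - (sin w * poly (pderiv P) (cos w))) (at w within S)"
  by (rule DERIV_subset[OF DERIV_chain2[OF poly_DERIV DERIV_cos, THEN DERIV_cong]]) auto

lemma derivative_bound_of_disc:
  fixes P :: "complex poly"
  assumes "\<And>z. norm (z - w) \<le> r \<Longrightarrow> norm (poly P (cos z)) \<le> Y" "0 < r"
  shows "norm (sin w * poly (pderiv P) (cos w)) \<le> Y / r"
proof -
  have "norm ((deriv ^^ 1) (\<lambda>z. poly P (cos z)) w) \<le> fact 1 * Y / r ^ 1"
  proof (rule Cauchy_inequality)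
    show "(\<lambda>z. poly P (cos z)) holomorphic_on ball w r" by (intro holomorphic_intros)
    show "continuous_on (cball w r) (\<lambda>z. poly P (cos z))" by (intro continuous_intros)
    show "norm (poly P (cos z)) \<le> Y" if "norm (w - z) = r" for z
      using assms(1)[of z] that by (simp add: norm_minus_commute)
  qed fact
  moreover have "deriv (\<lambda>z. poly P (cos z)) w = - (sin w * poly (pderiv P) (cos w))"
    by (rule DERIV_imp_deriv[OF has_field_derivative_poly_cos])
  ultimately show ?thesis by simp
qed

lemma lipschitz_of_disc:
  fixes P :: "complex poly" and s t :: real
  assumes disc: "\<And>z. norm (z - of_real t) \<le> r \<Longrightarrow> norm (poly P (cos z)) \<le> Y" and "0 < r"
    and s: "\<bar>s - t\<bar> \<le> r / 2"
  shows "norm (poly P (of_real (cos s)) - poly P (of_real (cos t))) \<le> 2 * Y / r * \<bar>s - t\<bar>"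
proof -
  have "norm (poly P (cos (of_real s)) - poly P (cos (of_real t))) \<le> (Y / (r / 2)) * norm (of_real s - of_real t :: complex)"
  proof (rule field_differentiable_bound[of "cball (of_real t :: complex) (r / 2)" "\<lambda>w. poly P (cos w)"])
    fix w :: complex assume w: "w \<in> cball (of_real t) (r / 2)"
    have "norm (sin w * poly (pderiv P) (cos w)) \<le> Y / (r / 2)"
    proof (rule derivative_bound_of_disc)
      fix z assume "norm (z - w) \<le> r / 2"
      moreover have "norm (w - of_real t) \<le> r / 2" using w by (simp add: dist_norm norm_minus_commute)
      moreover have "z - of_real t = (z - w) + (w - of_real t)" by simp
      ultimately have "norm (z - of_real t) \<le> r" using norm_triangle_ineq[of "z - w" "w - of_real t"] by simp
      then show "norm (poly P (cos z)) \<le> Y" by (rule disc)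
    qed (use assms in simp)
    then show "norm (- (sin w * poly (pderiv P) (cos w))) \<le> Y / (r / 2)" by simp
    show "((\<lambda>w. poly P (cos w)) has_field_derivative - (sin w * poly (pderiv P) (cos w))) (at w within cball (of_real t) (r / 2))"
      by (rule has_field_derivative_poly_cos)
  next
    show "(of_real s :: complex) \<in> cball (of_real t) (r / 2)"
      using s by (simp add: dist_norm abs_minus_commute flip: of_real_diff)
  qed (use assms in auto)
  then show ?thesis by (simp add: cos_of_real mult_ac flip: of_real_diff)
qed

lemma norm_sin_ge_half:
  fixes w :: complex
  assumes "norm w \<le> 1"
  shows "norm w / 2 \<le> norm (sin w)"
proof -
  define x y where "x = Re w" and "y = Im w"
  have "\<bar>x\<bar> \<le> 1" unfolding x_def using abs_Re_le_cmod[of w] assms by simp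
  then have "\<bar>x\<bar> / 2 \<le> \<bar>sin x\<bar>"
    using sin_ge_half(1)[of "\<bar>x\<bar>"] by (cases "0 \<le> x") auto
  then have sx: "x\<^sup>2 / 4 \<le> (sin x)\<^sup>2" using power_mono[of "\<bar>x\<bar> / 2" "\<bar>sin x\<bar>" 2] by (simp add: power_divide)
  have "\<bar>y\<bar> \<le> \<bar>(exp y - inverse (exp y)) / 2\<bar>" by (rule real_le_abs_sinh)
  then have "\<bar>y\<bar>\<^sup>2 \<le> \<bar>(exp y - inverse (exp y)) / 2\<bar>\<^sup>2" by (intro power_mono) auto
  then have sy: "4 * y\<^sup>2 \<le> (exp y - inverse (exp y))\<^sup>2" by (simp add: power_divide)
  have "(norm (sin w))\<^sup>2 = (exp (2 * y) + inverse (exp (2 * y)) - 2 * cos (2 * x)) / 4"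
    unfolding norm_sin_squared x_def y_def ..
  also have "exp (2 * y) = (exp y)\<^sup>2" by (simp add: power2_eq_square flip: exp_add)
  also have "inverse ((exp y)\<^sup>2) = (inverse (exp y))\<^sup>2" by (simp add: power_inverse)
  also have "cos (2 * x) = 1 - 2 * (sin x)\<^sup>2" by (rule cos_double_sin)
  also have "((exp y)\<^sup>2 + (inverse (exp y))\<^sup>2 - 2 * (1 - 2 * (sin x)\<^sup>2)) / 4 = (exp y - inverse (exp y))\<^sup>2 / 4 + (sin x)\<^sup>2"
  proof -
    have "(exp y - inverse (exp y))\<^sup>2 = (exp y)\<^sup>2 + (inverse (exp y))\<^sup>2 - 2" by (simp add: power2_diff)
    then show ?thesis by simp
  qed
  also have "\<dots> \<ge> y\<^sup>2 + x\<^sup>2 / 4" using sx sy by simp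
  finally have "y\<^sup>2 + x\<^sup>2 / 4 \<le> (norm (sin w))\<^sup>2" .
  moreover have "(norm w / 2)\<^sup>2 = (x\<^sup>2 + y\<^sup>2) / 4"
    unfolding power_divide cmod_power2 x_def y_def by simp
  ultimately have "(norm w / 2)\<^sup>2 \<le> (norm (sin w))\<^sup>2" using zero_le_power2[of y] by argo
  then show ?thesis by (rule power2_le_imp_le) simp
qed

text \<open>
  If \<open>sin t\<close> is at least of order \<open>r\<close>, divide the Cauchy estimate for the derivative of \<open>P (cos w)\<close> by it.  Otherwise
  \<open>t\<close> is close to \<open>0\<close> or \<open>pi\<close>, and the same argument applies on a circle of radius \<open>r / 2\<close> around
  that point, where the sine is large enough; the entire function \<open>P' (cos w)\<close> satisfies the maximum
  principle inside.
\<close>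

lemma markov_of_disc:
  fixes P :: "complex poly" and t r :: real
  assumes disc: "\<And>z. norm (z - of_real t) \<le> r \<Longrightarrow> norm (poly P (cos z)) \<le> Y"
    and r: "0 < r" "r \<le> 1" and t: "0 \<le> t" "t \<le> pi"
  shows "norm (poly (pderiv P) (of_real (cos t))) \<le> 32 * Y / r\<^sup>2"
proof -
  have Y: "0 \<le> Y" using order_trans[OF norm_ge_zero disc[of "of_real t"]] r by simp
  have derivative: "norm (sin w) * norm (poly (pderiv P) (cos w)) \<le> Y / (r / 4)"
    if w: "norm (w - of_real t) \<le> 3 * r / 4" for w
    unfolding norm_mult[symmetric]
  proof (rule derivative_bound_of_disc)
    fix z assume z: "norm (z - w) \<le> r / 4"
    have "z - of_real t = (z - w) + (w - of_real t)" by simp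
    then have "norm (z - of_real t) \<le> norm (z - w) + norm (w - of_real t)" by (metis norm_triangle_ineq)
    then show "norm (poly P (cos z)) \<le> Y" using z w by (intro disc) simp
  qed (use r in simp)
  show ?thesis
  proof (cases "r / 8 \<le> sin t")
    case True
    have "r / 8 * norm (poly (pderiv P) (of_real (cos t))) \<le> norm (sin (of_real t :: complex)) * norm (poly (pderiv P) (of_real (cos t)))"
      using True r by (intro mult_right_mono) (auto simp: sin_of_real)
    also have "\<dots> \<le> Y / (r / 4)" using derivative[of "of_real t"] r by (simp add: cos_of_real)
    finally show ?thesis using r by (simp add: power2_eq_square field_simps)
  next
    case False
    define p where "p = (if t \<le> pi / 2 then 0 else pi)"
    define \<tau> where "\<tau> = \<bar>t - p\<bar>"
    have \<tau>: "0 \<le> \<tau>" "\<tau> \<le> pi / 2" "sin \<tau> = sin t" unfolding \<tau>_def p_def using t by (auto simp: sin_diff)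
    have "\<tau> \<le> 1"
    proof (rule ccontr)
      assume "\<not> \<tau> \<le> 1"
      then have "sin 1 \<le> sin \<tau>" using \<tau> pi_gt_zero by (intro sin_monotone_2pi_le) auto
      then show False using sin_ge_half(1)[of 1] False \<tau> r by simp
    qed
    then have "\<tau> / 2 \<le> sin \<tau>" using sin_ge_half(1)[OF \<tau>(1) \<open>\<tau> \<le> 1\<close>] by simp
    then have tp: "\<tau> \<le> r / 4" using False \<tau> by simp
    have "norm (poly (pderiv P) (cos (of_real t))) \<le> 16 * Y / r\<^sup>2"
    proof (rule norm_le_on_disc_of_sphere[of "of_real p" "r / 2"])
      have "norm (of_real t - of_real p :: complex) = \<tau>" unfolding \<tau>_def by (simp flip: of_real_diff)
      then show "norm (of_real t - of_real p :: complex) \<le> r / 2" using tp r by simp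
      fix w :: complex assume w: "norm (w - of_real p) = r / 2"
      have "norm (w - of_real t) \<le> norm (w - of_real p) + norm (of_real p - of_real t :: complex)"
        using norm_triangle_ineq[of "w - of_real p" "of_real p - of_real t"] by simp
      also have "norm (of_real p - of_real t :: complex) = \<tau>" unfolding \<tau>_def by (simp add: abs_minus_commute flip: of_real_diff)
      finally have wt: "norm (w - of_real t) \<le> 3 * r / 4" using w tp by simp
      have "r / 2 / 2 \<le> norm (sin (w - of_real p))" using norm_sin_ge_half[of "w - of_real p"] w r by simp
      also have "\<dots> = norm (sin w)" unfolding p_def by (simp add: sin_diff cos_of_real sin_of_real)
      finally have "r / 4 * norm (poly (pderiv P) (cos w)) \<le> norm (sin w) * norm (poly (pderiv P) (cos w))"
        by (intro mult_right_mono) auto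
      also have "\<dots> \<le> Y / (r / 4)" by (rule derivative[OF wt])
      finally show "norm (poly (pderiv P) (cos w)) \<le> 16 * Y / r\<^sup>2"
        using r by (simp add: power2_eq_square field_simps)
    qed (use r in simp)
    also have "\<dots> \<le> 32 * Y / r\<^sup>2" using Y by (intro divide_right_mono) auto
    finally show ?thesis by (simp add: cos_of_real)
  qed
qed

text \<open>
  Take the supremum of \<open>f s / (1 + n * \<bar>s - t\<bar>) ^ k\<close> over all \<open>s\<close>.
\<close>

lemma smoothed_weight:
  fixes f :: "real \<Rightarrow> real" and n k :: nat
  assumes f: "\<And>t. 0 \<le> f t" "\<And>t. f t \<le> U"
  obtains v where "\<And>t. f t \<le> v t" "\<And>t. v t \<le> U" "\<And>s t. v t \<le> (1 + real n * \<bar>s - t\<bar>) ^ k * v s"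
    "\<And>t y. y < v t \<Longrightarrow> \<exists>s. y * (1 + real n * \<bar>s - t\<bar>) ^ k < f s"
proof -
  define q where "q = (\<lambda>t s. f s / (1 + real n * \<bar>s - t\<bar>) ^ k)"
  define v where "v = (\<lambda>t. Sup (range (q t)))"
  have one: "1 \<le> (1 + real n * \<bar>s - t\<bar>) ^ k" for s t by (intro one_le_power) simp
  have qU: "q t s \<le> U" for t s
  proof -
    have "0 < (1 + real n * \<bar>s - t\<bar>) ^ k" using one[of s t] by linarith
    then have "q t s \<le> f s / 1" unfolding q_def
      by (intro divide_left_mono one f) (simp only: mult_1_right)
    then show ?thesis using f(2)[of s] by simp
  qed
  have bdd: "bdd_above (range (q t))" for t using qU by (intro bdd_aboveI[of _ U]) auto
  have le: "q t s \<le> v t" for t s unfolding v_def by (rule cSup_upper[OF _ bdd]) simp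
  show thesis
  proof (rule that[of v])
    show "f t \<le> v t" for t using le[of t t] unfolding q_def by simp
    show "v t \<le> U" for t unfolding v_def by (rule cSup_least) (use qU in auto)
    show "v t \<le> (1 + real n * \<bar>s - t\<bar>) ^ k * v s" for s t
    proof -
      have "q t r \<le> (1 + real n * \<bar>s - t\<bar>) ^ k * v s" for r
      proof -
        define x y z where "x = 1 + real n * \<bar>r - t\<bar>" and "y = 1 + real n * \<bar>s - t\<bar>" and "z = 1 + real n * \<bar>r - s\<bar>"
        have pos: "1 \<le> x" "1 \<le> y" "1 \<le> z" unfolding x_def y_def z_def by auto
        have "real n * \<bar>r - s\<bar> \<le> real n * (\<bar>r - t\<bar> + \<bar>s - t\<bar>)" by (intro mult_left_mono) auto
        moreover have "0 \<le> (real n * \<bar>r - t\<bar>) * (real n * \<bar>s - t\<bar>)" by simp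
        moreover have "x * y = 1 + real n * (\<bar>r - t\<bar> + \<bar>s - t\<bar>) + (real n * \<bar>r - t\<bar>) * (real n * \<bar>s - t\<bar>)"
          unfolding x_def y_def by (simp add: algebra_simps)
        ultimately have "z \<le> x * y" unfolding z_def by linarith
        then have "z ^ k \<le> x ^ k * y ^ k" unfolding power_mult_distrib[symmetric] using pos by (intro power_mono) auto
        then have "f r / (x ^ k * y ^ k) \<le> f r / z ^ k" using f(1)[of r] pos by (intro divide_left_mono) auto
        also have "\<dots> \<le> v s" using le[of s r] unfolding q_def z_def .
        finally have "f r / x ^ k \<le> y ^ k * v s" using pos by (simp add: field_simps)
        then show ?thesis unfolding q_def x_def y_def .
      qed
      then show ?thesis unfolding v_def[of] using cSup_least[of "range (q t)"] by auto
    qed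
    show "\<exists>s. y * (1 + real n * \<bar>s - t\<bar>) ^ k < f s" if yv: "y < v t" for t y
    proof -
      obtain s where "y < q t s" using yv less_cSup_iff[OF _ bdd[of t], of y] unfolding v_def by auto
      moreover have "0 < (1 + real n * \<bar>s - t\<bar>) ^ k" using one[of s t] by linarith
      ultimately show ?thesis unfolding q_def by (intro exI[of _ s]) (simp add: field_simps)
    qed
  qed
qed

text \<open>
  Let \<open>S\<close> be the supremum of \<open>\<bar>f\<bar> * v * exp (- h)\<close> for the truncated exponent \<open>h\<close>.  A point \<open>t\<close> where more than half of
  it is attained has \<open>h t = H t\<close>, and \<open>\<bar>f\<bar>\<close> and \<open>H\<close> are stable at distance \<open>\<eta> / n\<close> from \<open>t\<close>.  Comparison
  with a point of that neighbourhood where the pointwise bound holds and \<open>u\<close> is comparable to \<open>v t\<close> shows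
  that \<open>S\<close> is at most a multiple of \<open>m\<close>.
\<close>

lemma weighted_markov:
  assumes "singular_exponent H Z c C \<alpha>" and u: "A_star_weight u"
    and W: "\<And>t. W (cos t) = (if t \<in> Z then 0 else exp (- H t))"
  obtains K where "0 < K"
    "\<And>n (P :: complex poly) m N x. 1 \<le> n \<Longrightarrow> degree P \<le> n \<Longrightarrow> negligible N \<Longrightarrow> 0 \<le> m \<Longrightarrow>
      (\<And>x. x \<in> {-1..1} \<Longrightarrow> x \<notin> N \<Longrightarrow> norm (poly P (of_real x)) * (W x * u x) \<le> m) \<Longrightarrow>
      x \<in> {-1..1} \<Longrightarrow> norm (poly (pderiv P) (of_real x)) * (W x * u x) \<le> K * (real n)\<^sup>2 * m"
proof -
  interpret singular_exponent H Z c C \<alpha> by fact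
  obtain C1 k where C1: "0 < C1" and doubling: "\<And>t s h N. 0 < h \<Longrightarrow> h \<le> 1 \<Longrightarrow> negligible N \<Longrightarrow>
      \<exists>t'. \<bar>t' - t\<bar> \<le> h \<and> cos t' \<notin> N \<and> u (cos s) \<le> C1 * (1 + \<bar>s - t\<bar> / h) ^ k * u (cos t')"
    by (fact A_star_cos_doubling[OF u])
  obtain L where L: "1 \<le> L" and u0: "\<And>x. x \<in> {-1..1} \<Longrightarrow> 0 \<le> u x"
    and "\<And>a b. -1 \<le> a \<Longrightarrow> b \<le> 1 \<Longrightarrow> u integrable_on {a..b}"
    and mean: "\<And>a b x. -1 \<le> a \<Longrightarrow> a < b \<Longrightarrow> b \<le> 1 \<Longrightarrow> x \<in> {a..b} \<Longrightarrow> u x \<le> L / (b - a) * integral {a..b} u"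
    by (fact A_star_bounds[OF u])
  define U where "U = L / 2 * integral {-1..1} u"
  have uU: "u x \<le> U" if "x \<in> {-1..1}" for x using mean[of "-1" 1 x] that unfolding U_def by simp
  obtain \<kappa>0 M0 where \<kappa>0: "0 < \<kappa>0" and majorant: "\<forall>n\<ge>1. \<exists>h. bernstein_majorant H Z k \<kappa>0 M0 n h"
    using weighted_bernstein[of k] by blast
  define \<kappa> where "\<kappa> = min 1 \<kappa>0"
  define M where "M = max 1 M0"
  have \<kappa>: "0 < \<kappa>" "\<kappa> \<le> 1" "\<kappa> \<le> \<kappa>0" unfolding \<kappa>_def using \<kappa>0 by auto
  have M: "1 \<le> M" "M0 \<le> M" unfolding M_def by auto
  \<comment> \<open>within \<open>\<eta> / n\<close> the Lipschitz bound lets \<open>f\<close> change by at most half of its value at the centre\<close>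
  define \<eta> where "\<eta> = \<kappa> / (8 * M)"
  have \<eta>: "0 < \<eta>" "\<eta> \<le> 1" "\<eta> \<le> \<kappa> / 2" "\<eta> \<le> \<kappa>"
    unfolding \<eta>_def using \<kappa> M by (auto simp: field_simps)
  define C2 where "C2 = 2 * C1 / \<eta> ^ k"
  have C2: "0 < C2" unfolding C2_def using C1 \<eta> by simp
  define K where "K = 32 * M / \<kappa>\<^sup>2 * (4 * C2 * exp M)"
  have "0 < K" unfolding K_def using \<kappa> M C2 by simp
  moreover have "norm (poly (pderiv P) (of_real x)) * (W x * u x) \<le> K * (real n)\<^sup>2 * m"
    if n: "1 \<le> n" and deg: "degree P \<le> n" and N: "negligible N" and m: "0 \<le> m"
      and bd: "\<And>x. x \<in> {-1..1} \<Longrightarrow> x \<notin> N \<Longrightarrow> norm (poly P (of_real x)) * (W x * u x) \<le> m"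
      and x: "x \<in> {-1..1}" for n and P :: "complex poly" and m N x
  proof -
    have n0: "1 \<le> real n" using n by simp
    obtain h where "bernstein_majorant H Z k \<kappa>0 M0 n h" using majorant n by blast
    note h = this[unfolded bernstein_majorant_def]
    have h0: "0 \<le> h t" and hH: "t \<notin> Z \<Longrightarrow> h t \<le> H t" for t using h by auto
    have uc: "0 \<le> u (cos t)" "u (cos t) \<le> U" for t using u0[of "cos t"] uU[of "cos t"] by auto
    obtain v where uv: "\<And>t. u (cos t) \<le> v t" and vU: "\<And>t. v t \<le> U"
      and vg: "\<And>s t. v t \<le> (1 + real n * \<bar>s - t\<bar>) ^ k * v s"
      and vsup: "\<And>t y. y < v t \<Longrightarrow> \<exists>s. y * (1 + real n * \<bar>s - t\<bar>) ^ k < u (cos s)"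
      by (fact smoothed_weight[of "\<lambda>t. u (cos t)" U n k, OF uc])
    have v0: "0 \<le> v t" for t using uc(1)[of t] uv[of t] by linarith
    define f where "f = (\<lambda>t. norm (poly P (of_real (cos t))))"
    obtain Bf where "\<And>w. 0 \<le> Im w \<Longrightarrow> norm (poly P (cos w) * exp (\<i> * of_nat n * w)) \<le> Bf"
      using norm_poly_cos_le[OF deg] by blast
    from this[of "of_real t" for t] have Bf: "f t \<le> Bf" for t unfolding f_def by (simp add: norm_mult cos_of_real)
    define g where "g = (\<lambda>t. f t * v t * exp (- h t))"
    have f0: "0 \<le> f t" for t unfolding f_def by simp
    have "g t \<le> Bf * U * 1" for t unfolding g_def
      using Bf[of t] vU[of t] v0[of t] f0[of t] h0[of t] order_trans[OF f0 Bf] order_trans[OF v0 vU]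
      by (intro mult_mono) auto
    then have bdd: "bdd_above (range g)" by (intro bdd_aboveI[of _ "Bf * U * 1"]) auto
    define S where "S = Sup (range g)"
    have gS: "g t \<le> S" for t unfolding S_def by (rule cSup_upper[OF _ bdd]) simp
    have "0 \<le> g 0" unfolding g_def using f0 v0 by simp
    then have S0: "0 \<le> S" using gS[of 0] by linarith
    have fS: "f t * v t \<le> S * exp (h t)" for t
    proof -
      have "f t * v t = g t * exp (h t)" unfolding g_def by (simp add: exp_minus)
      also have "\<dots> \<le> S * exp (h t)" by (intro mult_right_mono gS) simp
      finally show ?thesis .
    qed
    note core = h[THEN conjunct2, THEN conjunct2, rule_format, OF deg v0 vg S0 fS[unfolded f_def]]
    have bern: "norm (poly P (cos w)) * v t \<le> M * S * exp (h t)" if "norm (w - of_real t) \<le> \<kappa> / n" for t w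
    proof -
      have "\<kappa> / n \<le> \<kappa>0 / n" using \<kappa> by (intro divide_right_mono) auto
      then have "norm (poly P (cos w)) * v t \<le> M0 * S * exp (h t)"
        using core[THEN conjunct1, rule_format, of w t] that by linarith
      also have "\<dots> \<le> M * S * exp (h t)" using M S0 by (intro mult_right_mono) auto
      finally show ?thesis .
    qed
    have alt: "f t * v t \<le> S * exp (h t) / 4 \<or>
        h t = H t \<and> (\<forall>s. \<bar>s - t\<bar> \<le> \<kappa> / n \<longrightarrow> s \<notin> Z \<and> H s \<le> H t + M)" for t
    proof -
      have "\<kappa> / n \<le> \<kappa>0 / n" using \<kappa> by (intro divide_right_mono) auto
      moreover have "f t * v t \<le> S * exp (h t) / 4 \<or>
        h t = H t \<and> (\<forall>s. \<bar>s - t\<bar> \<le> \<kappa>0 / n \<longrightarrow> s \<notin> Z \<and> H s \<le> H t + M0)"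
        using core[THEN conjunct2, rule_format, of t] unfolding f_def .
      ultimately show ?thesis using M(2) by (smt (verit))
    qed
    have Sm: "S \<le> 4 * C2 * exp M * m"
    proof (cases "S = 0")
      case True
      then show ?thesis using C2 m by simp
    next
      case False
      then have Spos: "0 < S" using S0 by simp
      then have "S / 2 < Sup (range g)" unfolding S_def by simp
      then obtain t where gt: "S / 2 < g t" using less_cSupD[of "range g" "S / 2"] by auto
      have Se: "S * exp (h t) / 2 < f t * v t"
      proof -
        have "S / 2 * exp (h t) < g t * exp (h t)" using gt by simp
        also have "\<dots> = f t * v t" unfolding g_def by (simp add: exp_minus)
        finally show ?thesis by simp
      qed
      have hS: "0 < S * exp (h t)" using Spos by simp
      then have ht: "h t = H t" and near: "\<And>s. \<bar>s - t\<bar> \<le> \<kappa> / n \<Longrightarrow> s \<notin> Z \<and> H s \<le> H t + M"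
        using alt[of t] Se by auto
      have vt: "0 < v t" using Se hS v0[of t] f0[of t] by (cases "v t = 0") auto
      define Y where "Y = M * S * exp (h t) / v t"
      have disc: "norm (poly P (cos w)) \<le> Y" if "norm (w - of_real t) \<le> \<kappa> / n" for w
        using bern[OF that] vt unfolding Y_def by (simp add: pos_le_divide_eq)
      have "0 \<le> Y" unfolding Y_def using M Spos vt by simp
      have \<kappa>n: "0 < \<kappa> / n" using \<kappa> n0 by simp
      have close: "S * exp (h t) / 4 \<le> f s * v t" if s: "\<bar>s - t\<bar> \<le> \<eta> / n" for s
      proof -
        have "\<eta> / n \<le> (\<kappa> / n) / 2" using divide_right_mono[OF \<eta>(3), of n] by simp
        then have "norm (poly P (of_real (cos s)) - poly P (of_real (cos t))) \<le> 2 * Y / (\<kappa> / n) * \<bar>s - t\<bar>"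
          using s by (intro lipschitz_of_disc[OF disc \<kappa>n]) auto
        also have "\<dots> \<le> 2 * Y / (\<kappa> / n) * (\<eta> / n)"
          using s \<kappa>n \<open>0 \<le> Y\<close> by (intro mult_left_mono divide_nonneg_pos) auto
        also have "\<dots> = Y / (4 * M)" unfolding \<eta>_def using \<kappa> n0 M by (simp add: field_simps)
        also have "\<dots> = S * exp (h t) / v t / 4" unfolding Y_def using M by simp
        finally have "norm (poly P (of_real (cos s)) - poly P (of_real (cos t))) \<le> S * exp (h t) / v t / 4" .
        then have "f t - S * exp (h t) / v t / 4 \<le> f s"
          unfolding f_def using norm_triangle_ineq2[of "poly P (of_real (cos t))" "poly P (of_real (cos s))"]
          by (simp add: norm_minus_commute)
        then have "(f t - S * exp (h t) / v t / 4) * v t \<le> f s * v t" using vt by (intro mult_right_mono) auto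
        then show ?thesis using Se vt by (simp add: left_diff_distrib)
      qed
      obtain s where s: "v t / 2 * (1 + real n * \<bar>s - t\<bar>) ^ k < u (cos s)" using vsup[of "v t / 2" t] vt by auto
      have \<eta>n: "0 < \<eta> / n" "\<eta> / n \<le> 1" using \<eta> n0 by (auto simp: divide_le_eq)
      obtain t' where t': "\<bar>t' - t\<bar> \<le> \<eta> / n" "cos t' \<notin> N"
        "u (cos s) \<le> C1 * (1 + \<bar>s - t\<bar> / (\<eta> / n)) ^ k * u (cos t')"
        using doubling[OF \<eta>n N] by blast
      have vC: "v t \<le> C2 * u (cos t')"
      proof -
        have "1 + \<bar>s - t\<bar> / (\<eta> / n) = 1 + (real n * \<bar>s - t\<bar>) / \<eta>" by simp
        also have "\<dots> \<le> 1 / \<eta> + (real n * \<bar>s - t\<bar>) / \<eta>" using \<eta> by simp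
        also have "\<dots> = (1 + real n * \<bar>s - t\<bar>) / \<eta>" by (simp add: add_divide_distrib)
        finally have "(1 + \<bar>s - t\<bar> / (\<eta> / n)) ^ k \<le> ((1 + real n * \<bar>s - t\<bar>) / \<eta>) ^ k"
          using \<eta> by (intro power_mono) auto
        then have "C1 * (1 + \<bar>s - t\<bar> / (\<eta> / n)) ^ k * u (cos t') \<le> C1 * ((1 + real n * \<bar>s - t\<bar>) / \<eta>) ^ k * u (cos t')"
          using C1 uc by (intro mult_right_mono mult_left_mono) auto
        then have "v t / 2 * (1 + real n * \<bar>s - t\<bar>) ^ k \<le> C1 * ((1 + real n * \<bar>s - t\<bar>) / \<eta>) ^ k * u (cos t')"
          using s t'(3) by linarith
        also have "\<dots> = (C1 / \<eta> ^ k * u (cos t')) * (1 + real n * \<bar>s - t\<bar>) ^ k" by (simp add: power_divide)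
        finally have "v t / 2 \<le> C1 / \<eta> ^ k * u (cos t')" by (rule mult_right_le_imp_le) (simp add: add_pos_nonneg)
        then show ?thesis unfolding C2_def by (simp add: mult_ac)
      qed
      have "\<eta> / n \<le> \<kappa> / n" using \<eta>(4) by (intro divide_right_mono) auto
      then have tZ: "t' \<notin> Z" "H t' \<le> H t + M" using near[of t'] t'(1) by auto
      have "f t' * (exp (- H t') * u (cos t')) \<le> m"
        using bd[of "cos t'"] t'(2) tZ unfolding W f_def by simp
      then have fm: "f t' * u (cos t') \<le> m * exp (H t')" by (simp add: exp_minus field_simps)
      have "S * exp (h t) / 4 \<le> f t' * v t" by (rule close[OF t'(1)])
      also have "\<dots> \<le> f t' * (C2 * u (cos t'))" by (intro mult_left_mono f0 vC)
      also have "\<dots> = C2 * (f t' * u (cos t'))" by simp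
      also have "\<dots> \<le> C2 * (m * exp (H t'))" using C2 fm by (intro mult_left_mono) auto
      also have "\<dots> \<le> C2 * (m * exp (h t + M))" using C2 m tZ(2) unfolding ht by (intro mult_left_mono) auto
      also have "\<dots> = (C2 * exp M * m) * exp (h t)" by (simp add: exp_add)
      finally have "S / 4 * exp (h t) \<le> (C2 * exp M * m) * exp (h t)" by simp
      then have "S / 4 \<le> C2 * exp M * m" by (rule mult_right_le_imp_le) simp
      then show ?thesis by simp
    qed
    define t where "t = arccos x"
    have t: "0 \<le> t" "t \<le> pi" "x = cos t" unfolding t_def using x by (auto simp: arccos_lbound arccos_ubound)
    show ?thesis
    proof (cases "t \<in> Z \<or> v t = 0")
      case True
      have Wu: "W x * u x = 0"
      proof (cases "t \<in> Z")
        case False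
        then have "u (cos t) = 0" using True uv[of t] uc(1)[of t] by simp
        then show ?thesis using t by simp
      qed (simp add: W t)
      show ?thesis unfolding Wu using \<open>0 < K\<close> m by simp
    next
      case False
      then have vt: "0 < v t" using v0[of t] by simp
      define Y where "Y = M * S * exp (h t) / v t"
      have "norm (poly (pderiv P) (of_real (cos t))) \<le> 32 * Y / (\<kappa> / n)\<^sup>2"
      proof (rule markov_of_disc[OF _ _ _ t(1,2)])
        show "norm (poly P (cos w)) \<le> Y" if "norm (w - of_real t) \<le> \<kappa> / n" for w
          using bern[OF that] vt unfolding Y_def by (simp add: pos_le_divide_eq)
        show "0 < \<kappa> / n" "\<kappa> / n \<le> 1" using \<kappa> n0 by (auto simp: divide_le_eq)
      qed
      moreover have "W x * u x \<le> exp (- h t) * v t"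
        using False hH[of t] uv[of t] uc(1)[of t] unfolding t(3) W by (auto intro!: mult_mono)
      moreover have "0 \<le> 32 * Y / (\<kappa> / n)\<^sup>2" unfolding Y_def using M S0 vt by simp
      moreover have "0 \<le> W x * u x" unfolding t(3) W using uc(1)[of t] by simp
      ultimately have "norm (poly (pderiv P) (of_real x)) * (W x * u x) \<le> (32 * Y / (\<kappa> / n)\<^sup>2) * (exp (- h t) * v t)"
        unfolding t(3) by (rule mult_mono)
      also have "\<dots> = 32 * M / \<kappa>\<^sup>2 * (real n)\<^sup>2 * S"
        unfolding Y_def using vt by (simp add: exp_minus power_divide field_simps)
      also have "\<dots> \<le> 32 * M / \<kappa>\<^sup>2 * (real n)\<^sup>2 * (4 * C2 * exp M * m)"
        using M by (intro mult_left_mono Sm) auto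
      also have "\<dots> = K * (real n)\<^sup>2 * m" unfolding K_def by simp
      finally show ?thesis .
    qed
  qed
  ultimately show thesis by (rule that)
qed

text \<open>
  The weight is continuous off a finite set and vanishes on that set.
\<close>

lemma singular_factor_measurable:
  assumes fac: "singular_factor Z h" and w: "\<And>t. w (cos t) = (if t \<in> Z then 0 else exp (- h t))"
  shows "w \<in> borel_measurable (lebesgue_on {-1..1})"
proof -
  define N where "N = cos ` (Z \<inter> {-1..2 * pi + 1})"
  have "finite N" unfolding N_def using singular_factor.finite_on_period[OF fac] by simp
  have arc: "x = cos (arccos x)" "arccos x \<in> {-1..2 * pi + 1}" if "x \<in> {-1..1}" for x
    using that arccos_lbound[of x] arccos_ubound[of x] pi_gt_zero by auto
  have zero: "w x = 0" if "x \<in> N" for x using that w unfolding N_def by auto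
  have arcZ: "arccos x \<notin> Z" if "x \<in> {-1..1} - N" for x
    using that arc[of x] unfolding N_def by blast
  have "continuous_on ({-1..1} - N) w"
  proof (rule continuous_on_cong[THEN iffD1, OF refl])
    show "exp (- h (arccos x)) = w x" if "x \<in> {-1..1} - N" for x
      using w[of "arccos x"] arc[of x] arcZ[OF that] that by simp
    note hcont = singular_factor.continuous[OF fac]
    have "continuous_on ({-1..1} - N) arccos" by (rule continuous_on_subset[OF continuous_on_arccos']) auto
    then have "continuous_on ({-1..1} - N) (\<lambda>x. h (arccos x))"
      by (rule continuous_on_compose2[OF hcont]) (use arcZ in blast)
    then show "continuous_on ({-1..1} - N) (\<lambda>x. exp (- h (arccos x)))"
      by (intro continuous_on_exp continuous_on_minus)
  qed
  moreover have diff: "{-1..1} - N \<in> sets lebesgue" using \<open>finite N\<close> by (intro sets.Diff) (simp_all add: negligible_imp_sets negligible_finite)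
  ultimately have "w \<in> borel_measurable (lebesgue_on ({-1..1} - N))"
    by (rule continuous_imp_measurable_on_sets_lebesgue)
  then have "(\<lambda>x. if x \<in> {-1..1} - N then w x else 0) \<in> borel_measurable lebesgue"
    by (simp only: borel_measurable_if[OF diff])
  also have "(\<lambda>x. if x \<in> {-1..1} - N then w x else 0) = (\<lambda>x. if x \<in> {-1..1} then w x else 0)"
    using zero by auto
  finally show ?thesis by (rule borel_measurable_if[THEN iffD1, rotated]) simp
qed

theorem theorem7p4:
  fixes s :: nat and \<omega> :: "nat \<Rightarrow> real \<Rightarrow> real" and u :: "real \<Rightarrow> real"
  assumes "s \<ge> 1"
    and "\<And>i. i \<in> {1..s} \<Longrightarrow> (\<lambda>t. \<omega> i (cos t)) \<in> Omega"
    and "A_star_weight u"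
  shows "\<exists>C::real. \<forall>n\<ge>1. \<forall>P :: complex poly. degree P \<le> n \<longrightarrow>
    Linf_norm (\<lambda>x. poly (pderiv P) (of_real x) * of_real ((\<Prod>i=1..s. \<omega> i x) * u x))
      \<le> ereal (C * (real n)\<^sup>2) *
         Linf_norm (\<lambda>x. poly P (of_real x) * of_real ((\<Prod>i=1..s. \<omega> i x) * u x))"
proof -
  have "\<forall>i\<in>{1..s}. \<exists>Z h. singular_factor Z h \<and> (\<forall>t. \<omega> i (cos t) = (if t \<in> Z then 0 else exp (- h t)))"
  proof
    fix i assume "i \<in> {1..s}"
    obtain Z h where "singular_factor Z h" "\<And>t. \<omega> i (cos t) = (if t \<in> Z then 0 else exp (- h t))"
      by (fact Omega_singular_factor[OF assms(2)[OF \<open>i \<in> {1..s}\<close>]])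
    then show "\<exists>Z h. singular_factor Z h \<and> (\<forall>t. \<omega> i (cos t) = (if t \<in> Z then 0 else exp (- h t)))"
      by blast
  qed
  from bchoice[OF this] obtain Zi where
    "\<forall>i\<in>{1..s}. \<exists>h. singular_factor (Zi i) h \<and> (\<forall>t. \<omega> i (cos t) = (if t \<in> Zi i then 0 else exp (- h t)))"
    by blast
  from bchoice[OF this] obtain h where
    h: "\<forall>i\<in>{1..s}. singular_factor (Zi i) (h i) \<and> (\<forall>t. \<omega> i (cos t) = (if t \<in> Zi i then 0 else exp (- h i t)))"
    by blast
  have fac: "singular_factor (Zi i) (h i)"
    and \<omega>: "\<omega> i (cos t) = (if t \<in> Zi i then 0 else exp (- h i t))" if "i \<in> {1..s}" for i t
    using conjunct1[OF bspec[OF h that]] spec[OF conjunct2[OF bspec[OF h that]]] .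
  define Z where "Z = (\<Union>i\<in>{1..s}. Zi i)"
  define H where "H = (\<lambda>t. 1 + (\<Sum>i=1..s. h i t))"
  define w where "w = (\<lambda>x. \<Prod>i=1..s. \<omega> i x)"
  \<comment> \<open>the factor \<open>exp 1\<close> accounts for the summand \<open>1\<close> in \<open>H\<close>\<close>
  define W where "W = (\<lambda>x. w x / exp 1)"
  have "\<exists>c C \<alpha>. singular_exponent H Z c C \<alpha>"
    unfolding H_def Z_def by (rule singular_exponent_sum) (simp, rule fac)
  then obtain c C \<alpha> where sing: "singular_exponent H Z c C \<alpha>" by blast
  have W: "W (cos t) = (if t \<in> Z then 0 else exp (- H t))" for t
  proof (cases "t \<in> Z")
    case True
    then obtain i where "i \<in> {1..s}" "t \<in> Zi i" unfolding Z_def by blast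
    then have "w (cos t) = 0" unfolding w_def using \<omega> by (intro prod_zero) auto
    then show ?thesis using True unfolding W_def by simp
  next
    case False
    then have "w (cos t) = (\<Prod>i=1..s. exp (- h i t))"
      unfolding w_def Z_def using \<omega> by (intro prod.cong) auto
    also have "\<dots> = exp (- (\<Sum>i=1..s. h i t))" by (simp add: exp_sum flip: sum_negf)
    finally show ?thesis using False unfolding W_def H_def by (simp add: algebra_simps flip: exp_diff)
  qed
  obtain K where K: "0 < K" and markov: "\<And>n (P :: complex poly) m N x. 1 \<le> n \<Longrightarrow> degree P \<le> n \<Longrightarrow> negligible N \<Longrightarrow> 0 \<le> m \<Longrightarrow>
      (\<And>x. x \<in> {-1..1} \<Longrightarrow> x \<notin> N \<Longrightarrow> norm (poly P (of_real x)) * (W x * u x) \<le> m) \<Longrightarrow>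
      x \<in> {-1..1} \<Longrightarrow> norm (poly (pderiv P) (of_real x)) * (W x * u x) \<le> K * (real n)\<^sup>2 * m"
    by (fact weighted_markov[OF sing assms(3) W])
  have u0: "0 \<le> u x" if "x \<in> {-1..1}" for x
    using assms(3) that unfolding A_star_weight_def weight_def by blast
  have wu: "exp 1 * (W x * u x) = w x * u x" for x unfolding W_def by simp
  have w0: "0 \<le> w x * u x" if x: "x \<in> {-1..1}" for x
  proof -
    have "0 \<le> W (cos (arccos x))" unfolding W by simp
    then have "0 \<le> W x" using x by simp
    then have "0 \<le> w x" unfolding W_def by (simp add: zero_le_divide_iff)
    then show ?thesis using u0[OF x] by simp
  qed
  have norm_wu: "norm (poly Q (of_real x) * of_real (w x * u x)) = exp 1 * (norm (poly Q (of_real x)) * (W x * u x))"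
    if "x \<in> {-1..1}" for Q :: "complex poly" and x
  proof -
    have "norm (poly Q (of_real x) * of_real (w x * u x)) = norm (poly Q (of_real x)) * (w x * u x)"
      using w0[OF that] by (simp only: norm_mult norm_of_real abs_of_nonneg)
    then show ?thesis unfolding wu[symmetric] by (simp only: mult.left_commute)
  qed
  have meas: "(\<lambda>x. ereal (norm (poly Q (of_real x) * of_real (w x * u x)))) \<in> borel_measurable (lebesgue_on {-1..1})"
    for Q :: "complex poly"
  proof -
    have "set_integrable lebesgue {-1..1} u" using assms(3) unfolding A_star_weight_def weight_def by blast
    then have "integrable (lebesgue_on {-1..1}) u"
      unfolding set_integrable_def by (simp add: integrable_restrict_space)
    then have [measurable]: "u \<in> borel_measurable (lebesgue_on {-1..1})" by (rule borel_measurable_integrable)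
    have [measurable]: "w \<in> borel_measurable (lebesgue_on {-1..1})"
      unfolding w_def by (intro borel_measurable_prod singular_factor_measurable[OF fac \<omega>])
    have [measurable]: "(\<lambda>x. poly Q (of_real x)) \<in> borel_measurable (lebesgue_on {-1..1})"
      by (intro continuous_imp_measurable_on_sets_lebesgue continuous_intros) auto
    show ?thesis by measurable
  qed
  have "Linf_norm (\<lambda>x. poly (pderiv P) (of_real x) * of_real (w x * u x))
      \<le> ereal (K * (real n)\<^sup>2) * Linf_norm (\<lambda>x. poly P (of_real x) * of_real (w x * u x))"
    if n: "1 \<le> n" and deg: "degree P \<le> n" for n and P :: "complex poly"
  proof -
    define E where "E = Linf_norm (\<lambda>x. poly P (of_real x) * of_real (w x * u x))"
    have "0 \<le> E"
    proof -
      have "emeasure (lebesgue_on {-1..1::real}) (space (lebesgue_on {-1..1})) \<noteq> 0"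
        by (simp add: emeasure_restrict_space)
      then have "esssup (lebesgue_on {-1..1::real}) (\<lambda>_. 0 :: ereal) = 0" by (rule esssup_const)
      moreover have "esssup (lebesgue_on {-1..1::real}) (\<lambda>_. 0 :: ereal) \<le> E"
        unfolding E_def Linf_norm_def by (rule esssup_mono) auto
      ultimately show ?thesis by simp
    qed
    show ?thesis
    proof (cases E)
      case PInf
      then have top: "ereal (K * (real n)\<^sup>2) * E = \<infinity>" using K n by simp
      show ?thesis unfolding E_def[symmetric] top by simp
    next
      case MInf
      then show ?thesis using \<open>0 \<le> E\<close> by simp
    next
      case (real m)
      then have m: "0 \<le> m" using \<open>0 \<le> E\<close> by simp
      have "AE x in lebesgue_on {-1..1}. ereal (norm (poly P (of_real x) * of_real (w x * u x))) \<le> ereal m"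
        using esssup_AE[of "\<lambda>x. ereal (norm (poly P (of_real x) * of_real (w x * u x)))" "lebesgue_on {-1..1}"]
        unfolding real[symmetric] E_def Linf_norm_def .
      then have "AE x in lebesgue. x \<in> {-1..1} \<longrightarrow> norm (poly P (of_real x) * of_real (w x * u x)) \<le> m"
        by (simp add: AE_restrict_space_iff)
      then obtain N where N: "N \<in> null_sets lebesgue"
        "\<And>x. x \<in> {-1..1} \<Longrightarrow> x \<notin> N \<Longrightarrow> norm (poly P (of_real x) * of_real (w x * u x)) \<le> m"
        unfolding eventually_ae_filter by auto
      have bd: "norm (poly P (of_real x)) * (W x * u x) \<le> m / exp 1" if "x \<in> {-1..1}" "x \<notin> N" for x
        using N(2)[OF that] norm_wu[OF that(1), of P] by (simp add: field_simps)
      have "norm (poly (pderiv P) (of_real x) * of_real (w x * u x)) \<le> K * (real n)\<^sup>2 * m" if x: "x \<in> {-1..1}" for x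
      proof -
        have "norm (poly (pderiv P) (of_real x)) * (W x * u x) \<le> K * (real n)\<^sup>2 * (m / exp 1)"
          by (rule markov[OF n deg _ _ bd x]) (use N(1) m in \<open>auto simp: negligible_iff_null_sets\<close>)
        then have "exp 1 * (norm (poly (pderiv P) (of_real x)) * (W x * u x)) \<le> exp 1 * (K * (real n)\<^sup>2 * (m / exp 1))"
          by (intro mult_left_mono) auto
        then show ?thesis unfolding norm_wu[OF x] by simp
      qed
      then have "AE x in lebesgue_on {-1..1}. ereal (norm (poly (pderiv P) (of_real x) * of_real (w x * u x))) \<le> ereal (K * (real n)\<^sup>2 * m)"
        by (intro AE_I2) simp
      then have "Linf_norm (\<lambda>x. poly (pderiv P) (of_real x) * of_real (w x * u x)) \<le> ereal (K * (real n)\<^sup>2 * m)"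
        unfolding Linf_norm_def by (rule esssup_I[OF meas])
      then show ?thesis unfolding E_def[symmetric] real by simp
    qed
  qed
  then show ?thesis unfolding w_def by blast
qed

end
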